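(* Let $n_X,n_Y$ be positive integers and let $S$ be a homogeneous polynomial on $\mathbb{R}^{n_X}\times\mathbb{R}^{n_Y}$ with real coefficients and degree $d>n_X+n_Y$. Let $\varphi$ be a smooth cut-off function with compact support near the origin in $\mathbb{R}^{n_X}\times\mathbb{R}^{n_Y}$, and for $\lambda\in\mathbb{R}$ define \[ T_{\lambda}f(x)=\int_{\mathbb{R}^{n_Y}}e^{i\lambda S(x,y)}\varphi(x,y)f(y)\,dy,\qquad x\in\mathbb{R}^{n_X}. \] Suppose $S$ satisfies the rank one condition, i.e. there is no $(x,y)\in(\mathbb{R}^{n_X}\times\mathbb{R}^{n_Y})\setminus\{(0,0)\}$ with $\partial_{x_i}\partial_{y_j}S(x,y)=0$ for all $1\le i\le n_X$, $1\le j\le n_Y$. Then for every $p$ with \[ \frac{d-n_Y+n_X}{d-n_Y}<p<\frac{d-n_X+n_Y}{n_Y} \] there exists a constant $C=C(S,\varphi,p)$ such that for all $\lambda\neq 0$, \[ \|T_{\lambda}f\|_{L^p(\mathbb{R}^{n_X})}\le C|\lambda|^{-\gamma}\|f\|_{L^p(\mathbb{R}^{n_Y})},\qquad \gamma=\frac{n_X}{d}\cdot\frac1p+\frac{n_Y}{d}\cdot\frac1{p'}, \] where $1/p'=1-1/p$. Moreover, this estimate is sharp if $\varphi$ does not vanish near the origin: in that case there is $c>0$ such that the $L^p$ operator norm of $T_{\lambda}$ is at least $c|\lambda|^{-\gamma}$ for all sufficiently large $|\lambda|$. *)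

theory Defs
  imports "HOL-Analysis.Analysis"
begin

definition homogeneous_poly :: "nat \<Rightarrow> (real^'n \<Rightarrow> real^'m \<Rightarrow> real) \<Rightarrow> bool" where
  "homogeneous_poly d S \<longleftrightarrow>
     (\<exists>c :: ('n \<Rightarrow> nat) \<Rightarrow> ('m \<Rightarrow> nat) \<Rightarrow> real.
        \<forall>x y. S x y =
          (\<Sum>(\<alpha>,\<beta>) \<in> {(\<alpha>,\<beta>). sum \<alpha> UNIV + sum \<beta> UNIV = d}.
              c \<alpha> \<beta> * (\<Prod>i\<in>UNIV. (x $ i) ^ \<alpha> i) * (\<Prod>j\<in>UNIV. (y $ j) ^ \<beta> j)))"

fun higher_diff :: "nat \<Rightarrow> ('a::real_normed_vector \<Rightarrow> 'b::real_normed_vector) \<Rightarrow> bool" where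
  "higher_diff 0 f = continuous_on UNIV f"
| "higher_diff (Suc k) f =
     (f differentiable_on UNIV \<and> continuous_on UNIV f \<and>
      (\<forall>v. higher_diff k (\<lambda>x. frechet_derivative f (at x) v)))"

definition smooth :: "('a::real_normed_vector \<Rightarrow> 'b::real_normed_vector) \<Rightarrow> bool" where
  "smooth f \<longleftrightarrow> (\<forall>k. higher_diff k f)"

definition mixed_partial :: "(real^'n \<Rightarrow> real^'m \<Rightarrow> real) \<Rightarrow> 'n \<Rightarrow> 'm \<Rightarrow> real^'n \<Rightarrow> real^'m \<Rightarrow> real" where
  "mixed_partial S i j x y =
     frechet_derivative
       (\<lambda>x'. frechet_derivative (\<lambda>y'. S x' y') (at y) (axis j 1))
       (at x) (axis i 1)"

definition rank_one_condition :: "(real^'n \<Rightarrow> real^'m \<Rightarrow> real) \<Rightarrow> bool" where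
  "rank_one_condition S \<longleftrightarrow>
     \<not> (\<exists>x y. (x, y) \<noteq> (0, 0) \<and> (\<forall>i j. mixed_partial S i j x y = 0))"

definition osc_op :: "(real^'n \<Rightarrow> real^'m \<Rightarrow> real) \<Rightarrow> (real^'n \<Rightarrow> real^'m \<Rightarrow> real) \<Rightarrow> real
     \<Rightarrow> (real^'m \<Rightarrow> complex) \<Rightarrow> real^'n \<Rightarrow> complex" where
  "osc_op S \<phi> lam f x =
     (\<integral>y. exp (\<i> * complex_of_real (lam * S x y)) * complex_of_real (\<phi> x y) * f y \<partial>lborel)"

definition memLp :: "real \<Rightarrow> ('a::euclidean_space \<Rightarrow> complex) \<Rightarrow> bool" where
  "memLp p f \<longleftrightarrow> f \<in> borel_measurable lborel \<and> integrable lborel (\<lambda>x. norm (f x) powr p)"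

definition Lp_norm :: "real \<Rightarrow> ('a::euclidean_space \<Rightarrow> complex) \<Rightarrow> real" where
  "Lp_norm p f = (\<integral>x. norm (f x) powr p \<partial>lborel) powr (1 / p)"

definition Lp_opnorm :: "real \<Rightarrow> (('a::euclidean_space \<Rightarrow> complex) \<Rightarrow> ('b::euclidean_space \<Rightarrow> complex)) \<Rightarrow> real" where
  "Lp_opnorm p T = Sup {Lp_norm p (T f) | f. memLp p f \<and> Lp_norm p f \<le> 1}"

end

theory Submission
  imports Defs
begin

text \<open>
  Split \<open>\<real>\<^bsup>n\<^esup> \<times> \<real>\<^bsup>m\<^esup>\<close> into dyadic annuli of radius \<open>\<rho>\<close>. On an annulus the rank one condition and compactness
  provide finitely many boxes, each with a mixed derivative \<open>\<partial>\<^sub>i\<partial>\<^sub>jS\<close> of size at least \<open>\<kappa> \<rho>\<^bsup>d-2\<^esup>\<close>.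
  Freezing all variables but \<open>x\<^sub>i\<close> and \<open>y\<^sub>j\<close>, one integration by parts in the kernel of \<open>T\<^sup>*T\<close>
  gives, up to an \<open>\<epsilon>\<close> loss, the decay \<open>(|\<lambda>|\<rho>\<^sup>d)\<^bsup>-1/2\<^esup>\<close> on \<open>L\<^sup>2\<close>; since boundary terms
  obey the same bound, sharp cut-offs to boxes are harmless. Interpolation with the trivial bounds
  gives the decay \<open>(|\<lambda>|\<rho>\<^sup>d)\<^bsup>-\<delta>\<^esup>\<close> with \<open>\<delta>\<close> close to \<open>min (1/p) (1/p')\<close>, relative to the trivial bound
  \<open>\<rho>\<^bsup>d\<gamma>\<^esup>\<close>. The open range of \<open>p\<close> is exactly \<open>\<gamma> < min (1/p) (1/p')\<close>, so the annuli with
  \<open>\<rho> \<ge> |\<lambda>|\<^bsup>-1/d\<^esup>\<close> sum geometrically to \<open>|\<lambda>|\<^bsup>-\<gamma>\<^esup>\<close>, and the remaining cube obeys the trivial bound.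
  All of this is done for the bilinear form \<open>\<integral>\<integral> K(x,y) f(y) g(x)\<close>, which treats \<open>p \<le> 2\<close> and
  \<open>p \<ge> 2\<close> symmetrically.
\<close>

section \<open>Nonstationary phase on the line\<close>

text \<open>Only one mixed derivative is under control near a given point, and which one varies from
  point to point. The other n + m - 2 variables show no usable oscillation and enter through the
  volume of the boxes alone, so the gain on square-integrable functions is the one-dimensional
  exponent 1/2 in every dimension. With \<mu> = |\<lambda>| \<rho>^d, the kernel of T*T on a pair of
  coordinate lines is at most a constant times min(\<rho>, \<rho>^2 / (\<mu> |t - t'|)). Its
  integral in t' carries a logarithm; the weaker bound by the power |t - t'|^(\<epsilon> - 1) avoids
  it, and the open range of p leaves a gap between \<gamma> and min (1/p) (1/p') out of which
  \<epsilon> is paid. After scaling, \<mu> is the only parameter: the derivatives of S scale by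
  homogeneity, and the cut-off is measured by the scale-invariant quantity |\<partial>\<phi>|
  |(x,y)|. Hence all annuli obey one estimate with one number of boxes. The forms are estimated for
  bounded functions of bounded support, where Fubini and duality are free; truncation then reaches
  L^p.\<close>

text \<open>Integration by parts once, dividing by the derivative \<open>\<Phi>1\<close> of the
  phase. The term \<open>2 * M\<close> is the boundary contribution, since \<open>u\<close> does not
  have to vanish at the ends. The bound on \<open>\<Phi>2\<close> does the work that monotonicity of
  \<open>\<Phi>1\<close> would do.\<close>

lemma nonstationary_phase_bound:
  fixes \<Phi> \<Phi>1 \<Phi>2 u u1 :: "real \<Rightarrow> real"
  assumes ab: "a \<le> b" and lam: "lam \<noteq> 0" and \<kappa>: "\<kappa> > 0"
    and d1: "\<And>s. s \<in> {a..b} \<Longrightarrow> (\<Phi> has_real_derivative \<Phi>1 s) (at s)"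
    and d2: "\<And>s. s \<in> {a..b} \<Longrightarrow> (\<Phi>1 has_real_derivative \<Phi>2 s) (at s)"
    and d3: "\<And>s. s \<in> {a..b} \<Longrightarrow> (u has_real_derivative u1 s) (at s)"
    and b1: "\<And>s. s \<in> {a..b} \<Longrightarrow> \<kappa> \<le> \<bar>\<Phi>1 s\<bar>"
    and b2: "\<And>s. s \<in> {a..b} \<Longrightarrow> \<bar>\<Phi>2 s\<bar> \<le> \<kappa>2"
    and b3: "\<And>s. s \<in> {a..b} \<Longrightarrow> \<bar>u s\<bar> \<le> M"
    and b4: "\<And>s. s \<in> {a..b} \<Longrightarrow> \<bar>u1 s\<bar> \<le> M1"
  shows "norm (\<integral>s. indicator {a..<b} s *\<^sub>R (exp (\<i> * complex_of_real (lam * \<Phi> s)) * complex_of_real (u s)) \<partial>lborel)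
     \<le> (2 * M + (b - a) * (M1 + M * \<kappa>2 / \<kappa>)) / (\<bar>lam\<bar> * \<kappa>)"
proof -
  define E where "E s = exp (\<i> * complex_of_real (lam * \<Phi> s))" for s
  \<comment> \<open>\<open>G\<close> has derivative \<open>\<i> * lam * E * u + R\<close>, so the
    integral wanted is the difference of \<open>G b - G a\<close> and the integral of
    \<open>R\<close>, divided by \<open>\<i> * lam\<close>.\<close>
  define G where "G s = E s * complex_of_real (u s / \<Phi>1 s)" for s
  define R where "R s = E s * complex_of_real ((u1 s * \<Phi>1 s - u s * \<Phi>2 s) / (\<Phi>1 s * \<Phi>1 s))" for s
  have nE: "norm (E s) = 1" for s unfolding E_def by simp
  have nz: "\<Phi>1 s \<noteq> 0" if "s \<in> {a..b}" for s using b1[OF that] \<kappa> by auto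
  have M0: "M \<ge> 0" using b3[of a] ab by (meson abs_ge_zero atLeastAtMost_iff order_refl order_trans)
  have \<kappa>20: "\<kappa>2 \<ge> 0" using b2[of a] ab by (meson abs_ge_zero atLeastAtMost_iff order_refl order_trans)
  have M10: "M1 \<ge> 0" using b4[of a] ab by (meson abs_ge_zero atLeastAtMost_iff order_refl order_trans)
  have dE: "(E has_vector_derivative (\<i> * complex_of_real (lam * \<Phi>1 s) * E s)) (at s)" if "s \<in> {a..b}" for s
  proof -
    have "((\<lambda>s. complex_of_real (lam * \<Phi> s)) has_vector_derivative complex_of_real (lam * \<Phi>1 s)) (at s)"
      by (rule has_vector_derivative_of_real) (auto intro!: derivative_eq_intros d1[OF that])
    then have "((\<lambda>s. \<i> * complex_of_real (lam * \<Phi> s)) has_vector_derivative \<i> * complex_of_real (lam * \<Phi>1 s)) (at s)"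
      by (rule has_vector_derivative_mult_right)
    from field_vector_diff_chain_at[OF this, of exp "exp (\<i> * complex_of_real (lam * \<Phi> s))"]
    show ?thesis unfolding E_def o_def by (auto simp: DERIV_exp algebra_simps)
  qed
  have dG: "(G has_vector_derivative (\<i> * complex_of_real lam * (E s * complex_of_real (u s)) + R s)) (at s)"
    if s: "s \<in> {a..b}" for s
  proof -
    have "((\<lambda>s. complex_of_real (u s / \<Phi>1 s)) has_vector_derivative
       complex_of_real ((u1 s * \<Phi>1 s - u s * \<Phi>2 s) / (\<Phi>1 s * \<Phi>1 s))) (at s)"
      by (rule has_vector_derivative_of_real) (rule DERIV_divide[OF d3[OF s] d2[OF s] nz[OF s]])
    from has_vector_derivative_mult[OF dE[OF s] this]
    show ?thesis unfolding G_def R_def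
      by (rule has_vector_derivative_eq_rhs) (use nz[OF s] in \<open>simp add: field_simps\<close>)
  qed
  have cont: "continuous_on {a..b} (\<lambda>s. E s * complex_of_real (u s))"
  proof -
    have "continuous_on {a..b} E" using dE has_vector_derivative_continuous
      by (metis continuous_at_imp_continuous_on)
    moreover have "continuous_on {a..b} u" using d3 DERIV_isCont continuous_at_imp_continuous_on by blast
    ultimately show ?thesis by (intro continuous_intros)
  qed
  define I where "I = integral {a..b} (\<lambda>s. E s * complex_of_real (u s))"
  have hI: "((\<lambda>s. E s * complex_of_real (u s)) has_integral I) {a..b}"
    unfolding I_def using integrable_continuous_real[OF cont] by (rule integrable_integral)
  have "((\<lambda>s. \<i> * complex_of_real lam * (E s * complex_of_real (u s)) + R s) has_integral (G b - G a)) {a..b}"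
    by (rule fundamental_theorem_of_calculus[OF ab])
       (use dG in \<open>auto intro: has_vector_derivative_at_within\<close>)
  from has_integral_diff[OF this has_integral_mult_right[OF hI, of "\<i> * complex_of_real lam"]]
  have hR: "(R has_integral (G b - G a - \<i> * complex_of_real lam * I)) {a..b}" by simp
  have bR: "norm (R s) \<le> M1 / \<kappa> + M * \<kappa>2 / (\<kappa> * \<kappa>)" if s: "s \<in> {a..b}" for s
  proof -
    have "(u1 s * \<Phi>1 s - u s * \<Phi>2 s) / (\<Phi>1 s * \<Phi>1 s) = u1 s / \<Phi>1 s - u s * \<Phi>2 s / (\<Phi>1 s * \<Phi>1 s)"
      using nz[OF s] by (simp add: field_simps)
    moreover have "norm (R s) = \<bar>(u1 s * \<Phi>1 s - u s * \<Phi>2 s) / (\<Phi>1 s * \<Phi>1 s)\<bar>"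
      unfolding R_def norm_mult nE norm_of_real by simp
    ultimately have "norm (R s) \<le> \<bar>u1 s\<bar> / \<bar>\<Phi>1 s\<bar> + \<bar>u s\<bar> * \<bar>\<Phi>2 s\<bar> / (\<bar>\<Phi>1 s\<bar> * \<bar>\<Phi>1 s\<bar>)"
      using abs_triangle_ineq4[of "u1 s / \<Phi>1 s" "u s * \<Phi>2 s / (\<Phi>1 s * \<Phi>1 s)"] by (simp add: abs_mult abs_divide)
    also have "\<dots> \<le> M1 / \<kappa> + M * \<kappa>2 / (\<kappa> * \<kappa>)"
      using \<kappa> M0 M10 \<kappa>20 b1[OF s] b2[OF s] b3[OF s] b4[OF s]
      by (intro add_mono frac_le mult_mono) auto
    finally show ?thesis .
  qed
  have bG: "norm (G s) \<le> M / \<kappa>" if s: "s \<in> {a..b}" for s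
    unfolding G_def norm_mult nE norm_of_real using b1[OF s] b3[OF s] \<kappa> M0
    by (simp add: abs_divide) (intro frac_le; simp)
  have "norm (G b - G a - \<i> * complex_of_real lam * I) \<le> (M1 / \<kappa> + M * \<kappa>2 / (\<kappa> * \<kappa>)) * (b - a)"
    using has_integral_bound_real[OF _ finite.emptyI hR, of "M1 / \<kappa> + M * \<kappa>2 / (\<kappa> * \<kappa>)"] bR M0 M10 \<kappa>20 \<kappa> ab by simp
  moreover have "norm (G b - G a) \<le> 2 * M / \<kappa>"
    using norm_triangle_ineq4[of "G b" "G a"] bG[of a] bG[of b] ab by auto
  moreover have "norm (\<i> * complex_of_real lam * I) \<le> norm (G b - G a) + norm (G b - G a - \<i> * complex_of_real lam * I)"
    by (metis norm_minus_commute norm_triangle_sub)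
  ultimately have "\<bar>lam\<bar> * norm I \<le> 2 * M / \<kappa> + (M1 / \<kappa> + M * \<kappa>2 / (\<kappa> * \<kappa>)) * (b - a)"
    by (simp add: norm_mult)
  then have "norm I \<le> (2 * M / \<kappa> + (M1 / \<kappa> + M * \<kappa>2 / (\<kappa> * \<kappa>)) * (b - a)) / \<bar>lam\<bar>"
    using lam by (simp add: field_simps)
  also have "\<dots> = (2 * M + (b - a) * (M1 + M * \<kappa>2 / \<kappa>)) / (\<bar>lam\<bar> * \<kappa>)"
    using lam \<kappa> by (simp add: field_simps)
  finally have bI: "norm I \<le> (2 * M + (b - a) * (M1 + M * \<kappa>2 / \<kappa>)) / (\<bar>lam\<bar> * \<kappa>)" .
  define F where "F s = indicator {a..b} s *\<^sub>R (E s * complex_of_real (u s))" for s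
  have iF: "integrable lborel F"
    using borel_integrable_atLeastAtMost'[OF cont] unfolding set_integrable_def F_def[abs_def] .
  have "set_lebesgue_integral lborel {a..b} (\<lambda>s. E s * complex_of_real (u s)) = I"
    unfolding I_def
    by (rule set_borel_integral_eq_integral(2)[OF borel_integrable_atLeastAtMost'[OF cont]])
  then have "(\<integral>s. F s \<partial>lborel) = I"
    unfolding F_def set_lebesgue_integral_def .
  moreover have "(\<integral>s. indicator {a..<b} s *\<^sub>R (E s * complex_of_real (u s)) \<partial>lborel) = (\<integral>s. F s \<partial>lborel)"
  proof -
    have "(\<lambda>s. indicator {a..<b} s *\<^sub>R (E s * complex_of_real (u s))) = (\<lambda>s. indicator {a..<b} s *\<^sub>R F s)"
      by (auto simp: F_def fun_eq_iff indicator_def)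
    moreover have "\<dots> \<in> borel_measurable lborel" using iF by measurable
    moreover have "AE s in lborel. indicator {a..<b} s *\<^sub>R (E s * complex_of_real (u s)) = F s"
      using AE_lborel_singleton[of b] by eventually_elim (auto simp: F_def indicator_def)
    ultimately show ?thesis
      by (intro integral_cong_AE) (use iF in auto)
  qed
  ultimately show ?thesis using bI unfolding E_def by simp
qed

section \<open>Bounded functions with bounded support\<close>

text \<open>The name abbreviates \<^emph>\<open>bounded, compactly supported\<close>; on this class no integrability question arises.\<close>

definition bcs :: "('a::euclidean_space \<Rightarrow> complex) \<Rightarrow> bool" where
  "bcs f \<longleftrightarrow> f \<in> borel_measurable borel \<and> bounded (range f) \<and> bounded {x. f x \<noteq> 0}"

lemma bcsI:
  assumes "f \<in> borel_measurable borel" "\<And>x. norm (f x) \<le> M" "\<And>x. f x \<noteq> 0 \<Longrightarrow> x \<in> X" "bounded X"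
  shows "bcs f"
  unfolding bcs_def
proof (intro conjI)
  show "bounded (range f)" using assms(2) by (auto simp: bounded_iff)
  show "bounded {x. f x \<noteq> 0}" by (rule bounded_subset[OF assms(4)]) (use assms(3) in auto)
qed fact

section \<open>Closure properties of bounded functions with bounded support\<close>

lemma bcs_measurable: "bcs f \<Longrightarrow> f \<in> borel_measurable borel"
  by (simp add: bcs_def)

lemma bcs_bound:
  assumes "bcs f" obtains M where "M > 0" "\<And>x. norm (f x) \<le> M"
proof -
  obtain M where "\<And>x. norm (f x) \<le> M" using assms by (auto simp: bcs_def bounded_iff)
  then have "\<And>x. norm (f x) \<le> max 1 M" by (simp add: le_max_iff_disj)
  then show thesis using that[of "max 1 M"] by simp
qed

lemma bcs_supp:
  assumes "bcs f" obtains X where "bounded X" "X \<in> sets borel" "\<And>x. x \<notin> X \<Longrightarrow> f x = 0"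
proof -
  have "bounded {x. f x \<noteq> 0}" using assms by (simp add: bcs_def)
  then obtain R where "\<And>x. f x \<noteq> 0 \<Longrightarrow> norm x \<le> R" by (auto simp: bounded_iff)
  then show thesis using that[of "cball 0 R"] by (force simp: dist_norm)
qed

lemma bounded_finite_measure:
  fixes X :: "'a::euclidean_space set"
  assumes "bounded X" shows "emeasure lborel X < \<infinity>"
proof -
  obtain a where "X \<subseteq> cbox (-a) a" using bounded_subset_cbox_symmetric[OF assms] by auto
  then have "emeasure lborel X \<le> emeasure lborel (cbox (-a) a)" by (intro emeasure_mono) auto
  also have "\<dots> < \<infinity>" by (rule emeasure_lborel_cbox_finite)
  finally show ?thesis .
qed

lemma integrable_bounded_supp:
  fixes f :: "'a::euclidean_space \<Rightarrow> 'b::{banach, second_countable_topology}"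
  assumes "f \<in> borel_measurable borel" "\<And>x. norm (f x) \<le> M" "\<And>x. x \<notin> X \<Longrightarrow> f x = 0" "bounded X" "X \<in> sets borel"
  shows "integrable lborel f"
proof (rule integrableI_bounded_set[where A=X and B=M])
  show "emeasure lborel X < \<infinity>" by (rule bounded_finite_measure) fact
qed (use assms in auto)

lemma bcs_integrable:
  assumes "bcs f" shows "integrable lborel f"
proof -
  obtain M where M: "M > 0" "\<And>x. norm (f x) \<le> M" using bcs_bound[OF assms] by metis
  obtain X where X: "bounded X" "X \<in> sets borel" "\<And>x. x \<notin> X \<Longrightarrow> f x = 0" using bcs_supp[OF assms] by metis
  show ?thesis by (rule integrable_bounded_supp[OF bcs_measurable[OF assms] M(2) X(3) X(1,2)])
qed

lemma bcs_powr_integrable: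
  assumes "bcs f" "p > 0" shows "integrable lborel (\<lambda>x. norm (f x) powr p)"
proof -
  obtain M where "M > 0" "\<And>x. norm (f x) \<le> M" using bcs_bound[OF assms(1)] by metis
  moreover obtain X where "bounded X" "X \<in> sets borel" "\<And>x. x \<notin> X \<Longrightarrow> f x = 0" using bcs_supp[OF assms(1)] by metis
  moreover have "(\<lambda>x. norm (f x) powr p) \<in> borel_measurable borel" using bcs_measurable[OF assms(1)] by measurable
  ultimately show ?thesis using assms(2)
    by (intro integrable_bounded_supp[where M="M powr p" and X=X]) (auto intro: powr_mono2)
qed

lemma bcs_square_integrable:
  assumes "bcs f" shows "integrable lborel (\<lambda>x. (norm (f x))\<^sup>2)"
proof -
  have "(\<lambda>x. norm (f x) powr 2) = (\<lambda>x. (norm (f x))\<^sup>2)"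
    by (rule ext) (simp add: powr_numeral)
  then show ?thesis using bcs_powr_integrable[OF assms, of 2] by simp
qed

lemma bcs_mult:
  assumes "bcs f" "g \<in> borel_measurable borel" "\<And>x. norm (g x) \<le> M"
  shows "bcs (\<lambda>x. f x * g x)"
proof -
  obtain N where N: "N > 0" "\<And>x. norm (f x) \<le> N" using bcs_bound[OF assms(1)] by metis
  obtain X where X: "bounded X" "X \<in> sets borel" "\<And>x. x \<notin> X \<Longrightarrow> f x = 0" using bcs_supp[OF assms(1)] by metis
  show ?thesis
  proof (rule bcsI[where M="N*M" and X=X])
    show "(\<lambda>x. f x * g x) \<in> borel_measurable borel" using assms bcs_measurable by measurable
    show "norm (f x * g x) \<le> N * M" for x unfolding norm_mult using N assms(3)
      by (intro mult_mono) (auto intro: order_trans[OF norm_ge_zero])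
  qed (use X in auto)
qed

lemma bcs_bcs_mult: "bcs f \<Longrightarrow> bcs g \<Longrightarrow> bcs (\<lambda>x. f x * g x)"
  by (rule bcs_bound[of g], assumption, rule bcs_mult[OF _ bcs_measurable])

lemma bcs_cnj: "bcs f \<Longrightarrow> bcs (\<lambda>x. cnj (f x))"
  unfolding bcs_def by (auto simp: bounded_iff intro: borel_measurable_continuous_onI[THEN measurable_compose_rev] continuous_intros)

lemma bcs_indicator:
  assumes "bcs f" "X \<in> sets borel" shows "bcs (\<lambda>x. f x * indicator X x)"
  using assms by (intro bcs_mult[where M=1]) (auto simp: indicator_def)

text \<open>Linear growth of \<open>c\<close> makes preimages of bounded sets bounded. The slices,
  swaps and shears used below are instances, with \<open>A\<close> and \<open>B\<close> supplied by
  the triangle inequality.\<close>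

lemma bcs_compose:
  fixes F :: "'a::euclidean_space \<Rightarrow> complex" and c :: "'b::euclidean_space \<Rightarrow> 'a"
  assumes F: "bcs F" and c: "continuous_on UNIV c" and B: "B \<ge> 0" and growth: "\<And>w. norm w \<le> A + B * norm (c w)"
  shows "bcs (\<lambda>w. F (c w))"
proof -
  obtain N where N: "N > 0" "\<And>x. norm (F x) \<le> N" using bcs_bound[OF F] by metis
  obtain X where X: "bounded X" "X \<in> sets borel" "\<And>x. x \<notin> X \<Longrightarrow> F x = 0" using bcs_supp[OF F] by metis
  obtain R where R: "\<And>x. x \<in> X \<Longrightarrow> norm x \<le> R" using X(1) unfolding bounded_iff by metis
  show ?thesis
  proof (rule bcsI[where M=N and X="cball 0 (A + B * R)"])
    show "(\<lambda>w. F (c w)) \<in> borel_measurable borel"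
      by (rule measurable_compose[OF borel_measurable_continuous_onI[OF c] bcs_measurable[OF F]])
    show "w \<in> cball 0 (A + B * R)" if "F (c w) \<noteq> 0" for w
    proof -
      have "norm (c w) \<le> R" using X(3) R that by metis
      then have "B * norm (c w) \<le> B * R" using B by (rule mult_left_mono)
      then show ?thesis using growth[of w] by simp
    qed
  qed (use N in auto)
qed

lemma bcs_line:
  fixes f :: "'a::euclidean_space \<Rightarrow> complex"
  assumes "bcs f" "v \<noteq> 0" shows "bcs (\<lambda>s. f (x + s *\<^sub>R v))"
proof (rule bcs_compose[OF assms(1), where A="norm x / norm v" and B="1 / norm v"])
  fix s :: real
  have "\<bar>s\<bar> * norm v \<le> norm x + norm (x + s *\<^sub>R v)" using norm_triangle_ineq4[of "x + s *\<^sub>R v" x] by simp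
  then show "norm s \<le> norm x / norm v + 1 / norm v * norm (x + s *\<^sub>R v)" using assms(2) by (simp add: field_simps)
qed (auto intro!: continuous_intros)

lemma bcs_slice1:
  fixes F :: "'a::euclidean_space \<times> 'b::euclidean_space \<Rightarrow> complex"
  assumes "bcs F" shows "bcs (\<lambda>t. F (s, t))"
  by (rule bcs_compose[OF assms, where A=0 and B=1]) (auto intro!: continuous_intros simp: norm_snd_le)

lemma bcs_swap:
  fixes F :: "'a::euclidean_space \<times> 'b::euclidean_space \<Rightarrow> complex"
  assumes "bcs F" shows "bcs (\<lambda>z. F (snd z, fst z))"
  by (rule bcs_compose[OF assms, where A=0 and B=1]) (auto intro!: continuous_intros simp: norm_Pair add.commute)

lemma bcs_tensor:
  fixes f :: "'a::euclidean_space \<Rightarrow> complex" and g :: "'b::euclidean_space \<Rightarrow> complex"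
  assumes f: "bcs f" and g: "bcs g" shows "bcs (\<lambda>z. f (fst z) * g (snd z))"
proof -
  obtain M where M: "M > 0" "\<And>x. norm (f x) \<le> M" using bcs_bound[OF f] by metis
  obtain N where N: "N > 0" "\<And>x. norm (g x) \<le> N" using bcs_bound[OF g] by metis
  note [measurable] = bcs_measurable[OF f] bcs_measurable[OF g]
  show ?thesis
  proof (rule bcsI[where M="M * N" and X="{x. f x \<noteq> 0} \<times> {x. g x \<noteq> 0}"])
    have "(\<lambda>z. f (fst z) * g (snd z)) \<in> borel_measurable (borel \<Otimes>\<^sub>M borel)" by measurable
    then show "(\<lambda>z. f (fst z) * g (snd z)) \<in> borel_measurable borel" by (simp only: borel_prod)
    show "norm (f (fst z) * g (snd z)) \<le> M * N" for z
      unfolding norm_mult using M N by (intro mult_mono) (auto intro: less_imp_le)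
    show "bounded ({x. f x \<noteq> 0} \<times> {x. g x \<noteq> 0})" using f g by (simp add: bcs_def bounded_Times)
    show "z \<in> {x. f x \<noteq> 0} \<times> {x. g x \<noteq> 0}" if "f (fst z) * g (snd z) \<noteq> 0" for z
      using that by (cases z) simp
  qed
qed

lemma bcs_Fubini1:
  fixes F :: "'a::euclidean_space \<times> 'b::euclidean_space \<Rightarrow> complex"
  assumes "bcs F" shows "(\<integral>s. \<integral>t. F (s, t) \<partial>lborel \<partial>lborel) = (\<integral>z. F z \<partial>lborel)"
proof -
  have "integrable (lborel \<Otimes>\<^sub>M lborel) (\<lambda>z. F z)" using bcs_integrable[OF assms] by (simp add: lborel_prod)
  from lborel_pair.integral_fst'[OF this] show ?thesis by (simp add: lborel_prod)
qed

lemma bcs_Fubini2: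
  fixes F :: "'a::euclidean_space \<times> 'b::euclidean_space \<Rightarrow> complex"
  assumes "bcs F" shows "(\<integral>t. \<integral>s. F (s, t) \<partial>lborel \<partial>lborel) = (\<integral>z. F z \<partial>lborel)"
proof -
  have "integrable (lborel \<Otimes>\<^sub>M lborel) (\<lambda>(s,t). F (s,t))" using bcs_integrable[OF assms] by (simp add: lborel_prod)
  from lborel_pair.integral_snd[OF this] show ?thesis by (simp add: lborel_prod)
qed

text \<open>Integrating out a variable stays inside the class, so nested integrals can be formed and
  reordered without a new integrability argument.\<close>

lemma bcs_partial_integral:
  fixes F :: "'a::euclidean_space \<times> 'b::euclidean_space \<Rightarrow> complex"
  assumes "bcs F" shows "bcs (\<lambda>s. \<integral>t. F (s, t) \<partial>lborel)"
proof -
  obtain N where N: "N > 0" "\<And>x. norm (F x) \<le> N" using bcs_bound[OF assms(1)] by metis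
  obtain X where X: "bounded X" "X \<in> sets borel" "\<And>x. x \<notin> X \<Longrightarrow> F x = 0" using bcs_supp[OF assms(1)] by metis
  obtain R where R: "\<And>x. x \<in> X \<Longrightarrow> norm x \<le> R" using X(1) unfolding bounded_iff by metis
  have Rs: "norm s \<le> R \<and> norm t \<le> R" if "F (s,t) \<noteq> 0" for s t
  proof -
    have "norm (s, t) \<le> R" by (rule R) (use X(3) that in blast)
    then show ?thesis using norm_fst_le[of s t] norm_snd_le[of t s] by simp
  qed
  show ?thesis
  proof (rule bcsI[where M="N * measure lborel (cball (0::'b) R)" and X="cball 0 R"])
    have "(\<lambda>(s,t). F (s,t)) \<in> borel_measurable (borel \<Otimes>\<^sub>M lborel)"
      by (subst measurable_cong_sets[OF sets_pair_measure_cong[OF refl sets_lborel] refl])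
        (simp add: borel_prod bcs_measurable[OF assms])
    then show "(\<lambda>s. \<integral>t. F (s, t) \<partial>lborel) \<in> borel_measurable borel"
      using lborel.borel_measurable_lebesgue_integral[of "\<lambda>s t. F (s,t)" borel] by simp
    show "norm (\<integral>t. F (s, t) \<partial>lborel) \<le> N * measure lborel (cball (0::'b) R)" for s
    proof -
      have "norm (\<integral>t. F (s, t) \<partial>lborel) \<le> (\<integral>t. N * indicator (cball (0::'b) R) t \<partial>lborel)"
      proof (rule order_trans[OF integral_norm_bound], rule integral_mono)
        show "integrable lborel (\<lambda>t. norm (F (s, t)))" using bcs_integrable[OF bcs_slice1[OF assms]] by simp
        show "integrable lborel (\<lambda>t. N * indicator (cball (0::'b) R) t)"
          using bounded_finite_measure[OF bounded_cball, of "0::'b" R] by simp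
        show "norm (F (s,t)) \<le> N * indicator (cball (0::'b) R) t" for t
          using Rs[of s t] N(2)[of "(s,t)"] by (auto simp: indicator_def)
      qed
      then show ?thesis by simp
    qed
    show "s \<in> cball 0 R" if "(\<integral>t. F (s, t) \<partial>lborel) \<noteq> 0" for s
    proof -
      have "\<exists>t. F (s,t) \<noteq> 0" by (rule ccontr) (use that in simp)
      then obtain t where "F (s,t) \<noteq> 0" ..
      then show ?thesis using Rs by simp
    qed
  qed simp
qed

section \<open>Cauchy-Schwarz and Schur's test\<close>

abbreviation L2 :: "('a::euclidean_space \<Rightarrow> complex) \<Rightarrow> real" where
  "L2 f \<equiv> sqrt (\<integral>x. (norm (f x))\<^sup>2 \<partial>lborel)"

lemma Cauchy_Schwarz_bcs:
  assumes "bcs f" "bcs g"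
  shows "norm (\<integral>x. f x * g x \<partial>lborel) \<le> L2 f * L2 g"
proof -
  note [measurable] = bcs_measurable[OF assms(1)] bcs_measurable[OF assms(2)]
  have ifg: "integrable lborel (\<lambda>x. norm (f x * g x))" using bcs_integrable[OF bcs_bcs_mult[OF assms]] by simp
  have "(\<integral>\<^sup>+x. ennreal (norm (f x)) * ennreal (norm (g x)) \<partial>lborel)\<^sup>2 \<le>
    (\<integral>\<^sup>+x. (ennreal (norm (f x)))\<^sup>2 \<partial>lborel) * (\<integral>\<^sup>+x. (ennreal (norm (g x)))\<^sup>2 \<partial>lborel)"
    by (rule Cauchy_Schwarz_nn_integral) measurable
  moreover have "(\<integral>\<^sup>+x. ennreal (norm (f x)) * ennreal (norm (g x)) \<partial>lborel) = ennreal (\<integral>x. norm (f x * g x) \<partial>lborel)"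
    using nn_integral_eq_integral[OF ifg] by (simp add: ennreal_mult norm_mult)
  moreover have "(\<integral>\<^sup>+x. (ennreal (norm (f x)))\<^sup>2 \<partial>lborel) = ennreal (\<integral>x. (norm (f x))\<^sup>2 \<partial>lborel)"
    using nn_integral_eq_integral[OF bcs_square_integrable[OF assms(1)]] by (simp add: ennreal_power)
  moreover have "(\<integral>\<^sup>+x. (ennreal (norm (g x)))\<^sup>2 \<partial>lborel) = ennreal (\<integral>x. (norm (g x))\<^sup>2 \<partial>lborel)"
    using nn_integral_eq_integral[OF bcs_square_integrable[OF assms(2)]] by (simp add: ennreal_power)
  ultimately have "(\<integral>x. norm (f x * g x) \<partial>lborel)\<^sup>2 \<le> (\<integral>x. (norm (f x))\<^sup>2 \<partial>lborel) * (\<integral>x. (norm (g x))\<^sup>2 \<partial>lborel)"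
    by (simp add: ennreal_power ennreal_mult[symmetric])
  then have "(\<integral>x. norm (f x * g x) \<partial>lborel) \<le> L2 f * L2 g"
    by (metis real_le_rsqrt real_sqrt_mult)
  then show ?thesis using integral_norm_bound[of lborel "\<lambda>x. f x * g x"] by linarith
qed

text \<open>Schur's test for the kernel of \<open>T\<^sup>*T\<close>.\<close>

lemma TstarT_bound:
  fixes k :: "'a::euclidean_space \<Rightarrow> 'b::euclidean_space \<Rightarrow> complex" and \<Psi> :: "'b \<Rightarrow> 'b \<Rightarrow> real"
  assumes k: "bcs (\<lambda>z. k (fst z) (snd z))" and f: "bcs f" and g: "bcs g"
    and H: "\<And>t t'. t \<noteq> t' \<Longrightarrow> norm (\<integral>s. k s t * cnj (k s t') \<partial>lborel) \<le> \<Psi> t t'"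
    and \<Psi>0: "\<And>t t'. \<Psi> t t' \<ge> 0" and \<Psi>sym: "\<And>t t'. \<Psi> t t' = \<Psi> t' t"
    and \<Psi>m: "(\<lambda>z. \<Psi> (fst z) (snd z)) \<in> borel_measurable borel"
    and A: "\<And>t. (\<integral>\<^sup>+t'. ennreal (\<Psi> t t') \<partial>lborel) \<le> ennreal A" and A0: "A \<ge> 0"
  shows "norm (\<integral>s. \<integral>t. k s t * f t * g s \<partial>lborel \<partial>lborel)
     \<le> sqrt A * L2 f * L2 g"
proof -
  note [measurable] = bcs_measurable[OF f] bcs_measurable[OF g]
  obtain Mf where Mf: "Mf > 0" "\<And>x. norm (f x) \<le> Mf" using bcs_bound[OF f] by metis
  have \<Psi>m'[measurable]: "(\<lambda>z. \<Psi> (fst z) (snd z)) \<in> borel_measurable (borel \<Otimes>\<^sub>M borel)"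
    using \<Psi>m by (simp only: borel_prod)
  have \<Psi>c[measurable]: "case_prod \<Psi> \<in> borel_measurable (borel \<Otimes>\<^sub>M borel)"
    using \<Psi>m' by (simp only: case_prod_beta')
  have \<Psi>s[measurable]: "\<Psi> t \<in> borel_measurable borel" for t
    using measurable_compose[OF measurable_Pair1'[of t borel borel] \<Psi>m'] by simp
  have kf: "bcs (\<lambda>z. k (fst z) (snd z) * f (snd z))"
  proof (rule bcs_mult[OF k, where M=Mf])
    have "(\<lambda>x :: 'a \<times> 'b. f (snd x)) \<in> borel_measurable (borel \<Otimes>\<^sub>M borel)" by measurable
    then show "(\<lambda>x :: 'a \<times> 'b. f (snd x)) \<in> borel_measurable borel" by (simp only: borel_prod)
  qed (use Mf in auto)
  \<comment> \<open>\<open>U\<close> is the operator applied to \<open>f\<close>. Cauchy-Schwarz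
    against \<open>g\<close> leaves its norm, whose square is a form in \<open>f\<close> and
    \<open>cnj f\<close> with the kernel estimated by \<open>H\<close>.\<close>
  define U where "U s = (\<integral>t. k s t * f t \<partial>lborel)" for s
  have bU: "bcs U" using bcs_partial_integral[OF kf] unfolding U_def by simp
  have sl: "integrable lborel (\<lambda>t. k s t * f t)" for s using bcs_integrable[OF bcs_slice1[OF kf]] by simp
  have "(\<integral>s. \<integral>t. k s t * f t * g s \<partial>lborel \<partial>lborel) = (\<integral>s. U s * g s \<partial>lborel)"
    unfolding U_def using sl by simp
  then have 1: "norm (\<integral>s. \<integral>t. k s t * f t * g s \<partial>lborel \<partial>lborel) \<le>
      L2 U * L2 g"
    using Cauchy_Schwarz_bcs[OF bU g] by simp
  define Q where "Q = (\<lambda>w :: 'a \<times> ('b \<times> 'b). k (fst w) (fst (snd w)) * f (fst (snd w)) * cnj (k (fst w) (snd (snd w)) * f (snd (snd w))))"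
  have bQ: "bcs Q"
  proof -
    have "bcs (\<lambda>w :: 'a \<times> ('b \<times> 'b). (\<lambda>v. k (fst (fst v)) (snd (fst v)) * f (snd (fst v)) * cnj (k (fst (snd v)) (snd (snd v)) * f (snd (snd v))))
        ((fst w, fst (snd w)), (fst w, snd (snd w))))"
    proof (rule bcs_compose[where A=0 and B=3, OF bcs_tensor[OF kf bcs_cnj[OF kf]]])
      fix w :: "'a \<times> ('b \<times> 'b)"
      obtain s t t' where w: "w = (s, (t, t'))" by (metis prod.exhaust)
      have "norm w \<le> norm s + (norm t + norm t')"
        unfolding w using norm_Pair_le[of s "(t, t')"] norm_Pair_le[of t t'] by simp
      moreover have "norm s \<le> norm ((s, t), (s, t'))" "norm t \<le> norm ((s, t), (s, t'))" "norm t' \<le> norm ((s, t), (s, t'))"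
        using norm_fst_le[of "(s, t)" "(s, t')"] norm_snd_le[of "(s, t')" "(s, t)"] norm_fst_le[of s t] norm_snd_le[of t s] norm_snd_le[of t' s] by linarith+
      ultimately show "norm w \<le> 0 + 3 * norm ((fst w, fst (snd w)), (fst w, snd (snd w)))" unfolding w by simp
    qed (auto intro!: continuous_intros)
    then show ?thesis unfolding Q_def by simp
  qed
  have "complex_of_real (\<integral>s. (norm (U s))\<^sup>2 \<partial>lborel) = (\<integral>s. U s * cnj (U s) \<partial>lborel)"
    by (simp only: complex_norm_square[symmetric] of_real_power[symmetric] integral_complex_of_real)
  also have "\<dots> = (\<integral>s. \<integral>z. Q (s, z) \<partial>lborel \<partial>lborel)"
  proof (rule Bochner_Integration.integral_cong)
    fix s
    have "U s * cnj (U s) = (\<integral>t. k s t * f t * cnj (U s) \<partial>lborel)"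
      unfolding U_def using sl by simp
    also have "\<dots> = (\<integral>t. \<integral>t'. Q (s, (t, t')) \<partial>lborel \<partial>lborel)"
    proof (rule Bochner_Integration.integral_cong)
      fix t
      have "cnj (U s) = (\<integral>t'. cnj (k s t' * f t') \<partial>lborel)" unfolding U_def
        by (rule Bochner_Integration.integral_cnj[symmetric])
      then show "k s t * f t * cnj (U s) = (\<integral>t'. Q (s, (t, t')) \<partial>lborel)"
        unfolding Q_def using sl[of s] by simp
    qed simp
    also have "\<dots> = (\<integral>z. Q (s, z) \<partial>lborel)" by (rule bcs_Fubini1[OF bcs_slice1[OF bQ]])
    finally show "U s * cnj (U s) = (\<integral>z. Q (s, z) \<partial>lborel)" .
  qed simp
  also have "\<dots> = (\<integral>z. \<integral>s. Q (s, z) \<partial>lborel \<partial>lborel)"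
    using bcs_Fubini1[OF bQ] bcs_Fubini2[OF bQ] by simp
  finally have eq: "complex_of_real (\<integral>s. (norm (U s))\<^sup>2 \<partial>lborel) = (\<integral>z. \<integral>s. Q (s, z) \<partial>lborel \<partial>lborel)" .
  have U0: "(\<integral>s. (norm (U s))\<^sup>2 \<partial>lborel) \<ge> 0" by simp
  have bQ2: "bcs (\<lambda>z. \<integral>s. Q (s, z) \<partial>lborel)" using bcs_partial_integral[OF bcs_swap[OF bQ]] by simp
  have "(\<integral>s. (norm (U s))\<^sup>2 \<partial>lborel) = norm (\<integral>z. \<integral>s. Q (s, z) \<partial>lborel \<partial>lborel)"
    unfolding eq[symmetric] norm_of_real using U0 by simp
  then have "ennreal (\<integral>s. (norm (U s))\<^sup>2 \<partial>lborel) \<le> (\<integral>\<^sup>+z. norm (\<integral>s. Q (s, z) \<partial>lborel) \<partial>lborel)"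
    using integral_norm_bound_ennreal[OF bcs_integrable[OF bQ2]] by simp
  also have "\<dots> = (\<integral>\<^sup>+t. \<integral>\<^sup>+t'. norm (\<integral>s. Q (s, (t, t')) \<partial>lborel) \<partial>lborel \<partial>lborel)"
  proof -
    have "(\<lambda>z. ennreal (norm (\<integral>s. Q (s, z) \<partial>lborel))) \<in> borel_measurable (lborel \<Otimes>\<^sub>M lborel)"
      using bcs_measurable[OF bQ2] unfolding lborel_prod by simp
    from lborel.nn_integral_fst[OF this] show ?thesis by (simp add: lborel_prod)
  qed
  \<comment> \<open>The inequality |f t| |f t'| \<le> (|f t|^2 + |f t'|^2) / 2 separates the
    factors. By symmetry of \<open>\<Psi>\<close> both halves have the same integral, at most
    \<open>A / 2\<close> times the squared norm.\<close>
  also have "\<dots> \<le> (\<integral>\<^sup>+t. \<integral>\<^sup>+t'. ennreal (1/2 * ((norm (f t))\<^sup>2 * \<Psi> t t')) + ennreal (1/2 * ((norm (f t'))\<^sup>2 * \<Psi> t t')) \<partial>lborel \<partial>lborel)"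
  proof (rule nn_integral_mono, rule nn_integral_mono_AE)
    fix t
    show "AE t' in lborel. ennreal (norm (\<integral>s. Q (s, (t, t')) \<partial>lborel)) \<le>
       ennreal (1/2 * ((norm (f t))\<^sup>2 * \<Psi> t t')) + ennreal (1/2 * ((norm (f t'))\<^sup>2 * \<Psi> t t'))"
      \<comment> \<open>\<open>H\<close> says nothing on the diagonal \<open>t' = t\<close>, which
        is a null set for each \<open>t\<close>.\<close>
      using AE_lborel_singleton[of t]
    proof eventually_elim
      case (elim t')
      have "(\<integral>s. Q (s, (t, t')) \<partial>lborel) = (\<integral>s. f t * cnj (f t') * (k s t * cnj (k s t')) \<partial>lborel)"
        unfolding Q_def by (rule Bochner_Integration.integral_cong) (auto simp: algebra_simps)
      also have "\<dots> = f t * cnj (f t') * (\<integral>s. (k s t * cnj (k s t')) \<partial>lborel)"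
        by simp
      finally have "norm (\<integral>s. Q (s, (t, t')) \<partial>lborel) \<le> norm (f t) * norm (f t') * \<Psi> t t'"
        using H[of t t'] elim by (simp add: norm_mult mult_left_mono)
      also have "\<dots> \<le> 1/2 * ((norm (f t))\<^sup>2 + (norm (f t'))\<^sup>2) * \<Psi> t t'"
        using sum_squares_bound[of "norm (f t)" "norm (f t')"] \<Psi>0[of t t'] by (intro mult_right_mono) auto
      also have "\<dots> = 1/2 * ((norm (f t))\<^sup>2 * \<Psi> t t') + 1/2 * ((norm (f t'))\<^sup>2 * \<Psi> t t')" by (simp add: algebra_simps)
      finally show ?case using \<Psi>0 by (simp add: ennreal_plus[symmetric] del: ennreal_plus)
    qed
  qed
  also have "\<dots> = (\<integral>\<^sup>+t. (\<integral>\<^sup>+t'. ennreal (1/2 * ((norm (f t))\<^sup>2 * \<Psi> t t')) \<partial>lborel) + (\<integral>\<^sup>+t'. ennreal (1/2 * ((norm (f t'))\<^sup>2 * \<Psi> t t')) \<partial>lborel) \<partial>lborel)"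
    by (intro nn_integral_cong nn_integral_add) measurable
  also have "\<dots> = (\<integral>\<^sup>+t. \<integral>\<^sup>+t'. ennreal (1/2 * ((norm (f t))\<^sup>2 * \<Psi> t t')) \<partial>lborel \<partial>lborel) + (\<integral>\<^sup>+t. \<integral>\<^sup>+t'. ennreal (1/2 * ((norm (f t'))\<^sup>2 * \<Psi> t t')) \<partial>lborel \<partial>lborel)"
    by (intro nn_integral_add) measurable
  also have "(\<integral>\<^sup>+t. \<integral>\<^sup>+t'. ennreal (1/2 * ((norm (f t'))\<^sup>2 * \<Psi> t t')) \<partial>lborel \<partial>lborel)
      = (\<integral>\<^sup>+t. \<integral>\<^sup>+t'. ennreal (1/2 * ((norm (f t))\<^sup>2 * \<Psi> t t')) \<partial>lborel \<partial>lborel)"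
    by (subst lborel_pair.Fubini') (measurable, simp add: \<Psi>sym)
  also have "(\<integral>\<^sup>+t. \<integral>\<^sup>+t'. ennreal (1/2 * ((norm (f t))\<^sup>2 * \<Psi> t t')) \<partial>lborel \<partial>lborel)
      \<le> (\<integral>\<^sup>+t. ennreal (1/2 * A * (norm (f t))\<^sup>2) \<partial>lborel)"
  proof (rule nn_integral_mono)
    fix t
    have "(\<integral>\<^sup>+t'. ennreal (1/2 * ((norm (f t))\<^sup>2 * \<Psi> t t')) \<partial>lborel) = (\<integral>\<^sup>+t'. ennreal (1/2 * (norm (f t))\<^sup>2) * ennreal (\<Psi> t t') \<partial>lborel)"
      using \<Psi>0 by (intro nn_integral_cong) (simp add: ennreal_mult[symmetric] algebra_simps)
    also have "\<dots> = ennreal (1/2 * (norm (f t))\<^sup>2) * (\<integral>\<^sup>+t'. ennreal (\<Psi> t t') \<partial>lborel)"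
      by (rule nn_integral_cmult) measurable
    also have "\<dots> \<le> ennreal (1/2 * (norm (f t))\<^sup>2) * ennreal A"
      by (rule mult_left_mono[OF A]) simp
    finally show "(\<integral>\<^sup>+t'. ennreal (1/2 * ((norm (f t))\<^sup>2 * \<Psi> t t')) \<partial>lborel) \<le> ennreal (1/2 * A * (norm (f t))\<^sup>2)"
      using A0 by (simp add: ennreal_mult[symmetric] algebra_simps)
  qed
  also have "(\<integral>\<^sup>+t. ennreal (1/2 * A * (norm (f t))\<^sup>2) \<partial>lborel) = ennreal (1/2 * A * (\<integral>t. (norm (f t))\<^sup>2 \<partial>lborel))"
    using nn_integral_eq_integral[OF integrable_mult_right[OF bcs_square_integrable[OF f], of "1/2*A"]] A0
    by simp
  finally have "ennreal (\<integral>s. (norm (U s))\<^sup>2 \<partial>lborel) \<le> ennreal (1/2 * A * (\<integral>t. (norm (f t))\<^sup>2 \<partial>lborel)) + ennreal (1/2 * A * (\<integral>t. (norm (f t))\<^sup>2 \<partial>lborel))"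
    by (simp add: add_mono)
  also have "\<dots> = ennreal (A * (\<integral>t. (norm (f t))\<^sup>2 \<partial>lborel))"
    using A0 by (simp add: ennreal_plus[symmetric] del: ennreal_plus)
  finally have "(\<integral>s. (norm (U s))\<^sup>2 \<partial>lborel) \<le> A * (\<integral>t. (norm (f t))\<^sup>2 \<partial>lborel)"
    using A0 by simp
  then have "L2 U \<le> sqrt A * L2 f"
    by (metis real_sqrt_le_mono real_sqrt_mult)
  then have "L2 U * L2 g
      \<le> sqrt A * L2 f * L2 g"
    by (rule mult_right_mono) simp
  with 1 show ?thesis by linarith
qed

section \<open>Boxes and the local bound on square-integrable functions\<close>

lemma lborel_integral_translate:
  fixes f :: "'a::euclidean_space \<Rightarrow> complex"
  assumes "f \<in> borel_measurable borel"
  shows "(\<integral>x. f (x + v) \<partial>lborel) = (\<integral>x. f x \<partial>lborel)"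
proof -
  have "(\<integral>x. f x \<partial>lborel) = (\<integral>x. f x \<partial>distr lborel borel ((+) v))" by (simp only: lborel_distr_plus)
  also have "\<dots> = (\<integral>x. f (v + x) \<partial>lborel)" by (rule integral_distr) (use assms in auto)
  finally show ?thesis by (simp add: add.commute)
qed

lemma norm_integral_le:
  fixes f :: "'a \<Rightarrow> 'b::{banach, second_countable_topology}"
  assumes "\<And>x. norm (f x) \<le> g x" "integrable M g"
  shows "norm (\<integral>x. f x \<partial>M) \<le> (\<integral>x. g x \<partial>M)"
proof (cases "integrable M f")
  case True
  then show ?thesis by (intro order_trans[OF integral_norm_bound] integral_mono) (use assms in auto)
next
  case False
  \<comment> \<open>A function that is not integrable has Bochner integral 0, so only the sign of
    \<open>g\<close> is left to check.\<close>
  have "g x \<ge> 0" for x using assms(1)[of x] norm_ge_zero order_trans by blast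
  then show ?thesis using False by (simp add: not_integrable_integral_eq integral_nonneg_AE)
qed

section \<open>Half-open boxes and averaging along coordinate lines\<close>

text \<open>Half-open in each coordinate, so that grid cells are disjoint, cover space, and have
  sharp indicators that add up to the indicator of a larger cube.\<close>

definition hbox :: "real^'n \<Rightarrow> real \<Rightarrow> (real^'n) set" where
  "hbox a h = {x. \<forall>c. a $ c \<le> x $ c \<and> x $ c < a $ c + h}"

lemma hbox_subset_cbox: "hbox a h \<subseteq> cbox a (\<chi> c. a $ c + h)"
  by (auto simp: hbox_def mem_box_cart less_imp_le)

lemma hbox_bounded: "bounded (hbox a h)"
  using hbox_subset_cbox bounded_cbox bounded_subset by blast

lemma hbox_sets[measurable]: "hbox a h \<in> sets borel"
proof -
  have "hbox a h = (\<Inter>c\<in>UNIV. {x. a $ c \<le> x $ c} \<inter> {x. x $ c < a $ c + h})"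
    by (auto simp: hbox_def)
  also have "\<dots> \<in> sets borel"
    by (intro sets.finite_INT sets.Int borel_closed borel_open closed_Collect_le open_Collect_less continuous_intros) auto
  finally show ?thesis .
qed

lemma hbox_measure:
  fixes a :: "real^'n" assumes "h \<ge> 0" shows "measure lborel (hbox a h) \<le> h ^ CARD('n)"
proof -
  have "measure lborel (hbox a h) \<le> measure lborel (cbox a (\<chi> c. a $ c + h))"
    using hbox_subset_cbox[of a h] emeasure_lborel_cbox_finite
    by (intro measure_mono_fmeasurable) (auto simp: fmeasurable_def)
  also have "\<dots> = h ^ CARD('n)"
  proof -
    have "a \<in> cbox a (\<chi> c. a $ c + h)" using assms by (simp add: mem_box_cart)
    then have "cbox a (\<chi> c. a $ c + h) \<noteq> {}" by blast
    from content_cbox_cart[OF this] show ?thesis by simp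
  qed
  finally show ?thesis .
qed

lemma hbox_line:
  fixes x :: "real^'n"
  assumes "x \<in> hbox a h"
  shows "x + s *\<^sub>R axis i 1 \<in> hbox a h \<longleftrightarrow> s \<in> {a $ i - x $ i ..< a $ i - x $ i + h}"
  using assms by (auto simp: hbox_def axis_def)

lemma bcs_of_real_indicator:
  assumes "bounded X" "X \<in> sets borel" shows "bcs (indicator X :: 'a::euclidean_space \<Rightarrow> complex)"
  by (rule bcsI[where M=1 and X=X]) (use assms in \<open>auto simp: indicator_def\<close>)

lemma norm_scaled_axis_le: "\<bar>s\<bar> \<le> norm (x + s *\<^sub>R axis i (1::real)) + norm x"
  using norm_triangle_ineq4[of "x + s *\<^sub>R axis i 1" x] by simp

lemma bcs_hbox_line:
  fixes G :: "real^'n \<Rightarrow> complex"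
  assumes G: "bcs G"
  shows "bcs (\<lambda>z :: (real^'n) \<times> real. indicator (hbox a h) (fst z) * G (fst z + snd z *\<^sub>R axis i 1))"
proof -
  have "bcs (\<lambda>z :: (real^'n) \<times> real. (\<lambda>v. indicator (hbox a h) (fst v) * G (snd v)) (fst z, fst z + snd z *\<^sub>R axis i 1))"
  \<comment> \<open>The growth constant: |s| \<le> |x + s e| + |x|, hence |(x, s)| \<le> 2 |x| + |x
    + s e|, at most 3 times the norm of the pair (x, x + s e).\<close>
  proof (rule bcs_compose[where A=0 and B=3, OF bcs_tensor[OF bcs_of_real_indicator[OF hbox_bounded hbox_sets] G]])
    fix z :: "(real^'n) \<times> real"
    show "norm z \<le> 0 + 3 * norm (fst z, fst z + snd z *\<^sub>R axis i (1::real))"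
      using norm_Pair_le[of "fst z" "snd z"] norm_scaled_axis_le[of "snd z" "fst z" i]
        norm_fst_le[of "fst z" "fst z + snd z *\<^sub>R axis i (1::real)"] norm_snd_le[of "fst z + snd z *\<^sub>R axis i (1::real)" "fst z"]
      by simp
  qed (auto intro!: continuous_intros)
  then show ?thesis by simp
qed

text \<open>Averaging over translates along a coordinate axis takes the place of splitting off that
  coordinate: it isolates one variable without decomposing the space into a product.\<close>

lemma hbox_average:
  fixes G :: "real^'n \<Rightarrow> complex"
  assumes G: "bcs G" and h: "h > 0" and supp: "\<And>x. G x \<noteq> 0 \<Longrightarrow> x \<in> hbox a h"
  shows "(\<integral>x. \<integral>s. indicator (hbox a h) x * G (x + s *\<^sub>R axis i 1) \<partial>lborel \<partial>lborel) = complex_of_real h * (\<integral>x. G x \<partial>lborel)"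
proof -
  let ?X = "hbox a h" and ?e = "axis i 1 :: real^'n"
  have b1: "bcs (\<lambda>z :: (real^'n) \<times> real. indicator ?X (fst z) * G (fst z + snd z *\<^sub>R ?e))"
    by (rule bcs_hbox_line[OF G])
  define I where "I = (\<lambda>x. indicator ?X x :: complex)"
  have bI: "bcs I" unfolding I_def by (rule bcs_of_real_indicator[OF hbox_bounded hbox_sets])
  have Is: "G x = I x * G x" for x using supp[of x] by (auto simp: I_def indicator_def)
  note [measurable] = bcs_measurable[OF G] bcs_measurable[OF bI]
  have b3: "bcs (\<lambda>z :: (real^'n) \<times> real. I (fst z + (- snd z) *\<^sub>R ?e) * G (fst z))"
  proof -
    have "bcs (\<lambda>z :: (real^'n) \<times> real. (\<lambda>v. I (fst v) * G (snd v)) (fst z + (- snd z) *\<^sub>R ?e, fst z))"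
    proof (rule bcs_compose[where A=0 and B=3, OF bcs_tensor[OF bI G]])
      fix z :: "(real^'n) \<times> real"
      show "norm z \<le> 0 + 3 * norm (fst z + (- snd z) *\<^sub>R ?e, fst z)"
        using norm_Pair_le[of "fst z" "snd z"] norm_scaled_axis_le[of "- snd z" "fst z" i]
          norm_snd_le[of "fst z" "fst z + (- snd z) *\<^sub>R ?e"] norm_fst_le[of "fst z + (- snd z) *\<^sub>R ?e" "fst z"]
        by simp
    qed (auto intro!: continuous_intros)
    then show ?thesis by simp
  qed
  have "(\<integral>x. \<integral>s. indicator ?X x * G (x + s *\<^sub>R ?e) \<partial>lborel \<partial>lborel)
     = (\<integral>s. \<integral>x. I x * G (x + s *\<^sub>R ?e) \<partial>lborel \<partial>lborel)"
    using bcs_Fubini1[OF b1] bcs_Fubini2[OF b1] by (simp add: I_def)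
  \<comment> \<open>Translating \<open>x\<close> moves the shift from \<open>G\<close> to the
    indicator; the integral in \<open>s\<close> then only measures a segment.\<close>
  also have "\<dots> = (\<integral>s. \<integral>x. I (x + (-s) *\<^sub>R ?e) * G x \<partial>lborel \<partial>lborel)"
  proof (rule Bochner_Integration.integral_cong[OF refl])
    fix s :: real
    have "(\<lambda>x. I x * G (x + s *\<^sub>R ?e)) \<in> borel_measurable borel" by measurable
    from lborel_integral_translate[OF this, of "(-s) *\<^sub>R ?e"]
    show "(\<integral>x. I x * G (x + s *\<^sub>R ?e) \<partial>lborel) = (\<integral>x. I (x + (-s) *\<^sub>R ?e) * G x \<partial>lborel)"
      by simp
  qed
  also have "\<dots> = (\<integral>x. \<integral>s. I (x + (-s) *\<^sub>R ?e) * G x \<partial>lborel \<partial>lborel)"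
    using bcs_Fubini1[OF b3] bcs_Fubini2[OF b3] by simp
  also have "\<dots> = (\<integral>x. complex_of_real h * G x \<partial>lborel)"
  proof (rule Bochner_Integration.integral_cong[OF refl])
    fix x
    show "(\<integral>s. I (x + (-s) *\<^sub>R ?e) * G x \<partial>lborel) = complex_of_real h * G x"
    proof (cases "G x = 0")
      case False
      then have x: "x \<in> ?X" using supp by auto
      \<comment> \<open>The shift is by \<open>-s\<close>, so the segment in \<open>s\<close> is
        reflected: open on the left, closed on the right, still of length \<open>h\<close>.\<close>
      have "I (x + (-s) *\<^sub>R ?e) = indicator {x $ i - a $ i - h <.. x $ i - a $ i} s" for s
        using hbox_line[OF x, of "-s" i] unfolding I_def indicator_def by auto
      then have "(\<integral>s. I (x + (-s) *\<^sub>R ?e) * G x \<partial>lborel) = (\<integral>s. indicator {x $ i - a $ i - h <.. x $ i - a $ i} s *\<^sub>R G x \<partial>lborel)"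
        by (intro Bochner_Integration.integral_cong) (auto simp: indicator_def)
      also have "\<dots> = measure lborel {x $ i - a $ i - h <.. x $ i - a $ i} *\<^sub>R G x"
        by (subst integral_scaleR_left) (use h in auto)
      finally show ?thesis using h by (simp add: scaleR_conv_of_real)
    qed simp
  qed
  also have "\<dots> = complex_of_real h * (\<integral>x. G x \<partial>lborel)" by simp
  finally show ?thesis .
qed

text \<open>The integral that Schur's test asks for. The singularity is integrable because
  \<epsilon> > 0, and the factor \<open>1 / \<epsilon>\<close> is the price of removing the
  logarithm.\<close>

lemma nn_integral_powr_diff_le:
  assumes eps: "\<epsilon> > 0" and h: "h > 0"
  shows "(\<integral>\<^sup>+t'. ennreal (\<bar>t - t'\<bar> powr (\<epsilon> - 1) * indicator {-h..h} (t' - t)) \<partial>lborel) \<le> ennreal (2 * h powr \<epsilon> / \<epsilon>)"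
proof -
  have half: "(\<integral>\<^sup>+x. ennreal (x powr (\<epsilon> - 1) * indicator {0..h} x) \<partial>lborel) = ennreal (h powr \<epsilon> / \<epsilon>)"
  proof -
    have "((\<lambda>x. x powr (\<epsilon> - 1)) has_integral (h powr \<epsilon> / \<epsilon>)) {0..h}"
      using has_integral_powr_from_0[of "\<epsilon> - 1" h] eps h by simp
    moreover have "(\<lambda>x. x powr (\<epsilon> - 1) * indicator {0..h} x) = (\<lambda>x. if x \<in> {0..h} then x powr (\<epsilon> - 1) else 0)"
      by (auto simp: fun_eq_iff indicator_def)
    ultimately have "((\<lambda>x. x powr (\<epsilon> - 1) * indicator {0..h} x) has_integral (h powr \<epsilon> / \<epsilon>)) UNIV"
      by (simp only: has_integral_restrict_UNIV)
    from nn_integral_has_integral_lborel[OF _ _ this] show ?thesis by simp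
  qed
  have "(\<integral>\<^sup>+t'. ennreal (\<bar>t - t'\<bar> powr (\<epsilon> - 1) * indicator {-h..h} (t' - t)) \<partial>lborel)
     = (\<integral>\<^sup>+x. ennreal (\<bar>x\<bar> powr (\<epsilon> - 1) * indicator {-h..h} x) \<partial>lborel)"
    using nn_integral_real_affine[of "\<lambda>t'. ennreal (\<bar>t - t'\<bar> powr (\<epsilon> - 1) * indicator {-h..h} (t' - t))" 1 t]
    by simp
  also have "\<dots> \<le> (\<integral>\<^sup>+x. ennreal (x powr (\<epsilon> - 1) * indicator {0..h} x) + ennreal ((-x) powr (\<epsilon> - 1) * indicator {0..h} (-x)) \<partial>lborel)"
    by (intro nn_integral_mono) (auto simp: indicator_def abs_if)
  also have "\<dots> = (\<integral>\<^sup>+x. ennreal (x powr (\<epsilon> - 1) * indicator {0..h} x) \<partial>lborel) + (\<integral>\<^sup>+x. ennreal ((-x) powr (\<epsilon> - 1) * indicator {0..h} (-x)) \<partial>lborel)"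
    by (rule nn_integral_add) auto
  also have "(\<integral>\<^sup>+x. ennreal ((-x) powr (\<epsilon> - 1) * indicator {0..h} (-x)) \<partial>lborel) = (\<integral>\<^sup>+x. ennreal (x powr (\<epsilon> - 1) * indicator {0..h} x) \<partial>lborel)"
    using nn_integral_real_affine[of "\<lambda>x. ennreal (x powr (\<epsilon> - 1) * indicator {0..h} x)" "-1" 0] by simp
  also have "\<dots> + \<dots> = ennreal (2 * h powr \<epsilon> / \<epsilon>)"
    unfolding half using eps by (simp add: ennreal_plus[symmetric] del: ennreal_plus)
  finally show ?thesis unfolding half .
qed

text \<open>Cauchy-Schwarz in \<open>x\<close> costs the root of the volume of the box, and
  \<open>hbox_average\<close> evaluates the integral of the squares of \<open>G\<close> as
  \<open>h\<close> times the full squared norm of \<open>g\<close>.\<close>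

lemma hbox_line_norm:
  fixes g :: "real^'n \<Rightarrow> complex" and i :: 'n
  assumes g: "bcs g" and h: "h > 0" and supp: "\<And>x. g x \<noteq> 0 \<Longrightarrow> x \<in> hbox a h"
  defines "G \<equiv> \<lambda>x. indicator (hbox a h) x * sqrt (\<integral>s. (norm (g (x + s *\<^sub>R axis i 1)))\<^sup>2 \<partial>lborel)"
  shows "integrable lborel G" "(\<integral>x. G x \<partial>lborel) \<le> sqrt (h ^ CARD('n)) * sqrt h * L2 g"
proof -
  let ?X = "hbox a h" and ?e = "axis i 1 :: real^'n"
  \<comment> \<open>Squares are kept complex, as \<open>g * cnj g\<close>, so that the results on
    \<open>bcs\<close> apply to them.\<close>
  define q where "q = (\<lambda>x. g x * cnj (g x))"
  have bq: "bcs q" unfolding q_def by (intro bcs_bcs_mult bcs_cnj g)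
  have qn: "q x = complex_of_real ((norm (g x))\<^sup>2)" for x
    unfolding q_def by (simp only: complex_norm_square)
  have qsupp: "x \<in> ?X" if "q x \<noteq> 0" for x using that supp[of x] unfolding q_def by auto
  define p where "p = (\<lambda>x. indicator ?X x * (\<integral>s. (norm (g (x + s *\<^sub>R ?e)))\<^sup>2 \<partial>lborel))"
  have pe: "complex_of_real (p x) = (\<integral>s. indicator ?X x * q (x + s *\<^sub>R ?e) \<partial>lborel)" for x
  proof -
    have "(\<integral>s. indicator ?X x * q (x + s *\<^sub>R ?e) \<partial>lborel) = indicator ?X x * (\<integral>s. q (x + s *\<^sub>R ?e) \<partial>lborel)"
      by (cases "x \<in> ?X") auto
    also have "(\<integral>s. q (x + s *\<^sub>R ?e) \<partial>lborel) = complex_of_real (\<integral>s. (norm (g (x + s *\<^sub>R ?e)))\<^sup>2 \<partial>lborel)"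
      unfolding qn by (rule integral_complex_of_real)
    finally show ?thesis unfolding p_def by (auto simp: indicator_def)
  qed
  have bp: "bcs (\<lambda>x. complex_of_real (p x))"
    unfolding pe using bcs_partial_integral[OF bcs_hbox_line[OF bq]] by simp
  have p0: "p x \<ge> 0" for x unfolding p_def by simp
  have Gp: "G x = sqrt (p x)" for x unfolding G_def p_def by (auto simp: indicator_def)
  have bG: "bcs (\<lambda>x. complex_of_real (G x))"
  proof -
    obtain N where N: "N > 0" "\<And>x. norm (complex_of_real (p x)) \<le> N" using bcs_bound[OF bp] by metis
    have "p \<in> borel_measurable borel" using measurable_compose[OF bcs_measurable[OF bp], of Re borel] by simp
    then have "(\<lambda>x. complex_of_real (G x)) \<in> borel_measurable borel" unfolding Gp by measurable
    moreover have "norm (complex_of_real (G x)) \<le> sqrt N" for x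
      using N(2)[of x] p0[of x] by (simp add: Gp)
    moreover have "x \<in> ?X" if "complex_of_real (G x) \<noteq> 0" for x
      using that unfolding G_def by (auto simp: indicator_def)
    ultimately show ?thesis using hbox_bounded bcsI by metis
  qed
  show iG: "integrable lborel G" using bcs_integrable[OF bG] integrable_Re by fastforce
  have "complex_of_real (\<integral>x. p x \<partial>lborel) = (\<integral>x. \<integral>s. indicator ?X x * q (x + s *\<^sub>R ?e) \<partial>lborel \<partial>lborel)"
    unfolding pe[symmetric] by (rule integral_complex_of_real[symmetric])
  also have "\<dots> = complex_of_real h * (\<integral>x. q x \<partial>lborel)" by (rule hbox_average[OF bq h qsupp])
  also have "(\<integral>x. q x \<partial>lborel) = complex_of_real (\<integral>x. (norm (g x))\<^sup>2 \<partial>lborel)"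
    unfolding qn by (rule integral_complex_of_real)
  finally have ip: "(\<integral>x. p x \<partial>lborel) = h * (\<integral>x. (norm (g x))\<^sup>2 \<partial>lborel)"
    by (metis of_real_eq_iff of_real_mult)
  have bI: "bcs (indicator ?X :: _ \<Rightarrow> complex)" by (rule bcs_of_real_indicator[OF hbox_bounded hbox_sets])
  have "G x \<ge> 0" for x using p0 Gp by simp
  then have "(\<integral>x. G x \<partial>lborel) = norm (complex_of_real (\<integral>x. G x \<partial>lborel))" by (simp add: integral_nonneg_AE)
  also have "complex_of_real (\<integral>x. G x \<partial>lborel) = (\<integral>x. complex_of_real (G x) * indicator ?X x \<partial>lborel)"
    unfolding integral_complex_of_real[symmetric]
    by (intro Bochner_Integration.integral_cong) (auto simp: G_def indicator_def)
  also have "norm \<dots> \<le> sqrt (\<integral>x. (norm (complex_of_real (G x)))\<^sup>2 \<partial>lborel) * sqrt (\<integral>x. (norm (indicator ?X x :: complex))\<^sup>2 \<partial>lborel)"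
    by (rule Cauchy_Schwarz_bcs[OF bG bI])
  also have "(\<integral>x. (norm (complex_of_real (G x)))\<^sup>2 \<partial>lborel) = h * (\<integral>x. (norm (g x))\<^sup>2 \<partial>lborel)"
    unfolding ip[symmetric] using p0 by (intro Bochner_Integration.integral_cong) (auto simp: Gp)
  also have "(\<integral>x. (norm (indicator ?X x :: complex))\<^sup>2 \<partial>lborel) = measure lborel ?X"
  proof -
    have "(norm (indicator ?X x :: complex))\<^sup>2 = indicator ?X x" for x by (simp add: indicator_def)
    then show ?thesis by simp
  qed
  also have "sqrt (h * (\<integral>x. (norm (g x))\<^sup>2 \<partial>lborel)) * sqrt (measure lborel ?X) \<le> sqrt (h * (\<integral>x. (norm (g x))\<^sup>2 \<partial>lborel)) * sqrt (h ^ CARD('n))"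
    using hbox_measure[of h a] h by (intro mult_left_mono) auto
  finally show "(\<integral>x. G x \<partial>lborel) \<le> sqrt (h ^ CARD('n)) * sqrt h * L2 g"
    by (simp add: real_sqrt_mult mult_ac)
qed

text \<open>Along each pair of lines in the directions \<open>i\<close> and \<open>j\<close> the
  form obeys \<open>TstarT_bound\<close>; averaging over the base points recovers the whole form.
  The two averages put \<open>h^2\<close> on the left, and the two uses of
  \<open>hbox_line_norm\<close> put one factor \<open>h\<close> on the right besides the volumes.
  This explains the quotient by \<open>h\<close>.\<close>

lemma L2_bilinear_bound_hbox:
  fixes K :: "real^'n \<Rightarrow> real^'m \<Rightarrow> complex" and i :: 'n and j :: 'm
  assumes K: "bcs (\<lambda>z. K (fst z) (snd z))" and f: "bcs f" and g: "bcs g"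
    and f_supp: "\<And>y. f y \<noteq> 0 \<Longrightarrow> y \<in> hbox b h" and g_supp: "\<And>x. g x \<noteq> 0 \<Longrightarrow> x \<in> hbox a h"
    and h: "h > 0" and eps: "\<epsilon> > 0" and C: "C \<ge> 0"
    and K_supp: "\<And>x y. K x y \<noteq> 0 \<Longrightarrow> y \<in> hbox b h"
    and slice: "\<And>x y t t'. x \<in> hbox a h \<Longrightarrow> y \<in> hbox b h \<Longrightarrow> t \<noteq> t' \<Longrightarrow>
        y + t *\<^sub>R axis j 1 \<in> hbox b h \<Longrightarrow> y + t' *\<^sub>R axis j 1 \<in> hbox b h \<Longrightarrow>
        norm (\<integral>s. K (x + s *\<^sub>R axis i 1) (y + t *\<^sub>R axis j 1) * cnj (K (x + s *\<^sub>R axis i 1) (y + t' *\<^sub>R axis j 1)) \<partial>lborel)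
          \<le> C * \<bar>t - t'\<bar> powr (\<epsilon> - 1)"
  shows "norm (\<integral>x. \<integral>y. K x y * f y * g x \<partial>lborel \<partial>lborel)
     \<le> sqrt (C * (2 * h powr \<epsilon> / \<epsilon>)) * (sqrt (h ^ CARD('n)) * sqrt (h ^ CARD('m)) / h)
        * L2 f * L2 g"
proof -
  let ?X = "hbox a h" and ?Y = "hbox b h" and ?e = "axis i 1 :: real^'n" and ?e' = "axis j 1 :: real^'m"
  define A where "A = C * (2 * h powr \<epsilon> / \<epsilon>)"
  have A0: "A \<ge> 0" unfolding A_def using C eps by simp
  have ne: "?e \<noteq> 0" "?e' \<noteq> 0" by auto
  define F where "F x y = K x y * f y * g x" for x y
  have bF: "bcs (\<lambda>z. F (fst z) (snd z))"
  proof -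
    obtain Mf where Mf: "Mf > 0" "\<And>x. norm (f x) \<le> Mf" using bcs_bound[OF f] by metis
    obtain Mg where Mg: "Mg > 0" "\<And>x. norm (g x) \<le> Mg" using bcs_bound[OF g] by metis
    note [measurable] = bcs_measurable[OF f] bcs_measurable[OF g]
    have m1: "(\<lambda>z :: (real^'n) \<times> (real^'m). f (snd z)) \<in> borel_measurable (borel \<Otimes>\<^sub>M borel)" by measurable
    have m2: "(\<lambda>z :: (real^'n) \<times> (real^'m). g (fst z)) \<in> borel_measurable (borel \<Otimes>\<^sub>M borel)" by measurable
    show ?thesis unfolding F_def
      by (rule bcs_mult[OF bcs_mult[OF K m1[unfolded borel_prod], of Mf] m2[unfolded borel_prod], of Mg]) (use Mf Mg in auto)
  qed
  have F_supp: "x \<in> ?X" "y \<in> ?Y" if "F x y \<noteq> 0" for x y using that f_supp[of y] g_supp[of x] unfolding F_def by auto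
  have bF1: "bcs (\<lambda>y. F x y)" for x using bcs_slice1[OF bF, of x] by simp
  define W where "W x = (\<integral>y. F x y \<partial>lborel)" for x
  have bW: "bcs W" unfolding W_def using bcs_partial_integral[OF bF] by simp
  have W_supp: "x \<in> ?X" if "W x \<noteq> 0" for x
  proof (rule ccontr)
    assume "x \<notin> ?X"
    then have "F x = (\<lambda>y. 0)" using F_supp by blast
    then show False using that unfolding W_def by simp
  qed
  \<comment> \<open>\<open>V\<close> is the form on the pair of lines through \<open>x\<close> and
    \<open>y\<close>; \<open>swap\<close> brings the base point \<open>y\<close> out of the integral
    along the line in the first variable.\<close>
  define V where "V x y = (\<integral>s. \<integral>t. F (x + s *\<^sub>R ?e) (y + t *\<^sub>R ?e') \<partial>lborel \<partial>lborel)" for x y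
  have swap: "(\<integral>s. \<integral>y. \<integral>t. indicator ?Y y * F (x + s *\<^sub>R ?e) (y + t *\<^sub>R ?e') \<partial>lborel \<partial>lborel \<partial>lborel)
    = (\<integral>y. indicator ?Y y * V x y \<partial>lborel)" for x
  proof -
    define P where "P = (\<lambda>w :: (real \<times> (real^'m)) \<times> real. indicator ?Y (snd (fst w)) * F (x + fst (fst w) *\<^sub>R ?e) (snd (fst w) + snd w *\<^sub>R ?e'))"
    have bP: "bcs P"
    proof -
      have "bcs (\<lambda>w :: (real \<times> (real^'m)) \<times> real. (\<lambda>v. indicator ?Y (fst v) * F (fst (snd v)) (snd (snd v)))
          (snd (fst w), (x + fst (fst w) *\<^sub>R ?e, snd (fst w) + snd w *\<^sub>R ?e')))"
      proof (rule bcs_compose[where A="norm x" and B=4, OF bcs_tensor[OF bcs_of_real_indicator[OF hbox_bounded hbox_sets] bF]])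
        fix w :: "(real \<times> (real^'m)) \<times> real"
        obtain s y t where w: "w = ((s, y), t)" by (metis prod.exhaust)
        let ?u = "x + s *\<^sub>R ?e" and ?v = "y + t *\<^sub>R ?e'"
        have "norm w \<le> \<bar>s\<bar> + norm y + \<bar>t\<bar>"
          unfolding w using norm_Pair_le[of "(s, y)" t] norm_Pair_le[of s y] by simp
        moreover have "norm y \<le> norm (y, (?u, ?v))" "norm ?u \<le> norm (y, (?u, ?v))" "norm ?v \<le> norm (y, (?u, ?v))"
          using norm_fst_le[of y "(?u, ?v)"] norm_snd_le[of "(?u, ?v)" y] norm_fst_le[of ?u ?v] norm_snd_le[of ?v ?u] by linarith+
        ultimately have "norm w \<le> norm x + 4 * norm (y, (?u, ?v))"
          using norm_scaled_axis_le[of s x i] norm_scaled_axis_le[of t y j] by linarith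
        then show "norm w \<le> norm x + 4 * norm (snd (fst w), (x + fst (fst w) *\<^sub>R ?e, snd (fst w) + snd w *\<^sub>R ?e'))"
          unfolding w by simp
      qed (auto intro!: continuous_intros)
      then show ?thesis unfolding P_def by simp
    qed
    define R where "R = (\<lambda>z :: real \<times> (real^'m). \<integral>t. P (z, t) \<partial>lborel)"
    have bR: "bcs R" unfolding R_def by (rule bcs_partial_integral[OF bP])
    have "(\<integral>s. \<integral>y. \<integral>t. indicator ?Y y * F (x + s *\<^sub>R ?e) (y + t *\<^sub>R ?e') \<partial>lborel \<partial>lborel \<partial>lborel)
       = (\<integral>s. \<integral>y. R (s, y) \<partial>lborel \<partial>lborel)" unfolding R_def P_def by simp
    also have "\<dots> = (\<integral>y. \<integral>s. R (s, y) \<partial>lborel \<partial>lborel)" using bcs_Fubini1[OF bR] bcs_Fubini2[OF bR] by simp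
    also have "\<dots> = (\<integral>y. indicator ?Y y * V x y \<partial>lborel)"
    proof (rule Bochner_Integration.integral_cong[OF refl])
      fix y
      show "(\<integral>s. R (s, y) \<partial>lborel) = indicator ?Y y * V x y"
        unfolding R_def P_def V_def by (cases "y \<in> ?Y") auto
    qed
    finally show ?thesis .
  qed
  have eq: "complex_of_real h * (complex_of_real h * (\<integral>x. W x \<partial>lborel)) = (\<integral>x. indicator ?X x * (\<integral>y. indicator ?Y y * V x y \<partial>lborel) \<partial>lborel)"
  proof -
    have Wh: "complex_of_real h * W x = (\<integral>y. \<integral>t. indicator ?Y y * F x (y + t *\<^sub>R ?e') \<partial>lborel \<partial>lborel)" for x
      unfolding W_def by (rule hbox_average[symmetric, OF bF1 h]) (use F_supp in auto)
    have "complex_of_real h * (complex_of_real h * (\<integral>x. W x \<partial>lborel)) = complex_of_real h * (\<integral>x. \<integral>s. indicator ?X x * W (x + s *\<^sub>R ?e) \<partial>lborel \<partial>lborel)"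
      by (subst hbox_average[OF bW h]) (use W_supp in auto)
    also have "\<dots> = (\<integral>x. complex_of_real h * (\<integral>s. indicator ?X x * W (x + s *\<^sub>R ?e) \<partial>lborel) \<partial>lborel)" by simp
    also have "\<dots> = (\<integral>x. indicator ?X x * (\<integral>s. complex_of_real h * W (x + s *\<^sub>R ?e) \<partial>lborel) \<partial>lborel)"
    proof (rule Bochner_Integration.integral_cong[OF refl])
      fix x
      show "complex_of_real h * (\<integral>s. indicator ?X x * W (x + s *\<^sub>R ?e) \<partial>lborel) = indicator ?X x * (\<integral>s. complex_of_real h * W (x + s *\<^sub>R ?e) \<partial>lborel)"
        by (cases "x \<in> ?X") auto
    qed
    also have "\<dots> = (\<integral>x. indicator ?X x * (\<integral>y. indicator ?Y y * V x y \<partial>lborel) \<partial>lborel)"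
      unfolding Wh swap ..
    finally show ?thesis .
  qed
  define Gf where "Gf = (\<lambda>y. indicator ?Y y * sqrt (\<integral>t. (norm (f (y + t *\<^sub>R ?e')))\<^sup>2 \<partial>lborel))"
  define Gg where "Gg = (\<lambda>x. indicator ?X x * sqrt (\<integral>s. (norm (g (x + s *\<^sub>R ?e)))\<^sup>2 \<partial>lborel))"
  note Gf = hbox_line_norm[OF f h f_supp, where i=j, folded Gf_def]
  note Gg = hbox_line_norm[OF g h g_supp, where i=i, folded Gg_def]
  have Vb: "norm (V x y) \<le> sqrt A * sqrt (\<integral>t. (norm (f (y + t *\<^sub>R ?e')))\<^sup>2 \<partial>lborel) * sqrt (\<integral>s. (norm (g (x + s *\<^sub>R ?e)))\<^sup>2 \<partial>lborel)"
    if x: "x \<in> ?X" and y: "y \<in> ?Y" for x y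
  proof -
    define k where "k s t = K (x + s *\<^sub>R ?e) (y + t *\<^sub>R ?e')" for s t
    define T where "T = {b $ j - y $ j ..< b $ j - y $ j + h}"
    \<comment> \<open>The indicators of \<open>T\<close> record that both points lie in the box:
      outside it \<open>k\<close> vanishes, and inside it |t - t'| < h, which confines the singular
      integral to a window of width \<open>2 * h\<close>.\<close>
    define \<Psi> where "\<Psi> t t' = C * (\<bar>t - t'\<bar> powr (\<epsilon> - 1) * indicator T t * indicator T t')" for t t'
    have T: "y + t *\<^sub>R ?e' \<in> ?Y \<longleftrightarrow> t \<in> T" for t unfolding T_def by (rule hbox_line[OF y])
    have bk: "bcs (\<lambda>z. k (fst z) (snd z))"
    proof -
      have "bcs (\<lambda>w :: real \<times> real. (\<lambda>z. K (fst z) (snd z)) (x + fst w *\<^sub>R ?e, y + snd w *\<^sub>R ?e'))"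
      proof (rule bcs_compose[where A="norm x + norm y" and B=2, OF K])
        fix w :: "real \<times> real"
        let ?u = "x + fst w *\<^sub>R ?e" and ?v = "y + snd w *\<^sub>R ?e'"
        have "norm w \<le> \<bar>fst w\<bar> + \<bar>snd w\<bar>" using norm_Pair_le[of "fst w" "snd w"] by simp
        then show "norm w \<le> norm x + norm y + 2 * norm (?u, ?v)"
          using norm_scaled_axis_le[of "fst w" x i] norm_scaled_axis_le[of "snd w" y j] norm_fst_le[of ?u ?v] norm_snd_le[of ?v ?u]
          by linarith
      qed (auto intro!: continuous_intros)
      then show ?thesis unfolding k_def by simp
    qed
    have "norm (\<integral>s. \<integral>t. k s t * f (y + t *\<^sub>R ?e') * g (x + s *\<^sub>R ?e) \<partial>lborel \<partial>lborel) \<le>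
       sqrt A * sqrt (\<integral>t. (norm (f (y + t *\<^sub>R ?e')))\<^sup>2 \<partial>lborel) * sqrt (\<integral>s. (norm (g (x + s *\<^sub>R ?e)))\<^sup>2 \<partial>lborel)"
    proof (rule TstarT_bound[OF bk bcs_line[OF f ne(2)] bcs_line[OF g ne(1)], where \<Psi>=\<Psi>])
      show "norm (\<integral>s. k s t * cnj (k s t') \<partial>lborel) \<le> \<Psi> t t'" if "t \<noteq> t'" for t t'
      proof (cases "t \<in> T \<and> t' \<in> T")
        case True
        then show ?thesis using slice[OF x y that] T unfolding k_def \<Psi>_def by simp
      next
        case False
        then have z: "k s t * cnj (k s t') = 0" for s
          using K_supp[of "x + s *\<^sub>R ?e" "y + t *\<^sub>R ?e'"] K_supp[of "x + s *\<^sub>R ?e" "y + t' *\<^sub>R ?e'"] T unfolding k_def by auto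
        show ?thesis unfolding z \<Psi>_def using C by simp
      qed
      show "\<Psi> t t' \<ge> 0" for t t' unfolding \<Psi>_def using C by simp
      show "\<Psi> t t' = \<Psi> t' t" for t t' unfolding \<Psi>_def by (simp add: abs_minus_commute)
      have "(\<lambda>z :: real \<times> real. \<Psi> (fst z) (snd z)) \<in> borel_measurable (borel \<Otimes>\<^sub>M borel)" unfolding \<Psi>_def T_def by measurable
      then show "(\<lambda>z :: real \<times> real. \<Psi> (fst z) (snd z)) \<in> borel_measurable borel" by (simp only: borel_prod)
      show "(\<integral>\<^sup>+t'. ennreal (\<Psi> t t') \<partial>lborel) \<le> ennreal A" for t
      proof -
        have "(\<integral>\<^sup>+t'. ennreal (\<Psi> t t') \<partial>lborel) \<le> (\<integral>\<^sup>+t'. ennreal C * ennreal (\<bar>t - t'\<bar> powr (\<epsilon> - 1) * indicator {-h..h} (t' - t)) \<partial>lborel)"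
        proof (rule nn_integral_mono)
          fix t'
          have "\<Psi> t t' \<le> C * (\<bar>t - t'\<bar> powr (\<epsilon> - 1) * indicator {-h..h} (t' - t))"
            unfolding \<Psi>_def using C by (intro mult_left_mono) (auto simp: indicator_def T_def)
          then show "ennreal (\<Psi> t t') \<le> ennreal C * ennreal (\<bar>t - t'\<bar> powr (\<epsilon> - 1) * indicator {-h..h} (t' - t))"
            using C by (simp add: ennreal_mult[symmetric] ennreal_leI)
        qed
        also have "\<dots> = ennreal C * (\<integral>\<^sup>+t'. ennreal (\<bar>t - t'\<bar> powr (\<epsilon> - 1) * indicator {-h..h} (t' - t)) \<partial>lborel)"
          by (rule nn_integral_cmult) measurable
        also have "\<dots> \<le> ennreal C * ennreal (2 * h powr \<epsilon> / \<epsilon>)"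
          by (rule mult_left_mono[OF nn_integral_powr_diff_le[OF eps h]]) simp
        also have "\<dots> = ennreal A" unfolding A_def using C eps by (simp add: ennreal_mult[symmetric])
        finally show ?thesis .
      qed
    qed (rule A0)
    then show ?thesis unfolding V_def F_def k_def .
  qed
  have "norm (\<integral>x. indicator ?X x * (\<integral>y. indicator ?Y y * V x y \<partial>lborel) \<partial>lborel) \<le> (\<integral>x. sqrt A * (\<integral>y. Gf y \<partial>lborel) * Gg x \<partial>lborel)"
  proof (rule norm_integral_le)
    show "integrable lborel (\<lambda>x. sqrt A * (\<integral>y. Gf y \<partial>lborel) * Gg x)" using Gg(1) by simp
    fix x
    show "norm (indicator ?X x * (\<integral>y. indicator ?Y y * V x y \<partial>lborel)) \<le> sqrt A * (\<integral>y. Gf y \<partial>lborel) * Gg x"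
    proof (cases "x \<in> ?X")
      case True
      have "norm (\<integral>y. indicator ?Y y * V x y \<partial>lborel) \<le> (\<integral>y. sqrt A * Gg x * Gf y \<partial>lborel)"
      proof (rule norm_integral_le)
        show "norm (indicator ?Y y * V x y) \<le> sqrt A * Gg x * Gf y" for y
          using Vb[OF True, of y] True unfolding Gf_def Gg_def by (auto simp: indicator_def norm_mult mult_ac)
      qed (use Gf(1) in simp)
      then show ?thesis using True by (simp add: mult_ac)
    qed (simp add: Gg_def)
  qed
  also have "\<dots> = sqrt A * ((\<integral>y. Gf y \<partial>lborel) * (\<integral>x. Gg x \<partial>lborel))" by simp
  also have "\<dots> \<le> sqrt A * ((sqrt (h ^ CARD('m)) * sqrt h * L2 f) * (sqrt (h ^ CARD('n)) * sqrt h * L2 g))"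
    using Gf(2) Gg(2) A0 h
    by (intro mult_left_mono mult_mono) (auto simp: Gg_def Gf_def intro!: integral_nonneg_AE)
  finally have "h * (h * norm (\<integral>x. W x \<partial>lborel)) \<le> sqrt A * ((sqrt (h ^ CARD('m)) * sqrt h * L2 f) * (sqrt (h ^ CARD('n)) * sqrt h * L2 g))"
    unfolding eq[symmetric] norm_mult norm_of_real using h by simp
  also have "\<dots> = h * (h * (sqrt A * (sqrt (h ^ CARD('n)) * sqrt (h ^ CARD('m)) / h) * L2 f * L2 g))"
  proof -
    have "sqrt h * sqrt h = h" using h by simp
    then show ?thesis using h by (simp add: field_simps)
  qed
  finally have "norm (\<integral>x. W x \<partial>lborel) \<le> sqrt A * (sqrt (h ^ CARD('n)) * sqrt (h ^ CARD('m)) / h) * L2 f * L2 g"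
    unfolding mult_le_cancel_left_pos[OF h] .
  then show ?thesis unfolding W_def F_def A_def .
qed

section \<open>Bilinear forms and interpolation\<close>

text \<open>Young's inequality after normalising both integrals to 1. The form with exponents
  \<theta> and 1 - \<theta> serves twice: for a conjugate pair and, with an indicator as one factor,
  for lowering the exponent on a set of finite measure.\<close>

lemma Holder_powr:
  fixes u v :: "'a \<Rightarrow> real"
  assumes u: "integrable M u" and v: "integrable M v" and u0: "\<And>x. u x \<ge> 0" and v0: "\<And>x. v x \<ge> 0"
    and \<theta>: "0 < \<theta>" "\<theta> < 1"
  shows "integrable M (\<lambda>x. u x powr \<theta> * v x powr (1 - \<theta>))"
    "(\<integral>x. u x powr \<theta> * v x powr (1 - \<theta>) \<partial>M) \<le> (\<integral>x. u x \<partial>M) powr \<theta> * (\<integral>x. v x \<partial>M) powr (1 - \<theta>)"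
proof -
  note [measurable] = borel_measurable_integrable[OF u] borel_measurable_integrable[OF v]
  have young: "a powr \<theta> * b powr (1 - \<theta>) \<le> \<theta> * a + (1 - \<theta>) * b" if "a \<ge> 0" "b \<ge> 0" for a b
  proof (cases "a = 0 \<or> b = 0")
    case False
    then show ?thesis using Youngs_inequality_0[of \<theta> "1 - \<theta>" a b] that \<theta> by simp
  qed (use that \<theta> in auto)
  show i: "integrable M (\<lambda>x. u x powr \<theta> * v x powr (1 - \<theta>))"
  proof (rule Bochner_Integration.integrable_bound)
    show "integrable M (\<lambda>x. \<theta> * u x + (1 - \<theta>) * v x)" using u v by simp
    show "AE x in M. norm (u x powr \<theta> * v x powr (1 - \<theta>)) \<le> norm (\<theta> * u x + (1 - \<theta>) * v x)"
      using young[OF u0 v0] by (intro AE_I2) (simp add: abs_le_iff, smt (verit) abs_ge_self)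
  qed measurable
  define U where "U = (\<integral>x. u x \<partial>M)"
  define V where "V = (\<integral>x. v x \<partial>M)"
  have UV: "U \<ge> 0" "V \<ge> 0" unfolding U_def V_def using u0 v0 by (auto intro: integral_nonneg_AE)
  show "(\<integral>x. u x powr \<theta> * v x powr (1 - \<theta>) \<partial>M) \<le> U powr \<theta> * V powr (1 - \<theta>)"
  \<comment> \<open>The normalisation divides by \<open>U\<close> and \<open>V\<close>. If one of
    them is 0, the integrand vanishes almost everywhere.\<close>
  proof (cases "U = 0 \<or> V = 0")
    case True
    have "AE x in M. u x powr \<theta> * v x powr (1 - \<theta>) = 0"
    proof (cases "U = 0")
      case True
      then have "AE x in M. u x = 0" using integral_nonneg_eq_0_iff_AE[OF u] u0 unfolding U_def by auto
      then show ?thesis by eventually_elim (use \<theta> in simp)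
    next
      case False
      then have "AE x in M. v x = 0" using True integral_nonneg_eq_0_iff_AE[OF v] v0 unfolding V_def by auto
      then show ?thesis by eventually_elim (use \<theta> in simp)
    qed
    then have "(\<integral>x. u x powr \<theta> * v x powr (1 - \<theta>) \<partial>M) = (\<integral>x. 0 \<partial>M)" by (intro integral_cong_AE) auto
    then show ?thesis by simp
  next
    case False
    then have pos: "U > 0" "V > 0" using UV by auto
    have "(\<integral>x. u x powr \<theta> * v x powr (1 - \<theta>) \<partial>M) \<le> (\<integral>x. U powr \<theta> * V powr (1 - \<theta>) * (\<theta> * (u x / U) + (1 - \<theta>) * (v x / V)) \<partial>M)"
    proof (rule integral_mono[OF i])
      show "integrable M (\<lambda>x. U powr \<theta> * V powr (1 - \<theta>) * (\<theta> * (u x / U) + (1 - \<theta>) * (v x / V)))" using u v by simp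
      fix x
      have "u x powr \<theta> * v x powr (1 - \<theta>) = U powr \<theta> * V powr (1 - \<theta>) * ((u x / U) powr \<theta> * (v x / V) powr (1 - \<theta>))"
        using pos u0 v0 by (simp add: powr_divide)
      also have "\<dots> \<le> U powr \<theta> * V powr (1 - \<theta>) * (\<theta> * (u x / U) + (1 - \<theta>) * (v x / V))"
        using young[of "u x / U" "v x / V"] pos u0 v0 by (intro mult_left_mono) auto
      finally show "u x powr \<theta> * v x powr (1 - \<theta>) \<le> U powr \<theta> * V powr (1 - \<theta>) * (\<theta> * (u x / U) + (1 - \<theta>) * (v x / V))" .
    qed
    also have "\<dots> = U powr \<theta> * V powr (1 - \<theta>) * (\<theta> * (U / U) + (1 - \<theta>) * (V / V))"
      using u v unfolding U_def V_def by simp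
    also have "\<dots> = U powr \<theta> * V powr (1 - \<theta>)" using pos by simp
    finally show ?thesis .
  qed
qed

lemma conjugate_exponent:
  fixes p q :: real
  assumes "p > 1" "1/p + 1/q = 1" shows "1/q = 1 - 1/p" "q > 1"
proof -
  show q: "1/q = 1 - 1/p" using assms(2) by simp
  have "0 < 1/q" "1/q < 1" unfolding q using assms(1) by auto
  then show "q > 1" by (simp add: divide_less_eq split: if_splits)
qed

lemma Lp_norm_nonneg: "Lp_norm p f \<ge> 0"
  by (simp add: Lp_norm_def)

lemma Lp_norm_powr:
  assumes "p > 0" shows "Lp_norm p f powr p = (\<integral>x. norm (f x) powr p \<partial>lborel)"
  using assms by (simp add: Lp_norm_def powr_powr integral_nonneg_AE)

lemma Lp_Holder:
  fixes f g :: "'a::euclidean_space \<Rightarrow> complex"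
  assumes f: "memLp p f" and g: "memLp q g" and p: "p > 1" and pq: "1/p + 1/q = 1"
  shows "integrable lborel (\<lambda>x. f x * g x)" "(\<integral>x. norm (f x) * norm (g x) \<partial>lborel) \<le> Lp_norm p f * Lp_norm q g"
proof -
  note q = conjugate_exponent(1)[OF p pq, symmetric] conjugate_exponent(2)[OF p pq]
  have i: "integrable lborel (\<lambda>x. norm (f x) powr p)" "integrable lborel (\<lambda>x. norm (g x) powr q)"
    using f g by (auto simp: memLp_def)
  have e: "(norm (f x) powr p) powr (1/p) * (norm (g x) powr q) powr (1 - 1/p) = norm (f x) * norm (g x)" for x
    unfolding q(1) powr_powr using p q(2) by simp
  have I: "integrable lborel (\<lambda>x. norm (f x) * norm (g x))"
    using Holder_powr(1)[OF i, of "1/p"] p unfolding e by simp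
  then have "integrable lborel (\<lambda>x. norm (f x * g x))" by (simp add: norm_mult)
  moreover have "(\<lambda>x. f x * g x) \<in> borel_measurable lborel"
  proof -
    have [measurable]: "f \<in> borel_measurable borel" "g \<in> borel_measurable borel" using f g by (simp_all add: memLp_def)
    show ?thesis by measurable
  qed
  ultimately show "integrable lborel (\<lambda>x. f x * g x)" by (simp only: integrable_norm_iff)
  show "(\<integral>x. norm (f x) * norm (g x) \<partial>lborel) \<le> Lp_norm p f * Lp_norm q g"
    using Holder_powr(2)[OF i, of "1/p"] p unfolding e unfolding q(1) Lp_norm_def by simp
qed

lemma bcs_memLp: "bcs f \<Longrightarrow> p > 0 \<Longrightarrow> memLp p f"
  by (simp add: memLp_def bcs_powr_integrable bcs_measurable)

lemma Lp_norm_indicator_le: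
  assumes "bcs f" "X \<in> sets borel" "p > 0" shows "Lp_norm p (\<lambda>x. f x * indicator X x) \<le> Lp_norm p f"
  unfolding Lp_norm_def
proof (rule powr_mono2)
  show "(\<integral>x. norm (f x * indicator X x) powr p \<partial>lborel) \<le> (\<integral>x. norm (f x) powr p \<partial>lborel)"
    using assms by (intro integral_mono bcs_powr_integrable bcs_indicator) (auto simp: indicator_def)
qed (use assms in auto)

text \<open>Hoelder against the indicator of \<open>Y\<close>: lowering the exponent from
  \<open>p\<close> to \<open>r\<close> costs a power of the volume.\<close>

lemma integral_powr_le_Lp_norm:
  fixes f :: "'a::euclidean_space \<Rightarrow> complex"
  assumes f: "bcs f" and supp: "\<And>y. f y \<noteq> 0 \<Longrightarrow> y \<in> Y" and Y: "Y \<in> sets borel" "bounded Y" "measure lborel Y \<le> v"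
    and r: "0 < r" "r \<le> p"
  shows "(\<integral>y. norm (f y) powr r \<partial>lborel) \<le> v powr (1 - r/p) * Lp_norm p f powr r"
proof (cases "r = p")
  case True
  have "v powr 0 * Lp_norm p f powr r = Lp_norm p f powr r" if "v > 0" using that by simp
  \<comment> \<open>\<open>0 powr 0\<close> is 0, so for \<open>v = 0\<close> and
    \<open>r = p\<close> the right side is 0 and \<open>f\<close> must be shown to vanish almost
    everywhere.\<close>
  moreover have "Lp_norm p f powr r = 0" if "v \<le> 0"
  proof -
    have "measure lborel Y = 0" using Y(3) that measure_nonneg[of lborel Y] by linarith
    then have "emeasure lborel Y = 0" using bounded_finite_measure[OF Y(2)] by (auto simp: measure_def enn2real_eq_0_iff)
    then have "Y \<in> null_sets lborel" using Y(1) by auto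
    then have "AE y in lborel. y \<notin> Y" by (rule AE_not_in)
    then have "AE y in lborel. norm (f y) powr p = 0" by eventually_elim (use supp in fastforce)
    then have "(\<integral>y. norm (f y) powr p \<partial>lborel) = 0" by (rule integral_eq_zero_AE)
    then show ?thesis by (simp add: Lp_norm_def)
  qed
  ultimately show ?thesis using True r Lp_norm_powr[of p f] by (cases "v > 0") auto
next
  case False
  have \<theta>: "0 < r/p" "r/p < 1" using r False by auto
  have i1: "integrable lborel (\<lambda>y. norm (f y) powr p)" using bcs_powr_integrable[OF f] r by simp
  have i2: "integrable lborel (indicator Y :: 'a \<Rightarrow> real)" using bounded_finite_measure[OF Y(2)] Y(1) by simp
  have e: "(norm (f y) powr p) powr (r/p) * indicator Y y powr (1 - r/p) = norm (f y) powr r" for y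
    using supp[of y] r \<theta> by (cases "f y = 0") (auto simp: powr_powr)
  have "(\<integral>y. norm (f y) powr r \<partial>lborel) \<le> (\<integral>y. norm (f y) powr p \<partial>lborel) powr (r/p) * measure lborel Y powr (1 - r/p)"
    using Holder_powr(2)[OF i1 i2 _ _ \<theta>] unfolding e by simp
  also have "(\<integral>y. norm (f y) powr p \<partial>lborel) powr (r/p) = Lp_norm p f powr r"
    by (simp add: Lp_norm_def powr_powr)
  also have "Lp_norm p f powr r * measure lborel Y powr (1 - r/p) \<le> Lp_norm p f powr r * v powr (1 - r/p)"
    using Y(3) \<theta> by (intro mult_left_mono powr_mono2) auto
  finally show ?thesis by (simp add: mult.commute)
qed

section \<open>Bilinear forms with kernels in the class \<open>bcs\<close>\<close>

definition bil :: "('a::euclidean_space \<Rightarrow> 'b::euclidean_space \<Rightarrow> complex) \<Rightarrow> ('b \<Rightarrow> complex) \<Rightarrow> ('a \<Rightarrow> complex) \<Rightarrow> complex" where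
  "bil K f g = (\<integral>x. \<integral>y. K x y * f y * g x \<partial>lborel \<partial>lborel)"

lemma bcs_kernel_mult:
  fixes K :: "'a::euclidean_space \<Rightarrow> 'b::euclidean_space \<Rightarrow> complex"
  assumes K: "bcs (\<lambda>z. K (fst z) (snd z))" and f: "bcs f" and g: "bcs g"
  shows "bcs (\<lambda>z. K (fst z) (snd z) * f (snd z) * g (fst z))"
proof -
  obtain Mf where Mf: "Mf > 0" "\<And>x. norm (f x) \<le> Mf" using bcs_bound[OF f] by metis
  obtain Mg where Mg: "Mg > 0" "\<And>x. norm (g x) \<le> Mg" using bcs_bound[OF g] by metis
  note [measurable] = bcs_measurable[OF f] bcs_measurable[OF g]
  have m1: "(\<lambda>z :: 'a \<times> 'b. f (snd z)) \<in> borel_measurable (borel \<Otimes>\<^sub>M borel)" by measurable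
  have m2: "(\<lambda>z :: 'a \<times> 'b. g (fst z)) \<in> borel_measurable (borel \<Otimes>\<^sub>M borel)" by measurable
  show ?thesis
    by (rule bcs_mult[OF bcs_mult[OF K m1[unfolded borel_prod], of Mf] m2[unfolded borel_prod], of Mg]) (use Mf Mg in auto)
qed

lemma bil_eq_prod:
  assumes "bcs (\<lambda>z. K (fst z) (snd z))" "bcs f" "bcs g"
  shows "bil K f g = (\<integral>z. K (fst z) (snd z) * f (snd z) * g (fst z) \<partial>lborel)"
  unfolding bil_def using bcs_Fubini1[OF bcs_kernel_mult[OF assms]] by simp

lemma bcs_kernel_swap:
  assumes "bcs (\<lambda>z. K (fst z) (snd z))" shows "bcs (\<lambda>z. K (snd z) (fst z))"
  using bcs_swap[OF assms] by simp

lemma bil_swap: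
  assumes "bcs (\<lambda>z. K (fst z) (snd z))" "bcs f" "bcs g"
  shows "bil (\<lambda>y x. K x y) g f = bil K f g"
proof -
  have "bil K f g = (\<integral>y. \<integral>x. K x y * f y * g x \<partial>lborel \<partial>lborel)"
    unfolding bil_eq_prod[OF assms] using bcs_Fubini2[OF bcs_kernel_mult[OF assms]] by simp
  then show ?thesis unfolding bil_def by (simp add: mult_ac)
qed

lemma bil_sum:
  assumes "\<And>k. k \<in> S \<Longrightarrow> bcs (\<lambda>z. K k (fst z) (snd z))" "bcs f" "bcs g" "finite S"
  shows "bil (\<lambda>x y. \<Sum>k\<in>S. K k x y) f g = (\<Sum>k\<in>S. bil (K k) f g)"
proof -
  have 1: "bcs (\<lambda>z. \<Sum>k\<in>S. K k (fst z) (snd z))"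
    using assms(4,1)
  proof (induction S)
    case empty
    show ?case by (rule bcsI[where M=0 and X="{}"]) auto
  next
    case (insert k S)
    have a: "bcs (\<lambda>z. K k (fst z) (snd z))" "bcs (\<lambda>z. \<Sum>k\<in>S. K k (fst z) (snd z))" using insert by auto
    obtain M N where M: "\<And>z. norm (K k (fst z) (snd z)) \<le> M" and N: "\<And>z. norm (\<Sum>k\<in>S. K k (fst z) (snd z)) \<le> N"
      using bcs_bound[OF a(1)] bcs_bound[OF a(2)] by metis
    have b: "bounded ({z. K k (fst z) (snd z) \<noteq> 0} \<union> {z. (\<Sum>k\<in>S. K k (fst z) (snd z)) \<noteq> 0})"
      using a unfolding bcs_def by simp
    show ?case
    proof (rule bcsI[where M="M+N", OF _ _ _ b])
      show "(\<lambda>z. \<Sum>k\<in>insert k S. K k (fst z) (snd z)) \<in> borel_measurable borel"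
        using bcs_measurable[OF a(1)] bcs_measurable[OF a(2)] insert(1,2) by simp
      show "norm (\<Sum>k\<in>insert k S. K k (fst z) (snd z)) \<le> M + N" for z
        using norm_triangle_le[OF add_mono[OF M[of z] N[of z]]] insert(1,2) by simp
      show "z \<in> {z. K k (fst z) (snd z) \<noteq> 0} \<union> {z. (\<Sum>k\<in>S. K k (fst z) (snd z)) \<noteq> 0}" if "(\<Sum>k\<in>insert k S. K k (fst z) (snd z)) \<noteq> 0" for z
        using that insert(1,2) by auto
    qed
  qed
  have "(\<integral>z. (\<Sum>k\<in>S. K k (fst z) (snd z) * f (snd z) * g (fst z)) \<partial>lborel) = (\<Sum>k\<in>S. \<integral>z. K k (fst z) (snd z) * f (snd z) * g (fst z) \<partial>lborel)"
    by (rule Bochner_Integration.integral_sum) (rule bcs_integrable[OF bcs_kernel_mult[OF assms(1-3)]])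
  also have "\<dots> = (\<Sum>k\<in>S. bil (K k) f g)"
    by (intro sum.cong refl bil_eq_prod[symmetric] assms(1-3))
  finally show ?thesis unfolding bil_eq_prod[OF 1 assms(2,3)] by (simp only: sum_distrib_right)
qed

lemma bil_trivial_bound:
  assumes f: "bcs f" and g: "bcs g" and M: "\<And>x y. norm (K x y) \<le> M"
  shows "norm (bil K f g) \<le> M * (\<integral>y. norm (f y) \<partial>lborel) * (\<integral>x. norm (g x) \<partial>lborel)"
proof -
  have "norm (bil K f g) \<le> (\<integral>x. (M * (\<integral>y. norm (f y) \<partial>lborel)) * norm (g x) \<partial>lborel)"
    unfolding bil_def
  proof (rule norm_integral_le)
    show "integrable lborel (\<lambda>x. (M * (\<integral>y. norm (f y) \<partial>lborel)) * norm (g x))" using bcs_integrable[OF g] by simp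
    fix x
    have "norm (\<integral>y. K x y * f y * g x \<partial>lborel) \<le> (\<integral>y. M * norm (g x) * norm (f y) \<partial>lborel)"
    proof (rule norm_integral_le)
      show "integrable lborel (\<lambda>y. M * norm (g x) * norm (f y))" using bcs_integrable[OF f] by simp
      show "norm (K x y * f y * g x) \<le> M * norm (g x) * norm (f y)" for y
        using mult_right_mono[OF M[of x y], of "norm (f y) * norm (g x)"] by (simp add: norm_mult mult_ac)
    qed
    then show "norm (\<integral>y. K x y * f y * g x \<partial>lborel) \<le> M * (\<integral>y. norm (f y) \<partial>lborel) * norm (g x)"
      by (simp add: mult_ac)
  qed
  then show ?thesis by simp
qed

lemma bil_indicator:
  assumes "\<And>x y. K x y \<noteq> 0 \<Longrightarrow> x \<in> X \<and> y \<in> Y"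
  shows "bil K (\<lambda>y. f y * indicator Y y) (\<lambda>x. g x * indicator X x) = bil K f g"
proof -
  have eq: "K x y * (f y * indicator Y y) * (g x * indicator X x) = K x y * f y * g x" for x y
    using assms[of x y] by (cases "K x y = 0") (auto simp: indicator_def)
  show ?thesis unfolding bil_def eq ..
qed

section \<open>Interpolation by splitting at a height\<close>

text \<open>\<open>\<beta>\<close> solves \<open>\<beta> powr (q/2) = M * sqrt v / B\<close>, the
  condition that the two left sides agree; the right side is their common value. Writing
  \<open>M\<close>, \<open>v\<close> and \<open>B\<close> as exponentials makes both identities
  linear in the logarithms.\<close>

lemma interpolation_exponents:
  fixes p :: real
  assumes M: "M > 0" and v: "v > 0" and B: "B > 0" and p: "p \<ge> 2" and q: "1/p + 1/q = 1"
  defines "\<beta> \<equiv> (M * sqrt v / B) powr (2/q)"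
  shows "M * v powr (1 - 1/p) * \<beta> powr (1 - q) = M powr (1 - 2/p) * v powr (1 - 2/p) * B powr (2/p)"
    and "B * v powr (1/2 - 1/p) * \<beta> powr (1 - q/2) = M powr (1 - 2/p) * v powr (1 - 2/p) * B powr (2/p)"
proof -
  have q1: "1/q = 1 - 1/p" using q by simp
  have q0: "q \<noteq> 0" using q1 p by (auto simp: field_simps)
  have "(2/q) * (1 - q) = 2 * (1/q) - 2" using q0 by (simp add: field_simps)
  then have e1: "(2/q) * (1 - q) = - 2/p" unfolding q1 by simp
  have "(2/q) * (1 - q/2) = 2 * (1/q) - 1" using q0 by (simp add: field_simps)
  then have e2: "(2/q) * (1 - q/2) = 1 - 2/p" unfolding q1 by simp
  define m where "m = ln M"
  define w where "w = ln v"
  define b where "b = ln B"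
  have M': "M = exp m" and v': "v = exp w" and B': "B = exp b" using M v B by (simp_all add: m_def w_def b_def)
  have s: "sqrt v = exp (w/2)" unfolding v' by (rule real_sqrt_unique) (simp_all add: power2_eq_square exp_add[symmetric])
  have t: "M * sqrt v / B = exp (m + w/2 - b)" unfolding s M' B' by (simp add: exp_add exp_diff)
  show "M * v powr (1 - 1/p) * \<beta> powr (1 - q) = M powr (1 - 2/p) * v powr (1 - 2/p) * B powr (2/p)"
    unfolding \<beta>_def powr_powr e1 t unfolding M' v' B' powr_def
    by (simp add: exp_add[symmetric]) (use p in \<open>simp add: field_simps\<close>)
  show "B * v powr (1/2 - 1/p) * \<beta> powr (1 - q/2) = M powr (1 - 2/p) * v powr (1 - 2/p) * B powr (2/p)"
    unfolding \<beta>_def powr_powr e2 t unfolding M' v' B' powr_def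
    by (simp add: exp_add[symmetric]) (use p in \<open>simp add: field_simps\<close>)
qed

lemma Lp_norm_zero_AE:
  assumes "bcs g" "q > 0" "Lp_norm q g = 0" shows "AE x in lborel. g x = 0"
proof -
  have "(\<integral>x. norm (g x) powr q \<partial>lborel) = 0" using assms(3) by (simp add: Lp_norm_def)
  then have "AE x in lborel. norm (g x) powr q = 0"
    using integral_nonneg_eq_0_iff_AE[OF bcs_powr_integrable[OF assms(1,2)]] by simp
  then show ?thesis by eventually_elim (use assms(2) in simp)
qed

text \<open>The function \<open>g\<close> is split at a height balancing the trivial bound on its large part against the
  \<open>L\<^sup>2\<close> bound on its small part.\<close>

lemma bil_interpolation:
  fixes K :: "'a::euclidean_space \<Rightarrow> 'b::euclidean_space \<Rightarrow> complex"
  assumes K: "bcs (\<lambda>z. K (fst z) (snd z))" and f: "bcs f" and g: "bcs g"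
    and supp: "\<And>x y. K x y \<noteq> 0 \<Longrightarrow> x \<in> X \<and> y \<in> Y"
    and X: "X \<in> sets borel" "bounded X" and Y: "Y \<in> sets borel" "bounded Y" "measure lborel Y \<le> v"
    and M: "M > 0" "\<And>x y. norm (K x y) \<le> M" and v: "v > 0" and B: "B > 0"
    and L2: "\<And>f g. bcs f \<Longrightarrow> bcs g \<Longrightarrow> (\<And>y. f y \<noteq> 0 \<Longrightarrow> y \<in> Y) \<Longrightarrow> (\<And>x. g x \<noteq> 0 \<Longrightarrow> x \<in> X) \<Longrightarrow>
        norm (bil K f g) \<le> B * L2 f * L2 g"
    and p: "p \<ge> 2" and q: "1/p + 1/q = 1"
  shows "norm (bil K f g) \<le> 2 * (M powr (1 - 2/p) * v powr (1 - 2/p) * B powr (2/p)) * Lp_norm p f * Lp_norm q g"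
proof -
  define C where "C = M powr (1 - 2/p) * v powr (1 - 2/p) * B powr (2/p)"
  have C0: "C \<ge> 0" unfolding C_def by simp
  have p1: "p > 1" using p by simp
  note q1 = conjugate_exponent(1)[OF p1 q]
  have q2: "1 < q" "q \<le> 2"
  proof -
    show q: "1 < q" by (rule conjugate_exponent(2)[OF p1 q])
    have "1/2 \<le> 1/q" unfolding q1 using p by (simp add: field_simps)
    then show "q \<le> 2" using q by (simp add: field_simps)
  qed
  \<comment> \<open>The hypothesis \<open>L2\<close> applies to functions supported in
    \<open>Y\<close> and \<open>X\<close>. Restriction leaves the form unchanged and does not
    increase the norms.\<close>
  define f0 where "f0 y = f y * indicator Y y" for y
  define g0 where "g0 x = g x * indicator X x" for x
  have bf0: "bcs f0" unfolding f0_def by (rule bcs_indicator[OF f Y(1)])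
  have bg0: "bcs g0" unfolding g0_def by (rule bcs_indicator[OF g X(1)])
  have f0s: "y \<in> Y" if "f0 y \<noteq> 0" for y using that unfolding f0_def by (auto simp: indicator_def split: if_splits)
  have g0s: "x \<in> X" if "g0 x \<noteq> 0" for x using that unfolding g0_def by (auto simp: indicator_def split: if_splits)
  define F where "F = Lp_norm p f0"
  define G where "G = Lp_norm q g0"
  have F: "0 \<le> F" "F \<le> Lp_norm p f" unfolding F_def f0_def using Lp_norm_nonneg Lp_norm_indicator_le[OF f Y(1)] p by auto
  have G: "0 \<le> G" "G \<le> Lp_norm q g" unfolding G_def g0_def using Lp_norm_nonneg Lp_norm_indicator_le[OF g X(1)] q2 by auto
  have bil0: "bil K f g = bil K f0 g0"
    unfolding f0_def g0_def using bil_indicator[of K X Y f g] supp by simp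
  \<comment> \<open>Only \<open>g\<close> is split: since p \<ge> 2 and \<open>Y\<close> has finite
    measure, the L^1 and L^2 norms of \<open>f0\<close> are already bounded by its L^p norm times a
    power of \<open>v\<close>.\<close>
  have f1: "(\<integral>y. norm (f0 y) \<partial>lborel) \<le> v powr (1 - 1/p) * F"
    using integral_powr_le_Lp_norm[OF bf0 f0s Y, of 1 p] p F unfolding F_def by simp
  have f2: "L2 f0 \<le> v powr (1/2 - 1/p) * F"
  proof -
    have "(\<integral>y. norm (f0 y) powr 2 \<partial>lborel) \<le> v powr (1 - 2/p) * F powr 2"
      using integral_powr_le_Lp_norm[OF bf0 f0s Y, of 2 p] p unfolding F_def by simp
    also have "\<dots> = (v powr (1/2 - 1/p) * F)\<^sup>2"
    proof -
      have "(v powr (1/2 - 1/p))\<^sup>2 = v powr ((1/2 - 1/p) + (1/2 - 1/p))" unfolding power2_eq_square by (rule powr_add[symmetric])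
      also have "(1/2 - 1/p) + (1/2 - 1/p) = 1 - 2/p" by simp
      finally show ?thesis using F by (simp add: power_mult_distrib powr_numeral)
    qed
    finally have "(\<integral>y. (norm (f0 y))\<^sup>2 \<partial>lborel) \<le> (v powr (1/2 - 1/p) * F)\<^sup>2" by (simp add: powr_numeral)
    then show ?thesis using F by (intro real_le_lsqrt) auto
  qed
  have "norm (bil K f0 g0) \<le> 2 * C * F * G"
  proof (cases "G = 0")
    case True
    have "AE x in lborel. g0 x = 0" by (rule Lp_norm_zero_AE[OF bg0, of q]) (use q2 True G_def in auto)
    then have "AE x in lborel. norm (g0 x) = 0" by eventually_elim simp
    then have "(\<integral>x. norm (g0 x) \<partial>lborel) = 0" by (rule integral_eq_zero_AE)
    then show ?thesis using bil_trivial_bound[OF bf0 bg0 M(2)] True by simp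
  next
    case False
    then have Gp: "G > 0" using G by simp
    define \<beta> where "\<beta> = (M * sqrt v / B) powr (2/q)"
    have \<beta>: "\<beta> > 0" unfolding \<beta>_def using M B v by simp
    \<comment> \<open>Scaling the height by \<open>G\<close> makes the bounds on both pieces
      homogeneous of degree 1 in \<open>g\<close>.\<close>
    define \<alpha> where "\<alpha> = G * \<beta>"
    have \<alpha>: "\<alpha> > 0" unfolding \<alpha>_def using Gp \<beta> by simp
    define L where "L = {x. norm (g0 x) > \<alpha>}"
    have [measurable]: "g0 \<in> borel_measurable borel" by (rule bcs_measurable[OF bg0])
    have L: "L \<in> sets borel" "-L \<in> sets borel" unfolding L_def by measurable
    define g1 where "g1 x = g0 x * indicator L x" for x
    define g2 where "g2 x = g0 x * indicator (-L) x" for x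
    have bg1: "bcs g1" unfolding g1_def by (rule bcs_indicator[OF bg0 L(1)])
    have bg2: "bcs g2" unfolding g2_def by (rule bcs_indicator[OF bg0 L(2)])
    have iq: "integrable lborel (\<lambda>x. norm (g0 x) powr q)" by (rule bcs_powr_integrable[OF bg0]) (use q2 in simp)
    have Gq: "(\<integral>x. norm (g0 x) powr q \<partial>lborel) = G powr q" unfolding G_def using Lp_norm_powr[of q g0] q2 by simp
    \<comment> \<open>Above the height, the negative power \<open>1 - q\<close> of |g0| is at most
      that of \<open>\<alpha>\<close>; below it, the same holds for the power \<open>2 - q\<close>,
      nonnegative because q \<le> 2. Both times what remains is |g0|^q.\<close>
    have "(\<integral>x. norm (g1 x) \<partial>lborel) \<le> (\<integral>x. \<alpha> powr (1 - q) * norm (g0 x) powr q \<partial>lborel)"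
    proof (rule integral_mono)
      show "integrable lborel (\<lambda>x. norm (g1 x))" using bcs_integrable[OF bg1] by simp
      show "integrable lborel (\<lambda>x. \<alpha> powr (1 - q) * norm (g0 x) powr q)" using iq by simp
      fix x
      show "norm (g1 x) \<le> \<alpha> powr (1 - q) * norm (g0 x) powr q"
      proof (cases "x \<in> L")
        case True
        then have u: "norm (g0 x) > \<alpha>" unfolding L_def by simp
        have "norm (g0 x) = norm (g0 x) powr (1 - q) * norm (g0 x) powr q"
          using u \<alpha> by (simp add: powr_add[symmetric])
        also have "\<dots> \<le> \<alpha> powr (1 - q) * norm (g0 x) powr q"
          using u \<alpha> q2 by (intro mult_right_mono powr_mono2') auto
        finally show ?thesis using True by (simp add: g1_def)
      qed (simp add: g1_def)
    qed
    then have n1: "(\<integral>x. norm (g1 x) \<partial>lborel) \<le> \<beta> powr (1 - q) * G"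
      using Gq Gp \<beta> unfolding \<alpha>_def by (simp add: powr_mult powr_add[symmetric] mult_ac)
        (simp add: mult.assoc[symmetric] powr_add[symmetric])
    have "(\<integral>x. (norm (g2 x))\<^sup>2 \<partial>lborel) \<le> (\<integral>x. \<alpha> powr (2 - q) * norm (g0 x) powr q \<partial>lborel)"
    proof (rule integral_mono)
      show "integrable lborel (\<lambda>x. (norm (g2 x))\<^sup>2)" by (rule bcs_square_integrable[OF bg2])
      show "integrable lborel (\<lambda>x. \<alpha> powr (2 - q) * norm (g0 x) powr q)" using iq by simp
      fix x
      show "(norm (g2 x))\<^sup>2 \<le> \<alpha> powr (2 - q) * norm (g0 x) powr q"
      proof (cases "x \<in> L \<or> g0 x = 0")
        case False
        then have u: "norm (g0 x) \<le> \<alpha>" "norm (g0 x) > 0" unfolding L_def by auto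
        have "(norm (g0 x))\<^sup>2 = norm (g0 x) powr (2 - q) * norm (g0 x) powr q"
          using u by (simp add: powr_add[symmetric] powr_numeral)
        also have "\<dots> \<le> \<alpha> powr (2 - q) * norm (g0 x) powr q"
          using u \<alpha> q2 by (intro mult_right_mono powr_mono2) auto
        finally show ?thesis using False by (simp add: g2_def)
      qed (auto simp: g2_def)
    qed
    also have "\<dots> = (\<beta> powr (1 - q/2) * G)\<^sup>2"
    proof -
      have "(\<integral>x. \<alpha> powr (2 - q) * norm (g0 x) powr q \<partial>lborel) = \<beta> powr (2 - q) * (G powr (2 - q) * G powr q)"
        using Gq Gp \<beta> unfolding \<alpha>_def by (simp add: powr_mult mult_ac)
      also have "G powr (2 - q) * G powr q = G\<^sup>2" using Gp by (simp add: powr_add[symmetric] powr_numeral)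
      also have "\<beta> powr (2 - q) = (\<beta> powr (1 - q/2))\<^sup>2"
      proof -
        have "(\<beta> powr (1 - q/2))\<^sup>2 = \<beta> powr ((1 - q/2) + (1 - q/2))" unfolding power2_eq_square by (rule powr_add[symmetric])
        also have "(1 - q/2) + (1 - q/2) = 2 - q" by simp
        finally show ?thesis by simp
      qed
      finally show ?thesis by (simp add: power_mult_distrib)
    qed
    finally have n2: "L2 g2 \<le> \<beta> powr (1 - q/2) * G"
      using Gp by (intro real_le_lsqrt) auto
    have "bil K f0 g0 = bil K f0 g1 + bil K f0 g2"
    proof -
      have e: "K (fst z) (snd z) * f0 (snd z) * g0 (fst z) = K (fst z) (snd z) * f0 (snd z) * g1 (fst z) + K (fst z) (snd z) * f0 (snd z) * g2 (fst z)" for z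
        unfolding g1_def g2_def by (simp add: indicator_def)
      show ?thesis
        unfolding bil_eq_prod[OF K bf0 bg0] bil_eq_prod[OF K bf0 bg1] bil_eq_prod[OF K bf0 bg2] e
        by (rule Bochner_Integration.integral_add) (intro bcs_integrable bcs_kernel_mult K bf0 bg1 bg2)+
    qed
    then have "norm (bil K f0 g0) \<le> norm (bil K f0 g1) + norm (bil K f0 g2)" by (simp add: norm_triangle_ineq)
    also have "norm (bil K f0 g1) \<le> M * (\<integral>y. norm (f0 y) \<partial>lborel) * (\<integral>x. norm (g1 x) \<partial>lborel)"
      by (rule bil_trivial_bound[OF bf0 bg1 M(2)])
    also have "\<dots> \<le> M * (v powr (1 - 1/p) * F) * (\<beta> powr (1 - q) * G)"
      using f1 n1 M(1) F by (intro mult_mono) (auto intro!: integral_nonneg_AE)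
    also have "\<dots> = C * F * G"
      using interpolation_exponents(1)[OF M(1) v B p q, folded \<beta>_def C_def] by (simp add: mult_ac) 
    also have "norm (bil K f0 g2) \<le> B * L2 f0 * L2 g2"
    proof (rule L2[OF bf0 bg2 f0s])
      show "x \<in> X" if "g2 x \<noteq> 0" for x using that g0s unfolding g2_def by auto
    qed
    also have "\<dots> \<le> B * (v powr (1/2 - 1/p) * F) * (\<beta> powr (1 - q/2) * G)"
      using f2 n2 B F by (intro mult_mono) (auto intro!: integral_nonneg_AE)
    also have "\<dots> = C * F * G"
      using interpolation_exponents(2)[OF M(1) v B p q, folded \<beta>_def C_def] by (simp add: mult_ac)
    finally show ?thesis by simp
  qed
  also have "\<dots> \<le> 2 * C * Lp_norm p f * Lp_norm q g"
    using F G C0 by (intro mult_mono) auto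
  finally show ?thesis unfolding bil0 C_def .
qed

text \<open>The previous estimate for the transposed kernel: now \<open>f\<close> has exponent at
  most 2 and is the function that is split, while the volume of \<open>X\<close> pays for
  \<open>g\<close>.\<close>

lemma bil_interpolation_dual:
  fixes K :: "'a::euclidean_space \<Rightarrow> 'b::euclidean_space \<Rightarrow> complex"
  assumes K: "bcs (\<lambda>z. K (fst z) (snd z))" and f: "bcs f" and g: "bcs g"
    and supp: "\<And>x y. K x y \<noteq> 0 \<Longrightarrow> x \<in> X \<and> y \<in> Y"
    and X: "X \<in> sets borel" "bounded X" "measure lborel X \<le> v" and Y: "Y \<in> sets borel" "bounded Y"
    and M: "M > 0" "\<And>x y. norm (K x y) \<le> M" and v: "v > 0" and B: "B > 0"
    and L2: "\<And>f g. bcs f \<Longrightarrow> bcs g \<Longrightarrow> (\<And>y. f y \<noteq> 0 \<Longrightarrow> y \<in> Y) \<Longrightarrow> (\<And>x. g x \<noteq> 0 \<Longrightarrow> x \<in> X) \<Longrightarrow>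
        norm (bil K f g) \<le> B * L2 f * L2 g"
    and q: "q \<ge> 2" and pq: "1/p + 1/q = 1"
  shows "norm (bil K f g) \<le> 2 * (M powr (1 - 2/q) * v powr (1 - 2/q) * B powr (2/q)) * Lp_norm p f * Lp_norm q g"
proof -
  have "norm (bil (\<lambda>y x. K x y) g f) \<le> 2 * (M powr (1 - 2/q) * v powr (1 - 2/q) * B powr (2/q)) * Lp_norm q g * Lp_norm p f"
  proof (rule bil_interpolation[where X=Y and Y=X])
    show "bcs (\<lambda>z. K (snd z) (fst z))" by (rule bcs_kernel_swap[OF K])
    show "norm (bil (\<lambda>y x. K x y) f' g') \<le> B * sqrt (\<integral>y. (norm (f' y))\<^sup>2 \<partial>lborel) * sqrt (\<integral>x. (norm (g' x))\<^sup>2 \<partial>lborel)"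
      if "bcs f'" "bcs g'" "\<And>y. f' y \<noteq> 0 \<Longrightarrow> y \<in> X" "\<And>x. g' x \<noteq> 0 \<Longrightarrow> x \<in> Y" for f' g'
      using L2[OF that(2,1,4,3)] unfolding bil_swap[OF K that(2,1)] by (simp add: mult_ac)
    show "1/q + 1/p = 1" using pq by simp
  qed (use f g supp X Y M v B q in auto)
  then show ?thesis unfolding bil_swap[OF K f g] by (simp add: mult_ac)
qed

text \<open>Size alone, by Hoelder on \<open>X\<close> and \<open>Y\<close>. For cubes of side
  comparable to \<rho> the volumes combine to \<rho>^(n/p + m(1 - 1/p)), the benchmark against which
  oscillation gains and the bound for the innermost cube.\<close>

lemma bil_Lp_trivial_bound:
  fixes K :: "'a::euclidean_space \<Rightarrow> 'b::euclidean_space \<Rightarrow> complex"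
  assumes f: "bcs f" and g: "bcs g"
    and supp: "\<And>x y. K x y \<noteq> 0 \<Longrightarrow> x \<in> X \<and> y \<in> Y"
    and X: "X \<in> sets borel" "bounded X" "measure lborel X \<le> w" and Y: "Y \<in> sets borel" "bounded Y" "measure lborel Y \<le> v"
    and M: "\<And>x y. norm (K x y) \<le> M" and p: "p > 1" and pq: "1/p + 1/q = 1"
  shows "norm (bil K f g) \<le> M * v powr (1 - 1/p) * w powr (1/p) * Lp_norm p f * Lp_norm q g"
proof -
  have q1: "1/q = 1 - 1/p" and "q > 1" using conjugate_exponent[OF p pq] by auto
  define f0 where "f0 y = f y * indicator Y y" for y
  define g0 where "g0 x = g x * indicator X x" for x
  have bf0: "bcs f0" unfolding f0_def by (rule bcs_indicator[OF f Y(1)])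
  have bg0: "bcs g0" unfolding g0_def by (rule bcs_indicator[OF g X(1)])
  have f0s: "y \<in> Y" if "f0 y \<noteq> 0" for y using that unfolding f0_def by (auto simp: indicator_def split: if_splits)
  have g0s: "x \<in> X" if "g0 x \<noteq> 0" for x using that unfolding g0_def by (auto simp: indicator_def split: if_splits)
  have M0: "M \<ge> 0" using M norm_ge_zero order_trans by blast
  have "(\<integral>y. norm (f0 y) \<partial>lborel) \<le> v powr (1 - 1/p) * Lp_norm p f0"
    using integral_powr_le_Lp_norm[OF bf0 f0s Y, of 1 p] p Lp_norm_nonneg[of p f0] by simp
  also have "\<dots> \<le> v powr (1 - 1/p) * Lp_norm p f"
    unfolding f0_def using Lp_norm_indicator_le[OF f Y(1)] p by (intro mult_left_mono) auto
  finally have 1: "(\<integral>y. norm (f0 y) \<partial>lborel) \<le> v powr (1 - 1/p) * Lp_norm p f" .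
  have "(\<integral>x. norm (g0 x) \<partial>lborel) \<le> w powr (1/p) * Lp_norm q g0"
    using integral_powr_le_Lp_norm[OF bg0 g0s X, of 1 q] \<open>q > 1\<close> Lp_norm_nonneg[of q g0] q1 by simp
  also have "\<dots> \<le> w powr (1/p) * Lp_norm q g"
    unfolding g0_def using Lp_norm_indicator_le[OF g X(1)] \<open>q > 1\<close> by (intro mult_left_mono) auto
  finally have 2: "(\<integral>x. norm (g0 x) \<partial>lborel) \<le> w powr (1/p) * Lp_norm q g" .
  have "bil K f g = bil K f0 g0"
    unfolding f0_def g0_def using bil_indicator[of K X Y f g] supp by simp
  also have "norm \<dots> \<le> M * (\<integral>y. norm (f0 y) \<partial>lborel) * (\<integral>x. norm (g0 x) \<partial>lborel)"
    by (rule bil_trivial_bound[OF bf0 bg0 M])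
  also have "\<dots> \<le> M * (v powr (1 - 1/p) * Lp_norm p f) * (w powr (1/p) * Lp_norm q g)"
    using 1 2 M0 Lp_norm_nonneg[of p f] by (intro mult_mono) (auto intro!: integral_nonneg_AE)
  finally show ?thesis by (simp add: mult_ac)
qed

section \<open>Homogeneous phases and cut-offs\<close>

definition xmon :: "('n::finite \<Rightarrow> nat) \<Rightarrow> real^'n \<Rightarrow> real" where
  "xmon \<alpha> x = (\<Prod>c\<in>UNIV. (x $ c) ^ \<alpha> c)"

text \<open>The \<open>i\<close>-th partial derivative of the monomial; \<open>xmon2\<close> is the
  second one. Truncated subtraction in the exponents is harmless, because the coefficient is 0
  whenever truncation occurs.\<close>

definition xmon1 :: "('n::finite \<Rightarrow> nat) \<Rightarrow> 'n \<Rightarrow> real^'n \<Rightarrow> real" where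
  "xmon1 \<alpha> i x = real (\<alpha> i) * (x $ i) ^ (\<alpha> i - 1) * (\<Prod>c\<in>UNIV-{i}. (x $ c) ^ \<alpha> c)"

definition xmon2 :: "('n::finite \<Rightarrow> nat) \<Rightarrow> 'n \<Rightarrow> real^'n \<Rightarrow> real" where
  "xmon2 \<alpha> i x = real (\<alpha> i) * real (\<alpha> i - 1) * (x $ i) ^ (\<alpha> i - 2) * (\<Prod>c\<in>UNIV-{i}. (x $ c) ^ \<alpha> c)"

lemma xmon_split: "xmon \<alpha> x = (x $ i) ^ \<alpha> i * (\<Prod>c\<in>UNIV-{i}. (x $ c) ^ \<alpha> c)"
  unfolding xmon_def by (subst prod.remove[of UNIV i]) auto

lemma line_component: "(x + s *\<^sub>R axis i (1::real)) $ c = (if c = i then x $ i + s else x $ c)"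
  by (simp add: axis_def)

lemma prod_line: "(\<Prod>c\<in>UNIV-{i}. ((x + s *\<^sub>R axis i (1::real)) $ c) ^ \<alpha> c) = (\<Prod>c\<in>UNIV-{i}. (x $ c) ^ \<alpha> c)"
  by (intro prod.cong) (auto simp: axis_def)

lemma xmon_deriv: "((\<lambda>s. xmon \<alpha> (x + s *\<^sub>R axis i 1)) has_real_derivative xmon1 \<alpha> i (x + s *\<^sub>R axis i 1)) (at s)"
  unfolding xmon_split[of \<alpha> _ i] xmon1_def prod_line line_component
  by (auto intro!: derivative_eq_intros)

lemma xmon1_deriv: "((\<lambda>s. xmon1 \<alpha> i (x + s *\<^sub>R axis i 1)) has_real_derivative xmon2 \<alpha> i (x + s *\<^sub>R axis i 1)) (at s)"
  unfolding xmon2_def xmon1_def prod_line line_component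
  by (auto intro!: derivative_eq_intros simp: numeral_2_eq_2)

lemma xmon_cont: "continuous_on A (xmon \<alpha>)" "continuous_on A (xmon1 \<alpha> i)" "continuous_on A (xmon2 \<alpha> i)"
  unfolding xmon_def[abs_def] xmon1_def[abs_def] xmon2_def[abs_def] by (intro continuous_intros)+

lemma xmon_differentiable: "xmon \<alpha> differentiable (at x)"
proof -
  have "((\<lambda>x. \<Prod>c\<in>UNIV. (x $ c) ^ \<alpha> c) has_derivative
     (\<lambda>y. \<Sum>c\<in>UNIV. (of_nat (\<alpha> c) * (y $ c) * (x $ c) ^ (\<alpha> c - 1)) * (\<Prod>j\<in>UNIV - {c}. (x $ j) ^ \<alpha> j))) (at x)"
    by (rule has_derivative_prod) (auto intro!: derivative_eq_intros bounded_linear_imp_has_derivative bounded_linear_vec_nth)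
  then show ?thesis unfolding xmon_def[abs_def] by (rule differentiableI)
qed

lemma xmon_scale: "xmon \<alpha> (r *\<^sub>R x) = r ^ (sum \<alpha> UNIV) * xmon \<alpha> x"
  unfolding xmon_def by (simp add: power_mult_distrib prod.distrib power_sum)

lemma prod_scale: "(\<Prod>c\<in>UNIV-{i}. ((r *\<^sub>R x) $ c) ^ \<alpha> c) = r ^ (sum \<alpha> (UNIV-{i})) * (\<Prod>c\<in>UNIV-{i}. (x $ c) ^ \<alpha> c)"
  by (simp add: power_mult_distrib prod.distrib power_sum)

text \<open>Homogeneity of degree one less than the monomial, multiplied by \<open>r\<close> so that
  no exponent is subtracted and every real \<open>r\<close> is allowed.\<close>

lemma xmon1_scale: "r * xmon1 \<alpha> i (r *\<^sub>R x) = r ^ (sum \<alpha> UNIV) * xmon1 \<alpha> i x"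
proof (cases "\<alpha> i")
  case (Suc k)
  then show ?thesis unfolding xmon1_def prod_scale
    by (subst sum.remove[of UNIV i]) (auto simp: power_mult_distrib power_add algebra_simps)
qed (simp add: xmon1_def)

lemma xmon2_scale: "r^2 * xmon2 \<alpha> i (r *\<^sub>R x) = r ^ (sum \<alpha> UNIV) * xmon2 \<alpha> i x"
proof (cases "\<alpha> i \<ge> 2")
  case True
  then obtain k where "\<alpha> i = k + 2" by (metis add.commute le_Suc_ex)
  then show ?thesis unfolding xmon2_def prod_scale
    by (subst sum.remove[of UNIV i]) (auto simp: power_mult_distrib power_add algebra_simps power2_eq_square)
next
  case False
  then have "\<alpha> i = 0 \<or> \<alpha> i = 1" by linarith
  then show ?thesis by (auto simp: xmon2_def)
qed

lemma finite_multi_indices: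
  "finite {(\<alpha> :: 'n::finite \<Rightarrow> nat, \<beta> :: 'm::finite \<Rightarrow> nat). sum \<alpha> UNIV + sum \<beta> UNIV = d}"
proof (rule finite_subset)
  show "finite (PiE UNIV (\<lambda>_::'n. {..d}) \<times> PiE UNIV (\<lambda>_::'m. {..d}))"
    by (intro finite_cartesian_product finite_PiE) auto
  show "{(\<alpha> :: 'n \<Rightarrow> nat, \<beta> :: 'm \<Rightarrow> nat). sum \<alpha> UNIV + sum \<beta> UNIV = d} \<subseteq> PiE UNIV (\<lambda>_::'n. {..d}) \<times> PiE UNIV (\<lambda>_::'m. {..d})"
  proof clarify
    fix \<alpha> :: "'n \<Rightarrow> nat" and \<beta> :: "'m \<Rightarrow> nat" assume "d = sum \<alpha> UNIV + sum \<beta> UNIV"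
    moreover have "\<alpha> i \<le> sum \<alpha> UNIV" for i by (rule member_le_sum) auto
    moreover have "\<beta> i \<le> sum \<beta> UNIV" for i by (rule member_le_sum) auto
    ultimately show "\<alpha> \<in> UNIV \<rightarrow>\<^sub>E {..sum \<alpha> UNIV + sum \<beta> UNIV} \<and> \<beta> \<in> UNIV \<rightarrow>\<^sub>E {..sum \<alpha> UNIV + sum \<beta> UNIV}"
      by (auto simp: PiE_UNIV_domain intro: trans_le_add1 trans_le_add2)
  qed
qed

text \<open>\<open>mixed_partial\<close> speaks of Frechet derivatives while the calculus is done on
  coordinate lines; differentiability makes the two agree.\<close>

lemma frechet_derivative_line:
  fixes f :: "'a::real_normed_vector \<Rightarrow> real"
  assumes "f differentiable (at x)" "((\<lambda>s. f (x + s *\<^sub>R v)) has_real_derivative D) (at 0)"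
  shows "frechet_derivative f (at x) v = D"
proof -
  have fd: "(f has_derivative frechet_derivative f (at x)) (at (x + 0 *\<^sub>R v))"
    using assms(1) by (simp add: frechet_derivative_works)
  have "((\<lambda>s. x + s *\<^sub>R v) has_derivative (\<lambda>s. s *\<^sub>R v)) (at 0)" by (auto intro!: derivative_eq_intros)
  from has_derivative_compose[OF this fd]
  have "((\<lambda>s. f (x + s *\<^sub>R v)) has_derivative (\<lambda>s. frechet_derivative f (at x) (s *\<^sub>R v))) (at 0)" .
  moreover have "(\<lambda>s. frechet_derivative f (at x) (s *\<^sub>R v)) = (*) (frechet_derivative f (at x) v)"
    using linear_frechet_derivative[OF assms(1)] by (auto simp: linear_cmul)
  ultimately have "((\<lambda>s. f (x + s *\<^sub>R v)) has_real_derivative frechet_derivative f (at x) v) (at 0)"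
    by (simp add: has_field_derivative_def)
  then show ?thesis using assms(2) DERIV_unique by blast
qed

lemma sum_differentiable_at:
  fixes f :: "'i \<Rightarrow> 'a::real_normed_vector \<Rightarrow> real"
  assumes "finite I" "\<And>i. i \<in> I \<Longrightarrow> f i differentiable (at x)"
  shows "(\<lambda>x. \<Sum>i\<in>I. f i x) differentiable (at x)"
  using assms by (intro differentiable_sum) auto

text \<open>What the estimates use of a polynomial. In the kernel of T*T the phase is
  \<open>S x y - S x y'\<close>. By the mean value theorem in the second variable, its first and
  second derivatives in the \<open>i\<close>-th coordinate of \<open>x\<close> are values of
  \<open>S11\<close> and \<open>S21\<close> times the displacement; hence the scaling and continuity
  of these two, besides those of \<open>S\<close>.\<close>

locale homogeneous_phase =
  fixes S :: "real^'n \<Rightarrow> real^'m \<Rightarrow> real" and d :: nat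
    and S1 S2 :: "'n \<Rightarrow> real^'n \<Rightarrow> real^'m \<Rightarrow> real" and S11 S21 :: "'n \<Rightarrow> 'm \<Rightarrow> real^'n \<Rightarrow> real^'m \<Rightarrow> real"
  assumes S_hom: "S (r *\<^sub>R x) (r *\<^sub>R y) = r ^ d * S x y"
    and S_cont: "continuous_on UNIV (\<lambda>z. S (fst z) (snd z))"
    and S1: "((\<lambda>s. S (x + s *\<^sub>R axis i 1) y) has_real_derivative S1 i (x + s *\<^sub>R axis i 1) y) (at s)"
    and S2: "((\<lambda>s. S1 i (x + s *\<^sub>R axis i 1) y) has_real_derivative S2 i (x + s *\<^sub>R axis i 1) y) (at s)"
    and S11: "((\<lambda>t. S1 i x (y + t *\<^sub>R axis j 1)) has_real_derivative S11 i j x (y + t *\<^sub>R axis j 1)) (at t)"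
    and S21: "((\<lambda>t. S2 i x (y + t *\<^sub>R axis j 1)) has_real_derivative S21 i j x (y + t *\<^sub>R axis j 1)) (at t)"
    and S11_hom: "r ^ 2 * S11 i j (r *\<^sub>R x) (r *\<^sub>R y) = r ^ d * S11 i j x y"
    and S21_hom: "r ^ 3 * S21 i j (r *\<^sub>R x) (r *\<^sub>R y) = r ^ d * S21 i j x y"
    and S11_cont: "continuous_on UNIV (\<lambda>z. S11 i j (fst z) (snd z))"
    and S21_cont: "continuous_on UNIV (\<lambda>z. S21 i j (fst z) (snd z))"

lemma homogeneous_poly_phase:
  fixes S :: "real^'n \<Rightarrow> real^'m \<Rightarrow> real"
  assumes "homogeneous_poly d S"
  obtains S1 S2 S11 S21 where "homogeneous_phase S d S1 S2 S11 S21" "\<And>i j x y. mixed_partial S i j x y = S11 i j x y"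
proof -
  define I where "I = {(\<alpha> :: 'n \<Rightarrow> nat, \<beta> :: 'm \<Rightarrow> nat). sum \<alpha> UNIV + sum \<beta> UNIV = d}"
  have fI: "finite I" unfolding I_def by (rule finite_multi_indices)
  obtain c where "\<And>x y. S x y = (\<Sum>(\<alpha>,\<beta>)\<in>I. c \<alpha> \<beta> * (\<Prod>i\<in>UNIV. (x $ i) ^ \<alpha> i) * (\<Prod>j\<in>UNIV. (y $ j) ^ \<beta> j))"
    using assms unfolding homogeneous_poly_def I_def by blast
  then have S: "S x y = (\<Sum>k\<in>I. c (fst k) (snd k) * xmon (fst k) x * xmon (snd k) y)" for x y
    by (simp add: xmon_def case_prod_beta)
  define S1 where "S1 i x y = (\<Sum>k\<in>I. c (fst k) (snd k) * xmon1 (fst k) i x * xmon (snd k) y)" for i x y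
  define S2 where "S2 i x y = (\<Sum>k\<in>I. c (fst k) (snd k) * xmon2 (fst k) i x * xmon (snd k) y)" for i x y
  define S11 where "S11 i j x y = (\<Sum>k\<in>I. c (fst k) (snd k) * xmon1 (fst k) i x * xmon1 (snd k) j y)" for i j x y
  define S21 where "S21 i j x y = (\<Sum>k\<in>I. c (fst k) (snd k) * xmon2 (fst k) i x * xmon1 (snd k) j y)" for i j x y
  have deg: "sum (fst k) UNIV + sum (snd k) UNIV = d" if "k \<in> I" for k using that unfolding I_def by auto
  note cc = continuous_on_compose2[OF xmon_cont(1)[of UNIV]] continuous_on_compose2[OF xmon_cont(2)[of UNIV]] continuous_on_compose2[OF xmon_cont(3)[of UNIV]]
  show thesis
  proof (rule that[of S1 S2 S11 S21])
    show "homogeneous_phase S d S1 S2 S11 S21"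
    proof
      show "S (r *\<^sub>R x) (r *\<^sub>R y) = r ^ d * S x y" for x y r
        unfolding S sum_distrib_left
        by (intro sum.cong refl) (simp add: xmon_scale deg[symmetric] power_add mult_ac)
      show "continuous_on UNIV (\<lambda>z. S (fst z) (snd z))" unfolding S by (intro continuous_intros cc) auto
      show "continuous_on UNIV (\<lambda>z. S11 i j (fst z) (snd z))" for i j unfolding S11_def by (intro continuous_intros cc) auto
      show "continuous_on UNIV (\<lambda>z. S21 i j (fst z) (snd z))" for i j unfolding S21_def by (intro continuous_intros cc) auto
      show D1: "((\<lambda>s. S (x + s *\<^sub>R axis i 1) y) has_real_derivative S1 i (x + s *\<^sub>R axis i 1) y) (at s)" for i x y s
        unfolding S S1_def by (intro DERIV_sum DERIV_cmult_right DERIV_cmult xmon_deriv)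
      show "((\<lambda>s. S1 i (x + s *\<^sub>R axis i 1) y) has_real_derivative S2 i (x + s *\<^sub>R axis i 1) y) (at s)" for i x y s
        unfolding S2_def S1_def by (intro DERIV_sum DERIV_cmult_right DERIV_cmult xmon1_deriv)
      show "((\<lambda>t. S1 i x (y + t *\<^sub>R axis j 1)) has_real_derivative S11 i j x (y + t *\<^sub>R axis j 1)) (at t)" for i j x y t
        unfolding S11_def S1_def by (intro DERIV_sum DERIV_cmult_right DERIV_cmult xmon_deriv)
      show "((\<lambda>t. S2 i x (y + t *\<^sub>R axis j 1)) has_real_derivative S21 i j x (y + t *\<^sub>R axis j 1)) (at t)" for i j x y t
        unfolding S21_def S2_def by (intro DERIV_sum DERIV_cmult_right DERIV_cmult xmon_deriv)
      show "r ^ 2 * S11 i j (r *\<^sub>R x) (r *\<^sub>R y) = r ^ d * S11 i j x y" for i j x y r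
        unfolding S11_def sum_distrib_left
      proof (intro sum.cong refl)
        fix k assume k: "k \<in> I"
        have "r^2 * (c (fst k) (snd k) * xmon1 (fst k) i (r *\<^sub>R x) * xmon1 (snd k) j (r *\<^sub>R y))
           = c (fst k) (snd k) * (r * xmon1 (fst k) i (r *\<^sub>R x)) * (r * xmon1 (snd k) j (r *\<^sub>R y))"
          by (simp add: power2_eq_square mult_ac)
        also have "\<dots> = r ^ d * (c (fst k) (snd k) * xmon1 (fst k) i x * xmon1 (snd k) j y)"
          unfolding xmon1_scale deg[OF k, symmetric] power_add by (simp only: mult_ac)
        finally show "r^2 * (c (fst k) (snd k) * xmon1 (fst k) i (r *\<^sub>R x) * xmon1 (snd k) j (r *\<^sub>R y)) = r ^ d * (c (fst k) (snd k) * xmon1 (fst k) i x * xmon1 (snd k) j y)" .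
      qed
      show "r ^ 3 * S21 i j (r *\<^sub>R x) (r *\<^sub>R y) = r ^ d * S21 i j x y" for i j x y r
        unfolding S21_def sum_distrib_left
      proof (intro sum.cong refl)
        fix k assume k: "k \<in> I"
        have "r^3 * (c (fst k) (snd k) * xmon2 (fst k) i (r *\<^sub>R x) * xmon1 (snd k) j (r *\<^sub>R y))
           = c (fst k) (snd k) * (r^2 * xmon2 (fst k) i (r *\<^sub>R x)) * (r * xmon1 (snd k) j (r *\<^sub>R y))"
          by (simp add: power2_eq_square power3_eq_cube mult_ac)
        also have "\<dots> = r ^ d * (c (fst k) (snd k) * xmon2 (fst k) i x * xmon1 (snd k) j y)"
          unfolding xmon1_scale xmon2_scale deg[OF k, symmetric] power_add by (simp only: mult_ac)
        finally show "r^3 * (c (fst k) (snd k) * xmon2 (fst k) i (r *\<^sub>R x) * xmon1 (snd k) j (r *\<^sub>R y)) = r ^ d * (c (fst k) (snd k) * xmon2 (fst k) i x * xmon1 (snd k) j y)" .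
      qed
    qed
    show "mixed_partial S i j x y = S11 i j x y" for i j x y
    proof -
      have 1: "frechet_derivative (\<lambda>y'. S x' y') (at y) (axis j 1) = (\<Sum>k\<in>I. c (fst k) (snd k) * xmon (fst k) x' * xmon1 (snd k) j y)" for x'
      proof (rule frechet_derivative_line)
        show "S x' differentiable at y" unfolding S[abs_def]
          by (intro sum_differentiable_at[OF fI] differentiable_mult differentiable_const xmon_differentiable)
        have "((\<lambda>t. S x' (y + t *\<^sub>R axis j 1)) has_real_derivative (\<Sum>k\<in>I. c (fst k) (snd k) * xmon (fst k) x' * xmon1 (snd k) j (y + 0 *\<^sub>R axis j 1))) (at 0)"
          unfolding S by (intro DERIV_sum DERIV_cmult xmon_deriv)
        then show "((\<lambda>t. S x' (y + t *\<^sub>R axis j 1)) has_real_derivative (\<Sum>k\<in>I. c (fst k) (snd k) * xmon (fst k) x' * xmon1 (snd k) j y)) (at 0)"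
          by simp
      qed
      have "frechet_derivative (\<lambda>x'. \<Sum>k\<in>I. c (fst k) (snd k) * xmon (fst k) x' * xmon1 (snd k) j y) (at x) (axis i 1) = S11 i j x y"
      proof (rule frechet_derivative_line)
        show "(\<lambda>x'. \<Sum>k\<in>I. c (fst k) (snd k) * xmon (fst k) x' * xmon1 (snd k) j y) differentiable at x"
          by (intro sum_differentiable_at[OF fI] differentiable_mult differentiable_const xmon_differentiable)
        have "((\<lambda>s. \<Sum>k\<in>I. c (fst k) (snd k) * xmon (fst k) (x + s *\<^sub>R axis i 1) * xmon1 (snd k) j y) has_real_derivative S11 i j (x + 0 *\<^sub>R axis i 1) y) (at 0)"
          unfolding S11_def by (intro DERIV_sum DERIV_cmult_right DERIV_cmult xmon_deriv)
        then show "((\<lambda>s. \<Sum>k\<in>I. c (fst k) (snd k) * xmon (fst k) (x + s *\<^sub>R axis i 1) * xmon1 (snd k) j y) has_real_derivative S11 i j x y) (at 0)"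
          by simp
      qed
      then show ?thesis unfolding mixed_partial_def 1 .
    qed
  qed
qed

section \<open>Compactness and scaling\<close>

text \<open>\<open>\<eta>\<close> is a Lebesgue number for the cover of the unit annulus by the sets
  where one |T k| exceeds \<kappa>; scaling carries it to radius \<rho>. So \<kappa> and \<eta> do
  not depend on \<rho>.\<close>

lemma nondegenerate_on_annulus:
  fixes T :: "'i::finite \<Rightarrow> 'a::euclidean_space \<Rightarrow> real"
  assumes cont: "\<And>k. continuous_on UNIV (T k)"
    and hom: "\<And>k r z. r ^ 2 * T k (r *\<^sub>R z) = r ^ d * T k z"
    and nz: "\<And>z. z \<noteq> 0 \<Longrightarrow> \<exists>k. T k z \<noteq> 0"
  obtains \<kappa> \<eta> where "\<kappa> > 0" "\<eta> > 0"
    "\<And>\<rho> z0. \<rho> > 0 \<Longrightarrow> \<rho> / 2 \<le> norm z0 \<Longrightarrow> norm z0 \<le> R * \<rho> \<Longrightarrow>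
      \<exists>k. \<forall>z. dist z0 z < \<eta> * \<rho> \<longrightarrow> \<kappa> * \<rho> ^ d \<le> \<rho> ^ 2 * \<bar>T k z\<bar>"
proof -
  define A where "A = {z :: 'a. 1/2 \<le> norm z \<and> norm z \<le> R}"
  have "A = cball 0 R - ball 0 (1/2)" unfolding A_def by auto
  then have cA: "compact A" by (simp add: compact_diff)
  define \<Phi> where "\<Phi> z = (\<Sum>k\<in>UNIV. \<bar>T k z\<bar>)" for z
  have c\<Phi>: "continuous_on A \<Phi>" unfolding \<Phi>_def
    by (intro continuous_intros continuous_on_subset[OF cont]) auto
  have p\<Phi>: "\<Phi> z > 0" if "z \<in> A" for z
  proof -
    have "z \<noteq> 0" using that unfolding A_def by auto
    then obtain k where "T k z \<noteq> 0" using nz by blast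
    then show ?thesis unfolding \<Phi>_def by (intro sum_pos2[of UNIV k]) auto
  qed
  obtain c where c: "c > 0" "\<And>z. z \<in> A \<Longrightarrow> c \<le> \<Phi> z"
  proof (cases "A = {}")
    case False
    obtain w where w: "w \<in> A" "\<And>z. z \<in> A \<Longrightarrow> \<Phi> w \<le> \<Phi> z"
      using continuous_attains_inf[OF cA False c\<Phi>] by blast
    then show thesis using that[of "\<Phi> w"] p\<Phi> by blast
  qed (use that[of 1] in auto)
  \<comment> \<open>If every |T k| were at most \<kappa> at a point of \<open>A\<close>, their sum
    would be at most \<open>c / 2\<close>, below its lower bound \<open>c\<close>.\<close>
  define \<kappa> where "\<kappa> = c / (2 * CARD('i))"
  have \<kappa>: "\<kappa> > 0" unfolding \<kappa>_def using c by simp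
  define G where "G k = {z. \<kappa> < \<bar>T k z\<bar>}" for k
  have oG: "open (G k)" for k unfolding G_def
    by (intro open_Collect_less continuous_intros cont)
  have "A \<subseteq> \<Union> (range G)"
  proof
    fix z assume z: "z \<in> A"
    show "z \<in> \<Union> (range G)"
    proof (rule ccontr)
      assume "z \<notin> \<Union> (range G)"
      then have "\<bar>T k z\<bar> \<le> \<kappa>" for k unfolding G_def by (force simp: not_less)
      then have "\<Phi> z \<le> (\<Sum>k\<in>(UNIV::'i set). \<kappa>)" unfolding \<Phi>_def by (intro sum_mono) auto
      also have "\<dots> = c / 2" unfolding \<kappa>_def by simp
      finally show False using c(2)[OF z] c(1) by simp
    qed
  qed
  then obtain \<eta> where \<eta>: "\<eta> > 0" "\<And>z. z \<in> A \<Longrightarrow> \<exists>k. ball z \<eta> \<subseteq> G k"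
    using Heine_Borel_lemma[OF cA, of "range G"] oG by (smt (verit) imageE rangeI)
  show thesis
  proof (rule that[OF \<kappa> \<eta>(1)])
    fix \<rho> :: real and z0 :: 'a
    assume \<rho>: "\<rho> > 0" and z0: "\<rho> / 2 \<le> norm z0" "norm z0 \<le> R * \<rho>"
    have "(1/\<rho>) *\<^sub>R z0 \<in> A" unfolding A_def using \<rho> z0 by (simp add: field_simps)
    then obtain k where k: "ball ((1/\<rho>) *\<^sub>R z0) \<eta> \<subseteq> G k" using \<eta> by blast
    have "\<kappa> * \<rho> ^ d \<le> \<rho> ^ 2 * \<bar>T k z\<bar>" if z: "dist z0 z < \<eta> * \<rho>" for z
    proof -
      have "dist ((1/\<rho>) *\<^sub>R z0) ((1/\<rho>) *\<^sub>R z) = dist z0 z / \<rho>"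
        unfolding dist_norm scaleR_diff_right[symmetric] using \<rho> by simp
      also have "\<dots> < \<eta>" using z \<rho> by (simp add: pos_divide_less_eq)
      finally have "(1/\<rho>) *\<^sub>R z \<in> G k" using k by auto
      then have "\<kappa> < \<bar>T k ((1/\<rho>) *\<^sub>R z)\<bar>" unfolding G_def by simp
      then have "\<rho> ^ d * \<kappa> \<le> \<rho> ^ d * \<bar>T k ((1/\<rho>) *\<^sub>R z)\<bar>" using \<rho> by simp
      also have "\<dots> = \<bar>\<rho> ^ d * T k ((1/\<rho>) *\<^sub>R z)\<bar>" using \<rho> by (simp add: abs_mult)
      also have "\<rho> ^ d * T k ((1/\<rho>) *\<^sub>R z) = \<rho> ^ 2 * T k z" using hom[of \<rho> k "(1/\<rho>) *\<^sub>R z"] \<rho> by simp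
      finally show ?thesis by (simp add: abs_mult mult.commute)
    qed
    then show "\<exists>k. \<forall>z. dist z0 z < \<eta> * \<rho> \<longrightarrow> \<kappa> * \<rho> ^ d \<le> \<rho> ^ 2 * \<bar>T k z\<bar>" by blast
  qed
qed

text \<open>Compactness of a ball, then scaling. The exponent \<open>e\<close> is the number of
  derivatives taken: 3 for \<open>S21\<close>, 0 for \<open>S\<close> itself.\<close>

lemma homogeneous_bound:
  fixes T :: "'i::finite \<Rightarrow> 'a::euclidean_space \<Rightarrow> real"
  assumes cont: "\<And>k. continuous_on UNIV (T k)"
    and hom: "\<And>k r z. r ^ e * T k (r *\<^sub>R z) = r ^ d * T k z"
  obtains C where "C \<ge> 0" "\<And>\<rho> z k. \<rho> > 0 \<Longrightarrow> norm z \<le> R * \<rho> \<Longrightarrow> \<rho> ^ e * \<bar>T k z\<bar> \<le> C * \<rho> ^ d"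
proof -
  have "bounded (T k ` cball 0 R)" for k
    by (intro compact_imp_bounded compact_continuous_image continuous_on_subset[OF cont]) auto
  then have "\<exists>c. \<forall>z. norm z \<le> R \<longrightarrow> \<bar>T k z\<bar> \<le> c" for k by (force simp: bounded_iff)
  then obtain c where c: "\<And>k z. norm z \<le> R \<Longrightarrow> \<bar>T k z\<bar> \<le> c k" by metis
  define C where "C = (\<Sum>k\<in>UNIV. \<bar>c k\<bar>)"
  have cC: "c k \<le> C" for k unfolding C_def
    using member_le_sum[of k UNIV "\<lambda>k. \<bar>c k\<bar>"] by simp
  show thesis
  proof (rule that[of C])
    show "C \<ge> 0" unfolding C_def by (intro sum_nonneg) auto
    fix \<rho> :: real and z :: 'a and k assume \<rho>: "\<rho> > 0" and z: "norm z \<le> R * \<rho>"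
    have "norm ((1/\<rho>) *\<^sub>R z) \<le> R" using \<rho> z by (simp add: field_simps)
    then have b: "\<bar>T k ((1/\<rho>) *\<^sub>R z)\<bar> \<le> C" using c cC order_trans by blast
    have "\<rho> ^ e * \<bar>T k z\<bar> = \<bar>\<rho> ^ e * T k (\<rho> *\<^sub>R ((1/\<rho>) *\<^sub>R z))\<bar>" using \<rho> by (simp add: abs_mult)
    also have "\<dots> = \<rho> ^ d * \<bar>T k ((1/\<rho>) *\<^sub>R z)\<bar>" unfolding hom using \<rho> by (simp add: abs_mult)
    also have "\<dots> \<le> \<rho> ^ d * C" using b \<rho> by (intro mult_left_mono) auto
    finally show "\<rho> ^ e * \<bar>T k z\<bar> \<le> C * \<rho> ^ d" by (simp add: mult.commute)
  qed
qed

text \<open>\<open>\<phi>1_bound\<close> is a scale-invariant gradient bound: at distance comparable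
  to \<rho> from the origin it reads |\<phi>1| \<le> const / \<rho>, as if the cut-off were rescaled
  with the annulus. A continuous gradient of bounded support satisfies it.\<close>

locale cutoff =
  fixes \<phi> :: "real^'n \<Rightarrow> real^'m \<Rightarrow> real" and \<phi>1 :: "'n \<Rightarrow> real^'n \<Rightarrow> real^'m \<Rightarrow> real" and M M1 R :: real
  assumes \<phi>_cont: "continuous_on UNIV (\<lambda>z. \<phi> (fst z) (snd z))"
    and M_pos: "M > 0" and \<phi>_bound: "\<bar>\<phi> x y\<bar> \<le> M"
    and M1_nonneg: "M1 \<ge> 0" and R_pos: "R > 0" and \<phi>_supp: "\<phi> x y \<noteq> 0 \<Longrightarrow> norm (x, y) \<le> R"
    and \<phi>1: "((\<lambda>s. \<phi> (x + s *\<^sub>R axis i 1) y) has_real_derivative \<phi>1 i (x + s *\<^sub>R axis i 1) y) (at s)"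
    and \<phi>1_bound: "\<bar>\<phi>1 i x y\<bar> * norm (x, y) \<le> M1"

lemma smooth_cutoff:
  fixes \<phi> :: "real^'n \<Rightarrow> real^'m \<Rightarrow> real"
  assumes sm: "smooth (\<lambda>z :: (real^'n) \<times> (real^'m). \<phi> (fst z) (snd z))"
    and cpt: "compact (closure {z :: (real^'n) \<times> (real^'m). \<phi> (fst z) (snd z) \<noteq> 0})"
  obtains \<phi>1 M M1 R where "cutoff \<phi> \<phi>1 M M1 R"
proof -
  define F where "F = (\<lambda>z :: (real^'n) \<times> (real^'m). \<phi> (fst z) (snd z))"
  have "higher_diff (Suc 0) F" using sm unfolding smooth_def F_def by blast
  then have dF: "F differentiable_on UNIV" and cF: "continuous_on UNIV F"
    and cD: "\<And>v. continuous_on UNIV (\<lambda>z. frechet_derivative F (at z) v)" by auto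
  obtain R where R: "R > 0" "\<And>z. F z \<noteq> 0 \<Longrightarrow> norm z \<le> R"
  proof -
    have "bounded {z. F z \<noteq> 0}" using compact_imp_bounded[OF cpt] bounded_subset closure_subset unfolding F_def by blast
    then obtain R where "\<And>z. F z \<noteq> 0 \<Longrightarrow> norm z \<le> R" unfolding bounded_iff by (metis mem_Collect_eq)
    then have "\<And>z. F z \<noteq> 0 \<Longrightarrow> norm z \<le> max 1 R" by (metis max.coboundedI2)
    then show thesis using that[of "max 1 R"] by simp
  qed
  define D where "D i z = frechet_derivative F (at z) (axis i 1 :: real^'n, 0 :: real^'m)" for i z
  have fd: "(F has_derivative frechet_derivative F (at z)) (at z)" for z
    using dF unfolding differentiable_on_eq_differentiable_at[OF open_UNIV] frechet_derivative_works by blast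
  have D0: "D i z = 0" if "norm z > R" for i z
  proof -
    have "((\<lambda>_. 0 :: real) has_derivative (\<lambda>_. 0)) (at z)" by simp
    moreover have "open {z :: (real^'n) \<times> (real^'m). norm z > R}" by (intro open_Collect_less continuous_intros)
    ultimately have "(F has_derivative (\<lambda>_. 0)) (at z)"
      by (rule has_derivative_transform_within_open) (use that R in \<open>auto simp: not_le[symmetric]\<close>)
    then have "frechet_derivative F (at z) = (\<lambda>_. 0)" using fd has_derivative_unique by blast
    then show ?thesis unfolding D_def by simp
  qed
  have "bounded (F ` cball 0 R)"
    by (intro compact_imp_bounded compact_continuous_image continuous_on_subset[OF cF]) auto
  then obtain M0 where M0: "\<And>z. norm z \<le> R \<Longrightarrow> \<bar>F z\<bar> \<le> M0" by (force simp: bounded_iff)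
  have FM: "\<bar>F z\<bar> \<le> max 1 M0" for z
    using R(2)[of z] M0[of z] by (cases "F z = 0") (auto simp: le_max_iff_disj)
  have "bounded ((\<lambda>z. D i z * norm z) ` cball 0 R)" for i unfolding D_def
    by (intro compact_imp_bounded compact_continuous_image continuous_intros continuous_on_subset[OF cD]) auto
  then have "\<exists>c. \<forall>z. norm z \<le> R \<longrightarrow> \<bar>D i z * norm z\<bar> \<le> c" for i by (force simp: bounded_iff)
  then obtain c where c: "\<And>i z. norm z \<le> R \<Longrightarrow> \<bar>D i z * norm z\<bar> \<le> c i" by metis
  define M1 where "M1 = (\<Sum>k\<in>UNIV. \<bar>c k\<bar>)"
  have M10: "M1 \<ge> 0" unfolding M1_def by (intro sum_nonneg) auto
  have cM1: "c k \<le> M1" for k unfolding M1_def using member_le_sum[of k UNIV "\<lambda>k. \<bar>c k\<bar>"] by simp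
  show thesis
  proof (rule that[of "\<lambda>i x y. D i (x, y)" "max 1 M0" M1 R], unfold_locales)
    show "continuous_on UNIV (\<lambda>z. \<phi> (fst z) (snd z))" using cF unfolding F_def .
    show "\<bar>\<phi> x y\<bar> \<le> max 1 M0" for x y using FM[of "(x,y)"] unfolding F_def by simp
    show "norm (x, y) \<le> R" if "\<phi> x y \<noteq> 0" for x y using R(2)[of "(x,y)"] that unfolding F_def by simp
    show "\<bar>D i (x, y)\<bar> * norm (x, y) \<le> M1" for i x y
    proof (cases "norm (x, y) \<le> R")
      case True
      then show ?thesis using c[of "(x,y)" i] cM1[of i] by (simp add: abs_mult)
    qed (use D0[of "(x,y)" i] M10 in simp)
    fix i :: 'n and x :: "real^'n" and y :: "real^'m" and s :: real
    have "((\<lambda>s. (x + s *\<^sub>R axis i 1, y)) has_derivative (\<lambda>s. (s *\<^sub>R axis i 1, 0))) (at s)"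
      by (auto intro!: derivative_eq_intros)
    from has_derivative_compose[OF this fd]
    have "((\<lambda>s. F (x + s *\<^sub>R axis i 1, y)) has_derivative (\<lambda>r. frechet_derivative F (at (x + s *\<^sub>R axis i 1, y)) (r *\<^sub>R axis i 1, 0))) (at s)" .
    moreover have "(\<lambda>r. frechet_derivative F (at (x + s *\<^sub>R axis i 1, y)) (r *\<^sub>R axis i 1, 0)) = (*) (D i (x + s *\<^sub>R axis i 1, y))"
    proof
      fix r
      have "linear (frechet_derivative F (at (x + s *\<^sub>R axis i 1, y)))" using fd has_derivative_linear by blast
      from linear_cmul[OF this, of r "(axis i 1, 0)"]
      show "frechet_derivative F (at (x + s *\<^sub>R axis i 1, y)) (r *\<^sub>R axis i 1, 0) = D i (x + s *\<^sub>R axis i 1, y) * r"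
        unfolding D_def by simp
    qed
    ultimately show "((\<lambda>s. \<phi> (x + s *\<^sub>R axis i 1) y) has_real_derivative D i (x + s *\<^sub>R axis i 1, y)) (at s)"
      by (simp add: has_field_derivative_def F_def)
  qed (use M10 R in auto)
qed

section \<open>The estimate on a small box\<close>

locale oscillatory_data = homogeneous_phase S d S1 S2 S11 S21 + cutoff \<phi> \<phi>1 M M1 R
  for S \<phi> :: "real^'n \<Rightarrow> real^'m \<Rightarrow> real" and d S1 S2 S11 S21 \<phi>1 M M1 R
begin

definition ker :: "real \<Rightarrow> real^'n \<Rightarrow> real^'m \<Rightarrow> complex" where
  "ker lam x y = exp (\<i> * complex_of_real (lam * S x y)) * complex_of_real (\<phi> x y)"

definition cut :: "(real^'n) set \<Rightarrow> (real^'m) set \<Rightarrow> real \<Rightarrow> real^'n \<Rightarrow> real^'m \<Rightarrow> complex" where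
  "cut X Y lam x y = indicator X x * indicator Y y * ker lam x y"

lemma ker_norm: "norm (ker lam x y) = \<bar>\<phi> x y\<bar>"
  by (simp add: ker_def norm_mult)

lemma ker_bcs: "bcs (\<lambda>z. ker lam (fst z) (snd z))"
proof (rule bcsI[where M=M and X="cball 0 R"])
  show "(\<lambda>z. ker lam (fst z) (snd z)) \<in> borel_measurable borel"
    unfolding ker_def by (intro borel_measurable_continuous_onI continuous_intros S_cont \<phi>_cont)
  show "norm (ker lam (fst z) (snd z)) \<le> M" for z unfolding ker_norm by (rule \<phi>_bound)
  show "z \<in> cball 0 R" if "ker lam (fst z) (snd z) \<noteq> 0" for z
    using \<phi>_supp[of "fst z" "snd z"] that by (simp add: ker_def)
qed simp

lemma cut_norm: "norm (cut X Y lam x y) \<le> M"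
  using \<phi>_bound[of x y] M_pos by (auto simp: cut_def norm_mult ker_norm indicator_def)

lemma cut_supp: "cut X Y lam x y \<noteq> 0 \<Longrightarrow> x \<in> X \<and> y \<in> Y"
  by (auto simp: cut_def indicator_def split: if_splits)

lemma cut_bcs:
  assumes "X \<in> sets borel" "Y \<in> sets borel"
  shows "bcs (\<lambda>z. cut X Y lam (fst z) (snd z))"
proof -
  have m: "(\<lambda>z :: (real^'n) \<times> (real^'m). indicator X (fst z) * indicator Y (snd z) :: complex) \<in> borel_measurable (borel \<Otimes>\<^sub>M borel)"
    using assms by measurable
  have "bcs (\<lambda>z. ker lam (fst z) (snd z) * (indicator X (fst z) * indicator Y (snd z)))"
    by (rule bcs_mult[OF ker_bcs m[unfolded borel_prod], where M=1]) (auto simp: indicator_def)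
  then show ?thesis by (simp add: cut_def mult_ac)
qed

text \<open>Closed in \<open>x\<close>, because the boundary terms of the integration by parts sit on the faces of the box.\<close>

definition good_box :: "real \<Rightarrow> real \<Rightarrow> real \<Rightarrow> real \<Rightarrow> 'n \<Rightarrow> 'm \<Rightarrow> real^'n \<Rightarrow> real^'m \<Rightarrow> real \<Rightarrow> bool" where
  "good_box \<kappa> \<rho> C2 L i j a b h \<longleftrightarrow> (\<forall>x y. (\<forall>c. a $ c \<le> x $ c \<and> x $ c \<le> a $ c + h) \<longrightarrow> y \<in> hbox b h \<longrightarrow>
    \<kappa> * \<rho> ^ d \<le> \<rho> ^ 2 * \<bar>S11 i j x y\<bar> \<and> \<rho> ^ 3 * \<bar>S21 i j x y\<bar> \<le> C2 * \<rho> ^ d \<and> \<rho> * \<bar>\<phi>1 i x y\<bar> \<le> L)"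

text \<open>Both \<open>s\<close>-derivatives of the phase difference are proportional to |t - t'|,
  which therefore cancels from their ratio in \<open>nonstationary_phase_bound\<close> and survives
  once in the denominator. The other entry of the minimum is the length of the segment times the sup
  bound.\<close>

lemma slice_bound:
  assumes \<kappa>: "\<kappa> > 0" and \<rho>: "\<rho> > 0" and lam: "lam \<noteq> 0" and h: "0 < h" "h \<le> \<rho>" and C2: "C2 \<ge> 0"
    and good: "good_box \<kappa> \<rho> C2 L i j a b h"
    and x: "x \<in> hbox a h" and t: "t \<noteq> t'"
    and yt: "y + t *\<^sub>R axis j 1 \<in> hbox b h" and yt': "y + t' *\<^sub>R axis j 1 \<in> hbox b h"
  shows "norm (\<integral>s. cut (hbox a h) (hbox b h) lam (x + s *\<^sub>R axis i 1) (y + t *\<^sub>R axis j 1) *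
            cnj (cut (hbox a h) (hbox b h) lam (x + s *\<^sub>R axis i 1) (y + t' *\<^sub>R axis j 1)) \<partial>lborel)
    \<le> min (M\<^sup>2 * \<rho>) (\<rho>\<^sup>2 * ((2 * M\<^sup>2 + 2 * M * L + M\<^sup>2 * C2 / \<kappa>) / \<kappa>) / (\<bar>lam\<bar> * \<rho> ^ d * \<bar>t - t'\<bar>))"
proof -
  let ?X = "hbox a h" and ?Y = "hbox b h"
  have nd: "\<kappa> * \<rho> ^ d \<le> \<rho> ^ 2 * \<bar>S11 i j x y\<bar>" and b21: "\<rho> ^ 3 * \<bar>S21 i j x y\<bar> \<le> C2 * \<rho> ^ d" and b1: "\<rho> * \<bar>\<phi>1 i x y\<bar> \<le> L"
    if "\<forall>c. a $ c \<le> x $ c \<and> x $ c \<le> a $ c + h" "y \<in> ?Y" for x y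
    using good that unfolding good_box_def by blast+
  define xs where "xs s = x + s *\<^sub>R axis i 1" for s
  define ys where "ys r = y + r *\<^sub>R axis j 1" for r
  define \<alpha> where "\<alpha> = a $ i - x $ i"
  define \<tau> where "\<tau> = \<bar>t - t'\<bar>"
  have \<tau>: "\<tau> > 0" unfolding \<tau>_def using t by simp
  have closed_box: "\<forall>c. a $ c \<le> xs s $ c \<and> xs s $ c \<le> a $ c + h" if "s \<in> {\<alpha>..\<alpha> + h}" for s
    using that x unfolding xs_def \<alpha>_def hbox_def by (auto simp: axis_def less_imp_le)
  have y_between: "ys r \<in> ?Y" if "min t t' \<le> r" "r \<le> max t t'" for r
  proof -
    have "b $ c \<le> ys r $ c \<and> ys r $ c < b $ c + h" for c
      using yt yt' that unfolding ys_def hbox_def by (auto simp: axis_def min_def max_def split: if_splits; smt (verit))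
    then show ?thesis unfolding hbox_def by simp
  qed
  \<comment> \<open>The intermediate point may depend on \<open>s\<close>, but it lies between
    \<open>t\<close> and \<open>t'\<close>, hence in the box, where the bounds of
    \<open>good_box\<close> hold.\<close>
  have mvt: "\<exists>r. ys r \<in> ?Y \<and> \<bar>g (ys t) - g (ys t')\<bar> = \<tau> * \<bar>g' (ys r)\<bar>"
    if g: "\<And>r. ((\<lambda>r. g (ys r)) has_real_derivative g' (ys r)) (at r)" for g g' :: "real^'m \<Rightarrow> real"
  proof -
    obtain r where r: "min t t' < r" "r < max t t'" "g (ys (max t t')) - g (ys (min t t')) = (max t t' - min t t') * g' (ys r)"
      using MVT2[of "min t t'" "max t t'" "\<lambda>r. g (ys r)" "\<lambda>r. g' (ys r)"] g t by (metis max_less_iff_conj min_less_iff_disj neq_iff order.asym)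
    have "\<bar>g (ys t) - g (ys t')\<bar> = \<bar>g (ys (max t t')) - g (ys (min t t'))\<bar>"
      by (auto simp: max_def min_def abs_minus_commute)
    also have "\<dots> = \<tau> * \<bar>g' (ys r)\<bar>" unfolding r(3) \<tau>_def abs_mult by (simp add: max_def min_def abs_minus_commute)
    finally show ?thesis using y_between[of r] r by (intro exI[of _ r]) simp
  qed
  define \<Phi> where "\<Phi> s = S (xs s) (ys t) - S (xs s) (ys t')" for s
  define \<Phi>1 where "\<Phi>1 s = S1 i (xs s) (ys t) - S1 i (xs s) (ys t')" for s
  define \<Phi>2 where "\<Phi>2 s = S2 i (xs s) (ys t) - S2 i (xs s) (ys t')" for s
  define u where "u s = \<phi> (xs s) (ys t) * \<phi> (xs s) (ys t')" for s
  define u1 where "u1 s = \<phi>1 i (xs s) (ys t) * \<phi> (xs s) (ys t') + \<phi>1 i (xs s) (ys t') * \<phi> (xs s) (ys t)" for s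
  define \<kappa>' where "\<kappa>' = \<tau> * (\<kappa> * \<rho> ^ d / \<rho>\<^sup>2)"
  define C2' where "C2' = \<tau> * (C2 * \<rho> ^ d / \<rho> ^ 3)"
  have \<kappa>': "\<kappa>' > 0" unfolding \<kappa>'_def using \<tau> \<kappa> \<rho> by simp
  have L0: "L \<ge> 0"
    using b1[of x "ys t"] x yt \<rho> unfolding ys_def hbox_def
    by (smt (verit, best) mem_Collect_eq mult_nonneg_nonneg abs_ge_zero)
  have eq: "cut ?X ?Y lam (xs s) (ys t) * cnj (cut ?X ?Y lam (xs s) (ys t')) =
      indicator {\<alpha>..<\<alpha> + h} s *\<^sub>R (exp (\<i> * complex_of_real (lam * \<Phi> s)) * complex_of_real (u s))" for s
  proof -
    have X: "xs s \<in> ?X \<longleftrightarrow> s \<in> {\<alpha>..<\<alpha> + h}" unfolding xs_def \<alpha>_def by (rule hbox_line[OF x])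
    have "exp (\<i> * complex_of_real (lam * S (xs s) (ys t))) * cnj (exp (\<i> * complex_of_real (lam * S (xs s) (ys t'))))
       = exp (\<i> * complex_of_real (lam * \<Phi> s))"
      unfolding exp_cnj \<Phi>_def by (simp add: exp_add[symmetric] algebra_simps)
    then show ?thesis
      using yt yt' X unfolding cut_def ker_def u_def ys_def[symmetric]
      by (cases "s \<in> {\<alpha>..<\<alpha> + h}") (auto simp: algebra_simps)
  qed
  have ub: "\<bar>u s\<bar> \<le> M\<^sup>2" for s
    unfolding u_def abs_mult power2_eq_square using \<phi>_bound M_pos by (intro mult_mono) auto
  have main: "norm (\<integral>s. indicator {\<alpha>..<\<alpha> + h} s *\<^sub>R (exp (\<i> * complex_of_real (lam * \<Phi> s)) * complex_of_real (u s)) \<partial>lborel)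
      \<le> (2 * M\<^sup>2 + (\<alpha> + h - \<alpha>) * (2 * M * L / \<rho> + M\<^sup>2 * C2' / \<kappa>')) / (\<bar>lam\<bar> * \<kappa>')"
  proof (rule nonstationary_phase_bound[where ?\<Phi>1.0=\<Phi>1 and ?\<Phi>2.0=\<Phi>2 and ?u1.0=u1])
    show "\<alpha> \<le> \<alpha> + h" using h by simp
    fix s assume s: "s \<in> {\<alpha>..\<alpha> + h}"
    show "(\<Phi> has_real_derivative \<Phi>1 s) (at s)" unfolding \<Phi>_def[abs_def] \<Phi>1_def xs_def by (intro DERIV_diff S1)
    show "(\<Phi>1 has_real_derivative \<Phi>2 s) (at s)" unfolding \<Phi>1_def[abs_def] \<Phi>2_def xs_def by (intro DERIV_diff S2)
    show "(u has_real_derivative u1 s) (at s)" unfolding u_def[abs_def] u1_def xs_def by (intro DERIV_mult \<phi>1)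
    obtain r where r: "ys r \<in> ?Y" "\<bar>\<Phi>1 s\<bar> = \<tau> * \<bar>S11 i j (xs s) (ys r)\<bar>"
      using mvt[of "S1 i (xs s)" "S11 i j (xs s)"] S11 unfolding \<Phi>1_def ys_def by blast
    have "\<kappa> * \<rho> ^ d / \<rho>\<^sup>2 \<le> \<bar>S11 i j (xs s) (ys r)\<bar>"
      using nd[OF closed_box[OF s] r(1)] \<rho> by (simp add: pos_divide_le_eq mult.commute)
    then show "\<kappa>' \<le> \<bar>\<Phi>1 s\<bar>" unfolding r(2) \<kappa>'_def using \<tau> by (intro mult_left_mono) auto
    obtain r where r: "ys r \<in> ?Y" "\<bar>\<Phi>2 s\<bar> = \<tau> * \<bar>S21 i j (xs s) (ys r)\<bar>"
      using mvt[of "S2 i (xs s)" "S21 i j (xs s)"] S21 unfolding \<Phi>2_def ys_def by blast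
    have "\<bar>S21 i j (xs s) (ys r)\<bar> \<le> C2 * \<rho> ^ d / \<rho> ^ 3"
      using b21[OF closed_box[OF s] r(1)] \<rho> by (simp add: pos_le_divide_eq mult.commute)
    then show "\<bar>\<Phi>2 s\<bar> \<le> C2'" unfolding r(2) C2'_def using \<tau> by (intro mult_left_mono) auto
    have 1: "\<bar>\<phi>1 i (xs s) (ys r)\<bar> \<le> L / \<rho>" if "ys r \<in> ?Y" for r
      using b1[OF closed_box[OF s] that] \<rho> by (simp add: pos_le_divide_eq mult.commute)
    have "\<bar>u1 s\<bar> \<le> \<bar>\<phi>1 i (xs s) (ys t)\<bar> * \<bar>\<phi> (xs s) (ys t')\<bar> + \<bar>\<phi>1 i (xs s) (ys t')\<bar> * \<bar>\<phi> (xs s) (ys t)\<bar>"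
      unfolding u1_def abs_mult[symmetric] by (rule abs_triangle_ineq)
    also have "\<dots> \<le> L / \<rho> * M + L / \<rho> * M"
      using 1[of t] 1[of t'] yt yt' \<phi>_bound L0 \<rho> unfolding ys_def[symmetric] by (intro add_mono mult_mono) auto
    finally show "\<bar>u1 s\<bar> \<le> 2 * M * L / \<rho>" by (simp add: mult_ac)
  qed (use lam \<kappa>' ub in auto)
  \<comment> \<open>Here h \<le> \<rho> is spent: the length of the segment cancels the factor
    1/\<rho> lost by each differentiation in \<open>s\<close>.\<close>
  have "h * (2 * M * L / \<rho> + M\<^sup>2 * C2' / \<kappa>') \<le> \<rho> * (2 * M * L / \<rho> + M\<^sup>2 * C2' / \<kappa>')"
    using h M_pos L0 \<rho> \<kappa>' C2 \<tau> unfolding C2'_def by (intro mult_right_mono) auto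
  also have "\<dots> = 2 * M * L + M\<^sup>2 * C2 / \<kappa>"
    unfolding C2'_def \<kappa>'_def using \<rho> \<kappa> \<tau> by (simp add: field_simps power2_eq_square power3_eq_cube)
  finally have "(2 * M\<^sup>2 + (\<alpha> + h - \<alpha>) * (2 * M * L / \<rho> + M\<^sup>2 * C2' / \<kappa>')) / (\<bar>lam\<bar> * \<kappa>')
     \<le> (2 * M\<^sup>2 + 2 * M * L + M\<^sup>2 * C2 / \<kappa>) / (\<bar>lam\<bar> * \<kappa>')"
    using \<kappa>' lam by (intro divide_right_mono) auto
  also have "\<dots> = \<rho>\<^sup>2 * ((2 * M\<^sup>2 + 2 * M * L + M\<^sup>2 * C2 / \<kappa>) / \<kappa>) / (\<bar>lam\<bar> * \<rho> ^ d * \<tau>)"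
  proof -
    have "\<bar>lam\<bar> * \<kappa>' = \<kappa> * (\<bar>lam\<bar> * \<rho> ^ d * \<tau>) / \<rho>\<^sup>2" unfolding \<kappa>'_def by (simp add: mult_ac)
    then show ?thesis by (simp add: mult_ac)
  qed
  finally have b2: "norm (\<integral>s. indicator {\<alpha>..<\<alpha> + h} s *\<^sub>R (exp (\<i> * complex_of_real (lam * \<Phi> s)) * complex_of_real (u s)) \<partial>lborel)
      \<le> \<rho>\<^sup>2 * ((2 * M\<^sup>2 + 2 * M * L + M\<^sup>2 * C2 / \<kappa>) / \<kappa>) / (\<bar>lam\<bar> * \<rho> ^ d * \<tau>)"
    using main by linarith
  have "norm (\<integral>s. indicator {\<alpha>..<\<alpha> + h} s *\<^sub>R (exp (\<i> * complex_of_real (lam * \<Phi> s)) * complex_of_real (u s)) \<partial>lborel)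
      \<le> (\<integral>s. M\<^sup>2 * indicator {\<alpha>..<\<alpha> + h} s \<partial>lborel)"
  proof (rule norm_integral_le)
    show "norm (indicator {\<alpha>..<\<alpha> + h} s *\<^sub>R (exp (\<i> * complex_of_real (lam * \<Phi> s)) * complex_of_real (u s))) \<le> M\<^sup>2 * indicator {\<alpha>..<\<alpha> + h} s" for s
      using ub[of s] by (simp add: norm_mult indicator_def)
    show "integrable lborel (\<lambda>s. M\<^sup>2 * indicator {\<alpha>..<\<alpha> + h} s)"
      using h by (intro integrable_mult_right integrable_real_indicator) auto
  qed
  also have "\<dots> = M\<^sup>2 * h" using h by simp
  also have "\<dots> \<le> M\<^sup>2 * \<rho>" using h by (intro mult_left_mono) auto
  finally show ?thesis using b2 eq unfolding \<tau>_def xs_def ys_def by simp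
qed

end

context oscillatory_data
begin

text \<open>The inequality \<open>min 1 w \<le> w powr (1 - \<epsilon>)\<close> turns the kernel of
  \<open>slice_bound\<close> into an integrable power. Up to constants the outcome is the trivial
  factor \<rho>^((n + m)/2) times the gain from oscillation.\<close>

lemma box_L2_bound:
  assumes \<kappa>: "\<kappa> > 0" and \<rho>: "\<rho> > 0" and lam: "lam \<noteq> 0" and \<theta>: "0 < \<theta>" "\<theta> \<le> 1" and C2: "C2 \<ge> 0" and L: "L \<ge> 0"
    and good: "good_box \<kappa> \<rho> C2 L i j a b (\<theta> * \<rho>)"
    and eps: "0 < \<epsilon>" "\<epsilon> < 1"
    and E: "E = M\<^sup>2 + (2 * M\<^sup>2 + 2 * M * L + M\<^sup>2 * C2 / \<kappa>) / \<kappa>"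
    and f: "bcs f" and g: "bcs g"
    and f_supp: "\<And>y. f y \<noteq> 0 \<Longrightarrow> y \<in> hbox b (\<theta> * \<rho>)" and g_supp: "\<And>x. g x \<noteq> 0 \<Longrightarrow> x \<in> hbox a (\<theta> * \<rho>)"
  shows "norm (bil (cut (hbox a (\<theta> * \<rho>)) (hbox b (\<theta> * \<rho>)) lam) f g)
    \<le> sqrt (2 * E / \<epsilon>) / \<theta> * \<rho> powr ((real CARD('n) + real CARD('m)) / 2) * (\<bar>lam\<bar> * \<rho> ^ d) powr (- (1 - \<epsilon>) / 2)
      * L2 f * L2 g"
proof -
  define h where "h = \<theta> * \<rho>"
  have h: "h > 0" "h \<le> \<rho>" unfolding h_def using \<theta> \<rho> by (auto simp: mult_le_cancel_right1)
  define D where "D = (2 * M\<^sup>2 + 2 * M * L + M\<^sup>2 * C2 / \<kappa>) / \<kappa>"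
  have D: "D \<ge> 0" unfolding D_def using M_pos L C2 \<kappa> by simp
  have E': "E = M\<^sup>2 + D" unfolding E D_def ..
  have E0: "E > 0" unfolding E' using D M_pos by (simp add: add_pos_nonneg)
  define \<mu> where "\<mu> = \<bar>lam\<bar> * \<rho> ^ d"
  have \<mu>: "\<mu> > 0" unfolding \<mu>_def using lam \<rho> by simp
  define C where "C = E * \<rho> * (\<rho> / \<mu>) powr (1 - \<epsilon>)"
  have C0: "C \<ge> 0" unfolding C_def using E0 \<rho> by simp
  have slice: "norm (\<integral>s. cut (hbox a h) (hbox b h) lam (x + s *\<^sub>R axis i 1) (y + t *\<^sub>R axis j 1) *
            cnj (cut (hbox a h) (hbox b h) lam (x + s *\<^sub>R axis i 1) (y + t' *\<^sub>R axis j 1)) \<partial>lborel) \<le> C * \<bar>t - t'\<bar> powr (\<epsilon> - 1)"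
    if x: "x \<in> hbox a h" and t: "t \<noteq> t'" and yt: "y + t *\<^sub>R axis j 1 \<in> hbox b h" "y + t' *\<^sub>R axis j 1 \<in> hbox b h" for x y t t'
  proof -
    define \<tau> where "\<tau> = \<bar>t - t'\<bar>"
    have \<tau>: "\<tau> > 0" unfolding \<tau>_def using t by simp
    \<comment> \<open>Up to constants \<open>w\<close> is the quotient of the oscillatory bound by
      the trivial one; \<open>E\<close> dominates the constants of both.\<close>
    define w where "w = \<rho> / (\<mu> * \<tau>)"
    have w: "w > 0" unfolding w_def using \<rho> \<mu> \<tau> by simp
    have "norm (\<integral>s. cut (hbox a h) (hbox b h) lam (x + s *\<^sub>R axis i 1) (y + t *\<^sub>R axis j 1) *
            cnj (cut (hbox a h) (hbox b h) lam (x + s *\<^sub>R axis i 1) (y + t' *\<^sub>R axis j 1)) \<partial>lborel)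
        \<le> min (M\<^sup>2 * \<rho>) (\<rho>\<^sup>2 * D / (\<mu> * \<tau>))"
      unfolding D_def \<mu>_def \<tau>_def
      by (rule slice_bound[OF \<kappa> \<rho> lam h C2 good[folded h_def] x t yt])
    also have "\<dots> \<le> E * \<rho> * min 1 w"
    proof -
      have "M\<^sup>2 * \<rho> \<le> E * \<rho> * 1" unfolding E' using D \<rho> by (simp add: mult_right_mono)
      moreover have "\<rho>\<^sup>2 * D / (\<mu> * \<tau>) \<le> E * \<rho> * w"
      proof -
        have "\<rho>\<^sup>2 * D / (\<mu> * \<tau>) = D * \<rho> * w" unfolding w_def by (simp add: power2_eq_square mult_ac)
        also have "\<dots> \<le> E * \<rho> * w" unfolding E' using \<rho> w by (intro mult_right_mono) auto
        finally show ?thesis .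
      qed
      ultimately show ?thesis by (auto simp: min_def)
    qed
    also have "min 1 w \<le> w powr (1 - \<epsilon>)"
    proof (cases "w \<ge> 1")
      case True
      then show ?thesis using eps ge_one_powr_ge_zero[of w "1 - \<epsilon>"] by simp
    next
      case False
      then have "w powr 1 \<le> w powr (1 - \<epsilon>)" using w eps by (intro powr_mono') auto
      then show ?thesis using w False by simp
    qed
    also have "w powr (1 - \<epsilon>) = (\<rho> / \<mu>) powr (1 - \<epsilon>) * \<tau> powr (\<epsilon> - 1)"
    proof -
      have "w = (\<rho> / \<mu>) / \<tau>" unfolding w_def by simp
      then have "w powr (1 - \<epsilon>) = (\<rho> / \<mu>) powr (1 - \<epsilon>) / \<tau> powr (1 - \<epsilon>)"
        using \<rho> \<mu> \<tau> by (simp add: powr_divide powr_mult)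
      then show ?thesis using powr_minus_divide[of \<tau> "1 - \<epsilon>"] by simp
    qed
    finally show ?thesis unfolding C_def \<tau>_def using E0 \<rho> by (simp add: mult_ac mult_left_mono)
  qed
  define P where "P = real CARD('n) + real CARD('m)"
  have "norm (bil (cut (hbox a h) (hbox b h) lam) f g) \<le> sqrt (C * (2 * h powr \<epsilon> / \<epsilon>)) * (sqrt (h ^ CARD('n)) * sqrt (h ^ CARD('m)) / h)
        * L2 f * L2 g"
    unfolding bil_def
    by (rule L2_bilinear_bound_hbox[OF cut_bcs[OF hbox_sets hbox_sets] f g f_supp[folded h_def] g_supp[folded h_def] h(1) eps(1) C0 _ slice])
      (auto dest: cut_supp)
  also have "\<dots> \<le> (sqrt (2 * E / \<epsilon>) / \<theta> * \<rho> powr (P / 2) * \<mu> powr (- (1 - \<epsilon>) / 2)) * L2 f * L2 g"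
  proof (intro mult_right_mono)
    have "C * (2 * h powr \<epsilon> / \<epsilon>) \<le> C * (2 * \<rho> powr \<epsilon> / \<epsilon>)"
      using C0 h eps by (intro mult_left_mono divide_right_mono powr_mono2) auto
    also have "\<dots> = (2 * E / \<epsilon>) * \<rho>\<^sup>2 * \<mu> powr (- (1 - \<epsilon>))"
    proof -
      have "\<rho> * (\<rho> / \<mu>) powr (1 - \<epsilon>) * \<rho> powr \<epsilon> = \<rho> * (\<rho> powr (1 - \<epsilon>) * \<rho> powr \<epsilon>) * \<mu> powr (- (1 - \<epsilon>))"
        using \<rho> \<mu> by (simp add: powr_divide powr_minus_divide[of \<mu> "1 - \<epsilon>", simplified])
      also have "\<rho> powr (1 - \<epsilon>) * \<rho> powr \<epsilon> = \<rho>" using \<rho> by (simp add: powr_add[symmetric])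
      finally have e: "\<rho> * (\<rho> / \<mu>) powr (1 - \<epsilon>) * \<rho> powr \<epsilon> = \<rho>\<^sup>2 * \<mu> powr (- (1 - \<epsilon>))" by (simp add: power2_eq_square)
      have "C * (2 * \<rho> powr \<epsilon> / \<epsilon>) = (2 * E / \<epsilon>) * (\<rho> * (\<rho> / \<mu>) powr (1 - \<epsilon>) * \<rho> powr \<epsilon>)" unfolding C_def by simp
      then show ?thesis unfolding e by simp
    qed
    finally have "sqrt (C * (2 * h powr \<epsilon> / \<epsilon>)) \<le> sqrt ((2 * E / \<epsilon>) * \<rho>\<^sup>2 * \<mu> powr (- (1 - \<epsilon>)))" by simp
    also have "\<dots> = sqrt (2 * E / \<epsilon>) * \<rho> * \<mu> powr (- (1 - \<epsilon>) / 2)"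
    proof -
      have "sqrt (\<mu> powr (- (1 - \<epsilon>))) = \<mu> powr (- (1 - \<epsilon>) / 2)" using \<mu> by (simp add: powr_half_sqrt[symmetric] powr_powr)
      moreover have "sqrt ((2 * E / \<epsilon>) * \<rho>\<^sup>2 * \<mu> powr (- (1 - \<epsilon>))) = sqrt (2 * E / \<epsilon>) * sqrt (\<rho>\<^sup>2) * sqrt (\<mu> powr (- (1 - \<epsilon>)))"
        by (simp only: real_sqrt_mult)
      ultimately show ?thesis using \<rho> by simp
    qed
    finally have 1: "sqrt (C * (2 * h powr \<epsilon> / \<epsilon>)) \<le> sqrt (2 * E / \<epsilon>) * \<rho> * \<mu> powr (- (1 - \<epsilon>) / 2)" .
    have "sqrt (h ^ CARD('n)) * sqrt (h ^ CARD('m)) / h \<le> sqrt (\<rho> ^ CARD('n)) * sqrt (\<rho> ^ CARD('m)) / h"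
      using h by (intro divide_right_mono mult_mono) (auto intro: power_mono)
    also have "\<dots> = \<rho> powr (P / 2) / (\<theta> * \<rho>)"
    proof -
      have "sqrt (\<rho> ^ k) = \<rho> powr (real k / 2)" for k :: nat
        using \<rho> by (simp add: powr_half_sqrt[symmetric] powr_realpow[symmetric] powr_powr)
      then show ?thesis unfolding h_def P_def by (simp add: powr_add[symmetric] add_divide_distrib)
    qed
    finally have 2: "sqrt (h ^ CARD('n)) * sqrt (h ^ CARD('m)) / h \<le> \<rho> powr (P / 2) / (\<theta> * \<rho>)" .
    have "sqrt (C * (2 * h powr \<epsilon> / \<epsilon>)) * (sqrt (h ^ CARD('n)) * sqrt (h ^ CARD('m)) / h)
      \<le> (sqrt (2 * E / \<epsilon>) * \<rho> * \<mu> powr (- (1 - \<epsilon>) / 2)) * (\<rho> powr (P / 2) / (\<theta> * \<rho>))"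
      using 1 2 E0 eps \<rho> h by (intro mult_mono) auto
    also have "\<dots> = sqrt (2 * E / \<epsilon>) / \<theta> * \<rho> powr (P / 2) * \<mu> powr (- (1 - \<epsilon>) / 2)"
      using \<rho> \<theta> by simp
    finally show "sqrt (C * (2 * h powr \<epsilon> / \<epsilon>)) * (sqrt (h ^ CARD('n)) * sqrt (h ^ CARD('m)) / h)
       \<le> sqrt (2 * E / \<epsilon>) / \<theta> * \<rho> powr (P / 2) * \<mu> powr (- (1 - \<epsilon>) / 2)" .
  qed auto
  finally show ?thesis unfolding h_def \<mu>_def P_def .
qed

text \<open>Interpolation with the sup bound; \<open>r = max p q\<close> tells which function is
  split. In both cases the powers of \<rho> recombine to the exponent of the trivial bound, and the
  exponent of |lam| \<rho>^d is \<open>2 / r\<close> times the one for square-integrable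
  functions.\<close>

lemma box_Lp_bound:
  assumes \<kappa>: "\<kappa> > 0" and \<rho>: "\<rho> > 0" and lam: "lam \<noteq> 0" and \<theta>: "0 < \<theta>" "\<theta> \<le> 1" and C2: "C2 \<ge> 0" and L: "L \<ge> 0"
    and good: "good_box \<kappa> \<rho> C2 L i j a b (\<theta> * \<rho>)"
    and eps: "0 < \<epsilon>" "\<epsilon> < 1"
    and E: "E = M\<^sup>2 + (2 * M\<^sup>2 + 2 * M * L + M\<^sup>2 * C2 / \<kappa>) / \<kappa>"
    and p: "p > 1" and pq: "1/p + 1/q = 1" and r: "r = max p q"
    and f: "bcs f" and g: "bcs g"
  shows "norm (bil (cut (hbox a (\<theta> * \<rho>)) (hbox b (\<theta> * \<rho>)) lam) f g)
    \<le> 2 * (M powr (1 - 2/r) * (sqrt (2 * E / \<epsilon>) / \<theta>) powr (2/r))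
      * (\<rho> powr (real CARD('n) / p + real CARD('m) * (1 - 1/p)) * (\<bar>lam\<bar> * \<rho> ^ d) powr (- (1 - \<epsilon>) / r))
      * Lp_norm p f * Lp_norm q g"
proof -
  let ?X = "hbox a (\<theta> * \<rho>)" and ?Y = "hbox b (\<theta> * \<rho>)"
  define \<mu> where "\<mu> = \<bar>lam\<bar> * \<rho> ^ d"
  have \<mu>: "\<mu> > 0" unfolding \<mu>_def using lam \<rho> by simp
  have E0: "E > 0" unfolding E using M_pos L C2 \<kappa> by (intro add_pos_nonneg) auto
  define P where "P = real CARD('n) + real CARD('m)"
  define B0 where "B0 = sqrt (2 * E / \<epsilon>) / \<theta>"
  have B0: "B0 > 0" unfolding B0_def using E0 eps \<theta> by simp
  define B where "B = B0 * \<rho> powr (P / 2) * \<mu> powr (- (1 - \<epsilon>) / 2)"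
  have B: "B > 0" unfolding B_def using B0 \<rho> \<mu> by simp
  have Bpow: "B powr (2 / s) = B0 powr (2/s) * \<rho> powr (P / s) * \<mu> powr (- (1 - \<epsilon>) / s)" for s
  proof -
    have e: "P / 2 * (2 / s) = P / s" "(- (1 - \<epsilon>) / 2) * (2 / s) = - (1 - \<epsilon>) / s" by (cases "s = 0"; simp add: field_simps)+
    have "B powr (2 / s) = B0 powr (2/s) * (\<rho> powr (P / 2)) powr (2/s) * (\<mu> powr (- (1 - \<epsilon>) / 2)) powr (2/s)"
      unfolding B_def using B0 \<rho> \<mu> by (simp add: powr_mult)
    then show ?thesis unfolding powr_powr e .
  qed
  have hb: "\<theta> * \<rho> \<ge> 0" "\<theta> * \<rho> \<le> \<rho>" using \<theta> \<rho> by (auto simp: mult_le_cancel_right1)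
  have mX: "measure lborel ?X \<le> \<rho> powr real CARD('n)" and mY: "measure lborel ?Y \<le> \<rho> powr real CARD('m)"
    using order_trans[OF hbox_measure[OF hb(1), of a] power_mono[OF hb(2,1)]] order_trans[OF hbox_measure[OF hb(1), of b] power_mono[OF hb(2,1)]] \<rho>
    by (simp_all add: powr_realpow)
  have L2: "norm (bil (cut ?X ?Y lam) f g) \<le> B * L2 f * L2 g"
    if "bcs f" "bcs g" "\<And>y. f y \<noteq> 0 \<Longrightarrow> y \<in> ?Y" "\<And>x. g x \<noteq> 0 \<Longrightarrow> x \<in> ?X" for f g
    unfolding B_def B0_def P_def \<mu>_def
    by (rule box_L2_bound[OF \<kappa> \<rho> lam \<theta> C2 L good eps E that])
  note q1 = conjugate_exponent(1)[OF p pq] and q = conjugate_exponent(2)[OF p pq]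
  show ?thesis
  proof (cases "p \<ge> 2")
    case True
    have "1/2 \<le> 1/q" unfolding q1 using True by (simp add: field_simps)
    then have "q \<le> 2" using q by (simp add: field_simps)
    then have rp: "r = p" using r True by simp
    have "norm (bil (cut ?X ?Y lam) f g) \<le> 2 * (M powr (1 - 2/p) * (\<rho> powr real CARD('m)) powr (1 - 2/p) * B powr (2/p)) * Lp_norm p f * Lp_norm q g"
      by (rule bil_interpolation[OF cut_bcs[OF hbox_sets hbox_sets] f g cut_supp hbox_sets hbox_bounded hbox_sets hbox_bounded mY M_pos cut_norm _ B L2 True pq])
        (use \<rho> in auto)
    also have "M powr (1 - 2/p) * (\<rho> powr real CARD('m)) powr (1 - 2/p) * B powr (2/p)
      = M powr (1 - 2/p) * B0 powr (2/p) * (\<rho> powr (real CARD('m) * (1 - 2/p) + P / p) * \<mu> powr (- (1 - \<epsilon>) / p))"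
      unfolding Bpow powr_powr powr_add by simp
    also have "real CARD('m) * (1 - 2/p) + P / p = real CARD('n) / p + real CARD('m) * (1 - 1/p)"
      unfolding P_def using p by (simp add: field_simps)
    finally show ?thesis unfolding rp \<mu>_def B0_def by (simp add: mult_ac)
  next
    case False
    have "1/q \<le> 1/2" unfolding q1 using False p by (simp add: field_simps)
    then have q2: "q \<ge> 2" using q by (simp add: field_simps)
    then have rq: "r = q" using r False by simp
    have "norm (bil (cut ?X ?Y lam) f g) \<le> 2 * (M powr (1 - 2/q) * (\<rho> powr real CARD('n)) powr (1 - 2/q) * B powr (2/q)) * Lp_norm p f * Lp_norm q g"
      by (rule bil_interpolation_dual[OF cut_bcs[OF hbox_sets hbox_sets] f g cut_supp hbox_sets hbox_bounded mX hbox_sets hbox_bounded M_pos cut_norm _ B L2 q2 pq])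
        (use \<rho> in auto)
    also have "M powr (1 - 2/q) * (\<rho> powr real CARD('n)) powr (1 - 2/q) * B powr (2/q)
      = M powr (1 - 2/q) * B0 powr (2/q) * (\<rho> powr (real CARD('n) * (1 - 2/q) + P / q) * \<mu> powr (- (1 - \<epsilon>) / q))"
      unfolding Bpow powr_powr powr_add by simp
    also have "real CARD('n) * (1 - 2/q) + P / q = real CARD('n) / p + real CARD('m) * (1 - 1/p)"
    proof -
      have "real CARD('n) * (1 - 2/q) + P / q = real CARD('n) * (1 - 2 * (1/q)) + P * (1/q)" by simp
      then show ?thesis unfolding q1 P_def by (simp add: algebra_simps)
    qed
    finally show ?thesis unfolding rq \<mu>_def B0_def by (simp add: mult_ac)
  qed
qed

end

section \<open>Dyadic decomposition\<close>

text \<open>Indices of the cells of side \<open>h\<close> that tile the cube with coordinates in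
  [-hk, hk). The upper bound is strict because a cell is named by its lower corner.\<close>

definition grid :: "int \<Rightarrow> ('n::finite \<Rightarrow> int) set" where
  "grid k = {u. \<forall>c. - k \<le> u c \<and> u c < k}"

definition corner :: "real \<Rightarrow> ('n::finite \<Rightarrow> int) \<Rightarrow> real^'n" where
  "corner h u = (\<chi> c. h * of_int (u c))"

lemma finite_grid: "finite (grid k :: ('n::finite \<Rightarrow> int) set)"
proof (rule finite_subset)
  show "grid k \<subseteq> PiE (UNIV :: 'n set) (\<lambda>_. {-k..<k})" unfolding grid_def by (auto simp: PiE_UNIV_domain)
  show "finite (PiE (UNIV :: 'n set) (\<lambda>_. {-k..<k}))" by (intro finite_PiE) auto
qed

lemma grid_mono: assumes "k \<le> k'" shows "grid k \<subseteq> grid k'"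
proof
  fix u :: "'a \<Rightarrow> int" assume "u \<in> grid k"
  then have u: "- k \<le> u c \<and> u c < k" for c unfolding grid_def by simp
  have "- k' \<le> u c \<and> u c < k'" for c using u[of c] assms by linarith
  then show "u \<in> grid k'" unfolding grid_def by simp
qed

lemma mem_hbox_corner:
  fixes x :: "real^'n"
  assumes "h > 0"
  shows "x \<in> hbox (corner h u) h \<longleftrightarrow> u = (\<lambda>c. \<lfloor>x $ c / h\<rfloor>)"
proof -
  have "(h * of_int (u c) \<le> x $ c \<and> x $ c < h * of_int (u c) + h) \<longleftrightarrow> u c = \<lfloor>x $ c / h\<rfloor>" for c
  proof -
    have "(h * of_int (u c) \<le> x $ c \<and> x $ c < h * of_int (u c) + h) \<longleftrightarrow> (of_int (u c) \<le> x $ c / h \<and> x $ c / h < of_int (u c) + 1)"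
      using assms by (simp add: field_simps)
    also have "\<dots> \<longleftrightarrow> u c = \<lfloor>x $ c / h\<rfloor>" using floor_eq_iff[of "x $ c / h" "u c"] by auto
    finally show ?thesis .
  qed
  then show ?thesis unfolding hbox_def corner_def by (auto simp: fun_eq_iff)
qed

text \<open>Each point lies in exactly one cell, the one indexed by the integer parts of its
  coordinates divided by \<open>h\<close>.\<close>

lemma indicator_grid:
  fixes x :: "real^'n"
  assumes "h > 0"
  shows "(\<Sum>u\<in>grid k. indicator (hbox (corner h u) h) x) = (indicator (hbox (\<chi> c. - (h * of_int k)) (2 * (h * of_int k))) x :: complex)"
proof -
  define w where "w = (\<lambda>c. \<lfloor>x $ c / h\<rfloor>)"
  have "(\<Sum>u\<in>grid k. indicator (hbox (corner h u) h) x) = (\<Sum>u\<in>grid k. if u = w then 1 else (0::complex))"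
    using mem_hbox_corner[OF assms, of x] by (intro sum.cong) (auto simp: indicator_def w_def)
  also have "\<dots> = (if w \<in> grid k then 1 else 0)" by (simp add: finite_grid)
  also have "w \<in> grid k \<longleftrightarrow> x \<in> hbox (\<chi> c. - (h * of_int k)) (2 * (h * of_int k))"
  proof -
    have "(- k \<le> w c \<and> w c < k) \<longleftrightarrow> (- (h * of_int k) \<le> x $ c \<and> x $ c < - (h * of_int k) + 2 * (h * of_int k))" for c
    proof -
      have "- k \<le> w c \<longleftrightarrow> of_int (- k) \<le> x $ c / h" unfolding w_def by (rule le_floor_iff)
      also have "\<dots> \<longleftrightarrow> - (h * of_int k) \<le> x $ c" using assms by (simp add: pos_le_divide_eq mult.commute)
      finally have 1: "- k \<le> w c \<longleftrightarrow> - (h * of_int k) \<le> x $ c" .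
      have "w c < k \<longleftrightarrow> x $ c / h < of_int k" unfolding w_def by (rule floor_less_iff)
      also have "\<dots> \<longleftrightarrow> x $ c < h * of_int k" using assms by (simp add: pos_divide_less_eq mult.commute)
      finally show ?thesis using 1 by simp
    qed
    then show ?thesis unfolding grid_def hbox_def by simp
  qed
  finally show ?thesis by (simp add: indicator_def)
qed

lemma norm_vec_le_card:
  fixes x :: "real^'n"
  assumes "\<And>c. \<bar>x $ c\<bar> \<le> r" shows "norm x \<le> real CARD('n) * r"
proof -
  have "norm x \<le> (\<Sum>c\<in>UNIV. \<bar>x $ c\<bar>)" by (rule norm_le_l1_cart)
  also have "\<dots> \<le> (\<Sum>c\<in>(UNIV::'n set). r)" by (intro sum_mono assms)
  finally show ?thesis by simp
qed

lemma norm_pair_le_card: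
  fixes x :: "real^'n" and y :: "real^'m"
  assumes "\<And>c. \<bar>x $ c\<bar> \<le> r" "\<And>c. \<bar>y $ c\<bar> \<le> r"
  shows "norm (x, y) \<le> (real CARD('n) + real CARD('m)) * r"
  using norm_vec_le_card[OF assms(1)] norm_vec_le_card[OF assms(2)] norm_Pair_le[of x y]
  by (simp add: distrib_right)

context oscillatory_data
begin

definition cube :: "real \<Rightarrow> real \<Rightarrow> real^'n \<Rightarrow> real^'m \<Rightarrow> complex" where
  "cube lam \<rho> = cut (hbox (\<chi> c. - \<rho>) (2 * \<rho>)) (hbox (\<chi> c. - \<rho>) (2 * \<rho>)) lam"

lemma cube_eq_sum:
  assumes "h > 0"
  shows "cube lam (h * of_int k) x y =
    (\<Sum>w\<in>grid k \<times> grid k. cut (hbox (corner h (fst w)) h) (hbox (corner h (snd w)) h) lam x y)"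
proof -
  have "cube lam (h * of_int k) x y = (\<Sum>u\<in>grid k. indicator (hbox (corner h u) h) x) * (\<Sum>v\<in>grid k. indicator (hbox (corner h v) h) y) * ker lam x y"
    unfolding cube_def cut_def indicator_grid[OF assms] ..
  also have "\<dots> = (\<Sum>u\<in>grid k. \<Sum>v\<in>grid k. indicator (hbox (corner h u) h) x * indicator (hbox (corner h v) h) y * ker lam x y)"
    unfolding sum_product by (simp only: sum_distrib_right)
  also have "\<dots> = (\<Sum>w\<in>grid k \<times> grid k. cut (hbox (corner h (fst w)) h) (hbox (corner h (snd w)) h) lam x y)"
    unfolding cut_def sum.cartesian_product by (simp add: case_prod_beta)
  finally show ?thesis .
qed

text \<open>Doubling the cube keeps the mesh, so the annulus is exactly a union of products of
  cells, in number depending on \<open>k\<close> and not on \<open>h\<close>.\<close>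

lemma cube_annulus:
  assumes "h > 0" "k \<ge> 0" and f: "bcs f" and g: "bcs g"
  shows "bil (cube lam (h * of_int (2 * k))) f g = bil (cube lam (h * of_int k)) f g +
    (\<Sum>w\<in>grid (2*k) \<times> grid (2*k) - grid k \<times> grid k. bil (cut (hbox (corner h (fst w)) h) (hbox (corner h (snd w)) h) lam) f g)"
proof -
  have b: "bil (cube lam (h * of_int k')) f g = (\<Sum>w\<in>grid k' \<times> grid k'. bil (cut (hbox (corner h (fst w)) h) (hbox (corner h (snd w)) h) lam) f g)" for k'
    unfolding cube_eq_sum[OF assms(1), abs_def]
    by (rule bil_sum[OF cut_bcs[OF hbox_sets hbox_sets] f g]) (intro finite_cartesian_product finite_grid)
  have "grid k \<times> grid k \<subseteq> (grid (2*k) \<times> grid (2*k) :: (('n \<Rightarrow> int) \<times> ('m \<Rightarrow> int)) set)"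
    by (intro Sigma_mono grid_mono) (use assms(2) in auto)
  then show ?thesis unfolding b
    by (subst sum.subset_diff[of "grid k \<times> grid k"]) (auto intro: finite_cartesian_product finite_grid)
qed

end

section \<open>Summation over annuli\<close>

text \<open>The factor \<open>CARD('n) + CARD('m)\<close> comes from
  \<open>norm_pair_le_card\<close> for points of the cube of half-width \<rho>, the bound
  \<open>\<rho> / 2\<close> from the inner cube that is removed. The constants are fixed before
  \<rho>.\<close>

locale nondegenerate_data = oscillatory_data S \<phi> d S1 S2 S11 S21 \<phi>1 M M1 R
  for S \<phi> :: "real^'n \<Rightarrow> real^'m \<Rightarrow> real" and d S1 S2 S11 S21 \<phi>1 M M1 R +
  fixes \<kappa> \<eta> C2 :: real
  assumes \<kappa>: "\<kappa> > 0" and \<eta>: "\<eta> > 0" and C2: "C2 \<ge> 0"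
    and nd: "\<rho> > 0 \<Longrightarrow> \<rho> / 2 \<le> norm (x0, y0) \<Longrightarrow> norm (x0, y0) \<le> (real CARD('n) + real CARD('m)) * \<rho> \<Longrightarrow>
        \<exists>i j. \<forall>x y. dist (x0, y0) (x, y) < \<eta> * \<rho> \<longrightarrow> \<kappa> * \<rho> ^ d \<le> \<rho> ^ 2 * \<bar>S11 i j x y\<bar>"
    and b21: "\<rho> > 0 \<Longrightarrow> norm (x, y) \<le> (real CARD('n) + real CARD('m)) * \<rho> \<Longrightarrow> \<rho> ^ 3 * \<bar>S21 i j x y\<bar> \<le> C2 * \<rho> ^ d"
begin

text \<open>The annulus between the cubes of radius \<open>\<rho>/2\<close> and \<open>\<rho>\<close> is cut into boxes so small that one
  mixed derivative dominates throughout each of them.\<close>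

lemma annulus_bound:
  assumes eps: "0 < \<epsilon>" "\<epsilon> < 1" and p: "p > 1" and pq: "1/p + 1/q = 1"
  obtains A where "A \<ge> 0"
    "\<And>lam \<rho> f g. lam \<noteq> 0 \<Longrightarrow> \<rho> > 0 \<Longrightarrow> bcs f \<Longrightarrow> bcs g \<Longrightarrow>
      norm (bil (cube lam \<rho>) f g) \<le> norm (bil (cube lam (\<rho> / 2)) f g) +
        A * (\<rho> powr (real CARD('n) / p + real CARD('m) * (1 - 1/p)) * (\<bar>lam\<bar> * \<rho> ^ d) powr (- (1 - \<epsilon>) / max p q))
          * Lp_norm p f * Lp_norm q g"
proof -
  define D where "D = real CARD('n) + real CARD('m)"
  have D: "D > 0" unfolding D_def by (simp add: add_pos_pos)
  \<comment> \<open>\<open>N\<close> cells make up \<open>\<rho> / 2\<close>. Points of a product of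
    two cells are at most \<open>D * h = D * \<theta> * \<rho>\<close> from its corner, and this
    choice of \<open>N\<close> keeps that below \<open>\<eta> * \<rho>\<close>, the radius on which
    one mixed derivative dominates.\<close>
  obtain N :: nat where N: "D / (2 * \<eta>) < real N" using reals_Archimedean2 by blast
  have "0 < D / (2 * \<eta>)" using D \<eta> by simp
  then have N0: "real N > 0" using N by linarith
  define \<theta> where "\<theta> = 1 / (2 * real N)"
  have \<theta>: "0 < \<theta>" "\<theta> \<le> 1" unfolding \<theta>_def using N0 by auto
  have \<theta>N: "\<theta> * real N = 1/2" unfolding \<theta>_def using N0 by simp
  have \<theta>D: "D * \<theta> < \<eta>" unfolding \<theta>_def using N N0 \<eta> by (simp add: field_simps)
  \<comment> \<open>\<open>2 * M1\<close> takes the place of \<open>L\<close>: on the annulus the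
    norm is at least \<open>\<rho> / 2\<close>, so \<open>\<phi>1_bound\<close> gives \<rho>
    |\<phi>1| \<le> 2 M1.\<close>
  define E where "E = M\<^sup>2 + (2 * M\<^sup>2 + 2 * M * (2 * M1) + M\<^sup>2 * C2 / \<kappa>) / \<kappa>"
  define r where "r = max p q"
  define B where "B = 2 * (M powr (1 - 2/r) * (sqrt (2 * E / \<epsilon>) / \<theta>) powr (2/r))"
  have B0: "B \<ge> 0" unfolding B_def by simp
  define J where "J = (grid (2 * int N) \<times> grid (2 * int N) - grid (int N) \<times> grid (int N) :: (('n \<Rightarrow> int) \<times> ('m \<Rightarrow> int)) set)"
  show thesis
  proof (rule that[of "real (card J) * B"])
    show "real (card J) * B \<ge> 0" using B0 by simp
    fix lam \<rho> :: real and f :: "real^'m \<Rightarrow> complex" and g :: "real^'n \<Rightarrow> complex"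
    assume lam: "lam \<noteq> 0" and \<rho>: "\<rho> > 0" and f: "bcs f" and g: "bcs g"
    define h where "h = \<theta> * \<rho>"
    have h: "h > 0" unfolding h_def using \<theta> \<rho> by simp
    have hN: "h * real N = \<rho> / 2" using \<theta>N unfolding h_def by (simp add: mult_ac)
    define Q where "Q = \<rho> powr (real CARD('n) / p + real CARD('m) * (1 - 1/p)) * (\<bar>lam\<bar> * \<rho> ^ d) powr (- (1 - \<epsilon>) / r)"
    have box: "norm (bil (cut (hbox (corner h (fst w)) h) (hbox (corner h (snd w)) h) lam) f g) \<le> B * Q * Lp_norm p f * Lp_norm q g"
      if w: "w \<in> J" for w
    proof -
      obtain u v where uv: "w = (u, v)" by (metis prod.exhaust)
      have in_grid: "- (2 * int N) \<le> u c \<and> u c < 2 * int N" "- (2 * int N) \<le> v c' \<and> v c' < 2 * int N" for c c'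
        using w unfolding J_def uv grid_def by auto
      have range: "- \<rho> \<le> h * of_int k \<and> h * of_int k + h \<le> \<rho>" if "- (2 * int N) \<le> k \<and> k < 2 * int N" for k
      proof -
        have "- (2 * real N) \<le> of_int k" "of_int k + 1 \<le> 2 * real N" using that by linarith+
        then have "h * (- (2 * real N)) \<le> h * of_int k" "h * (of_int k + 1) \<le> h * (2 * real N)"
          using h by (intro mult_left_mono; simp)+
        then show ?thesis using hN by (simp add: algebra_simps)
      qed
      \<comment> \<open>The closed product contains the corner, where \<open>nd\<close> is applied,
        and the faces that \<open>good_box\<close> asks for.\<close>
      define clo where "clo x y \<longleftrightarrow> (\<forall>c. corner h u $ c \<le> x $ c \<and> x $ c \<le> corner h u $ c + h) \<and> (\<forall>c. corner h v $ c \<le> y $ c \<and> y $ c \<le> corner h v $ c + h)" for x y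
      have clo_box: "clo x y" if "\<forall>c. corner h u $ c \<le> x $ c \<and> x $ c \<le> corner h u $ c + h" "y \<in> hbox (corner h v) h" for x y
        using that unfolding clo_def hbox_def by (auto simp: less_imp_le)
      have clo_corner: "clo (corner h u) (corner h v)" unfolding clo_def using h by simp
      have small: "norm (x, y) \<le> D * \<rho>" if "clo x y" for x y
        unfolding D_def
      proof (rule norm_pair_le_card)
        show "\<bar>x $ c\<bar> \<le> \<rho>" for c using that range[OF in_grid(1)[of c]] unfolding clo_def corner_def by (auto simp: abs_le_iff; smt (verit))
        show "\<bar>y $ c\<bar> \<le> \<rho>" for c using that range[OF in_grid(2)[of c]] unfolding clo_def corner_def by (auto simp: abs_le_iff; smt (verit))
      qed
      \<comment> \<open>An index of at least \<open>N\<close> puts the lower end of the cell at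
        \<open>\<rho> / 2\<close> or beyond; an index below \<open>-N\<close> is at most
        \<open>-N - 1\<close>, so the upper end is at most \<open>-\<rho> / 2\<close>.\<close>
      have far: "\<rho> / 2 \<le> \<bar>z\<bar>" if "\<not> (- int N \<le> k \<and> k < int N)" "h * of_int k \<le> z \<and> z \<le> h * of_int k + h" for k z
      proof (cases "int N \<le> k")
        case True
        then have "h * real N \<le> h * of_int k" using h by (intro mult_left_mono) auto
        then show ?thesis using that hN by linarith
      next
        case False
        then have "of_int k + 1 \<le> - real N" using that by linarith
        then have "h * (of_int k + 1) \<le> h * (- real N)" using h by (intro mult_left_mono) auto
        then have "z \<le> - (\<rho> / 2)" using that hN by (simp add: algebra_simps)
        then show ?thesis by linarith
      qed
      have large: "\<rho> / 2 \<le> norm (x, y)" if xy: "clo x y" for x y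
      proof -
        have "u \<notin> grid (int N) \<or> v \<notin> grid (int N)" using w unfolding J_def uv by auto
        then show ?thesis
        proof
          assume "u \<notin> grid (int N)"
          then obtain c where "\<not> (- int N \<le> u c \<and> u c < int N)" unfolding grid_def by auto
          then have "\<rho> / 2 \<le> \<bar>x $ c\<bar>" by (rule far) (use xy in \<open>auto simp: clo_def corner_def\<close>)
          then show ?thesis using component_le_norm_cart[of x c] norm_fst_le[of x y] by linarith
        next
          assume "v \<notin> grid (int N)"
          then obtain c where "\<not> (- int N \<le> v c \<and> v c < int N)" unfolding grid_def by auto
          then have "\<rho> / 2 \<le> \<bar>y $ c\<bar>" by (rule far) (use xy in \<open>auto simp: clo_def corner_def\<close>)
          then show ?thesis using component_le_norm_cart[of y c] norm_snd_le[of y x] by linarith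
        qed
      qed
      have near: "dist (corner h u, corner h v) (x, y) < \<eta> * \<rho>" if "clo x y" for x y
      proof -
        have "norm (x - corner h u, y - corner h v) \<le> D * h"
          unfolding D_def
        proof (rule norm_pair_le_card)
          show "\<bar>(x - corner h u) $ c\<bar> \<le> h" for c
            using that[unfolded clo_def, THEN conjunct1, THEN spec, of c] unfolding vector_minus_component by linarith
          show "\<bar>(y - corner h v) $ c\<bar> \<le> h" for c
            using that[unfolded clo_def, THEN conjunct2, THEN spec, of c] unfolding vector_minus_component by linarith
        qed
        also have "\<dots> < \<eta> * \<rho>" unfolding h_def using \<theta>D \<rho> by (simp add: mult.assoc[symmetric])
        finally show ?thesis by (subst dist_commute) (simp add: dist_norm)
      qed
      obtain i j where ij: "\<And>x y. dist (corner h u, corner h v) (x, y) < \<eta> * \<rho> \<Longrightarrow> \<kappa> * \<rho> ^ d \<le> \<rho> ^ 2 * \<bar>S11 i j x y\<bar>"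
        using nd[OF \<rho> large[OF clo_corner] small[OF clo_corner, unfolded D_def]] by blast
      have L: "\<rho> * \<bar>\<phi>1 i x y\<bar> \<le> 2 * M1" if "clo x y" for x y
      proof -
        have "\<rho> / 2 * \<bar>\<phi>1 i x y\<bar> \<le> norm (x, y) * \<bar>\<phi>1 i x y\<bar>" using large[OF that] by (intro mult_right_mono) auto
        then show ?thesis using \<phi>1_bound[of i x y] by (simp add: mult.commute)
      qed
      have "good_box \<kappa> \<rho> C2 (2 * M1) i j (corner h u) (corner h v) h"
        unfolding good_box_def using clo_box ij near b21[OF \<rho> small[unfolded D_def]] L by blast
      from box_Lp_bound[OF \<kappa> \<rho> lam \<theta> C2 _ this[unfolded h_def] eps E_def p pq r_def f g] M1_nonneg
      have "norm (bil (cut (hbox (corner h u) (\<theta> * \<rho>)) (hbox (corner h v) (\<theta> * \<rho>)) lam) f g) \<le> B * Q * Lp_norm p f * Lp_norm q g"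
        unfolding B_def Q_def h_def by simp
      then show ?thesis unfolding uv fst_conv snd_conv h_def .
    qed
    have e1: "h * of_int (2 * int N) = \<rho>" and e2: "h * of_int (int N) = \<rho> / 2" using hN by simp_all
    have "bil (cube lam \<rho>) f g = bil (cube lam (\<rho> / 2)) f g +
       (\<Sum>w\<in>J. bil (cut (hbox (corner h (fst w)) h) (hbox (corner h (snd w)) h) lam) f g)"
      using cube_annulus[OF h _ f g, of "int N" lam] unfolding e1 e2 J_def by simp
    then have "norm (bil (cube lam \<rho>) f g) \<le> norm (bil (cube lam (\<rho> / 2)) f g) +
       norm (\<Sum>w\<in>J. bil (cut (hbox (corner h (fst w)) h) (hbox (corner h (snd w)) h) lam) f g)"
      by (simp add: norm_triangle_ineq)
    also have "norm (\<Sum>w\<in>J. bil (cut (hbox (corner h (fst w)) h) (hbox (corner h (snd w)) h) lam) f g) \<le> (\<Sum>w\<in>J. B * Q * Lp_norm p f * Lp_norm q g)"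
      by (rule sum_norm_le) (rule box)
    finally show "norm (bil (cube lam \<rho>) f g) \<le> norm (bil (cube lam (\<rho> / 2)) f g) +
        real (card J) * B * (\<rho> powr (real CARD('n) / p + real CARD('m) * (1 - 1/p)) * (\<bar>lam\<bar> * \<rho> ^ d) powr (- (1 - \<epsilon>) / max p q))
          * Lp_norm p f * Lp_norm q g"
      unfolding Q_def r_def by (simp add: mult_ac)
  qed
qed

text \<open>For the radii \<rho> = |lam|^(-1/d) 2^k the parameter |lam| \<rho>^d equals 2^(dk), so
  \<open>lam\<close> enters each annulus only through |lam|^(-\<gamma>), and the bounds for
  consecutive annuli have the fixed ratio \<open>t < 1\<close>.\<close>

lemma bil_ker_bound:
  assumes p: "p > 1" and pq: "1/p + 1/q = 1" and d: "d > 0"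
    and \<gamma>: "\<gamma> = real CARD('n) / real d * (1/p) + real CARD('m) / real d * (1 - 1/p)" and \<gamma>_less: "\<gamma> * max p q < 1"
  obtains C where "C \<ge> 0"
    "\<And>lam f g. lam \<noteq> 0 \<Longrightarrow> bcs f \<Longrightarrow> bcs g \<Longrightarrow>
      norm (bil (ker lam) f g) \<le> C * \<bar>lam\<bar> powr (- \<gamma>) * Lp_norm p f * Lp_norm q g"
proof -
  define r where "r = max p q"
  have r: "r > 1" unfolding r_def using p by simp
  have \<gamma>0: "\<gamma> \<ge> 0" unfolding \<gamma> using p by simp
  \<comment> \<open>This puts \<open>\<delta>\<close> at the midpoint of \<open>\<gamma>\<close> and
    \<open>1 / r\<close>.\<close>
  define \<epsilon> where "\<epsilon> = (1 - \<gamma> * r) / 2"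
  have gr: "\<gamma> * r < 1" "\<gamma> * r \<ge> 0" using \<gamma>_less \<gamma>0 r unfolding r_def[symmetric] by auto
  have eps: "0 < \<epsilon>" "\<epsilon> < 1" unfolding \<epsilon>_def using gr by auto
  define \<delta> where "\<delta> = (1 - \<epsilon>) / r"
  have \<delta>: "\<gamma> < \<delta>" unfolding \<delta>_def \<epsilon>_def using gr r by (simp add: field_simps)
  have d\<gamma>: "real CARD('n) / p + real CARD('m) * (1 - 1/p) = d * \<gamma>" unfolding \<gamma> using d by (simp add: distrib_left)
  have \<delta>e: "- (1 - \<epsilon>) / max p q = - \<delta>" unfolding \<delta>_def r_def by (simp only: minus_divide_left)
  show thesis
  proof (rule annulus_bound[OF eps p pq])
    fix A assume A0: "A \<ge> 0" and A1: "\<And>lam \<rho> f g. lam \<noteq> 0 \<Longrightarrow> \<rho> > 0 \<Longrightarrow> bcs f \<Longrightarrow> bcs g \<Longrightarrow>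
        norm (bil (cube lam \<rho>) f g) \<le> norm (bil (cube lam (\<rho> / 2)) f g) +
          A * (\<rho> powr (real CARD('n) / p + real CARD('m) * (1 - 1/p)) * (\<bar>lam\<bar> * \<rho> ^ d) powr (- (1 - \<epsilon>) / max p q))
            * Lp_norm p f * Lp_norm q g"
    note A = A0 A1[unfolded d\<gamma> \<delta>e]
    define t where "t = 2 powr (d * (\<gamma> - \<delta>))"
    have t: "0 < t" "t < 1" unfolding t_def using \<delta> d by (auto simp: mult_pos_neg intro!: powr_less_one)
    \<comment> \<open>The innermost cube has side \<open>2 * \<rho> 0\<close>, whence the factor
      \<open>2 powr (d * \<gamma>)\<close>.\<close>
    define C0 where "C0 = M * 2 powr (d * \<gamma>)"
    have C00: "C0 \<ge> 0" unfolding C0_def using M_pos by simp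
    have q1: "1/q = 1 - 1/p" using pq by simp
    show thesis
    proof (rule that[of "C0 + A * (1 / (1 - t))"])
      show "C0 + A * (1 / (1 - t)) \<ge> 0" using C00 A(1) t by simp
      fix lam :: real and f :: "real^'m \<Rightarrow> complex" and g :: "real^'n \<Rightarrow> complex"
      assume lam: "lam \<noteq> 0" and f: "bcs f" and g: "bcs g"
      define F where "F = Lp_norm p f * Lp_norm q g"
      have F0: "F \<ge> 0" unfolding F_def by (intro mult_nonneg_nonneg Lp_norm_nonneg)
      define \<Lambda> where "\<Lambda> = \<bar>lam\<bar>"
      have \<Lambda>: "\<Lambda> > 0" unfolding \<Lambda>_def using lam by simp
      define \<rho> where "\<rho> k = \<Lambda> powr (- (1 / d)) * 2 ^ k" for k :: nat
      have \<rho>0: "\<rho> k > 0" for k unfolding \<rho>_def using \<Lambda> by simp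
      have \<rho>\<gamma>: "\<rho> k powr (d * \<gamma>) = \<Lambda> powr (- \<gamma>) * 2 powr (d * \<gamma> * k)" for k
        unfolding \<rho>_def using \<Lambda> d by (simp add: powr_mult powr_powr powr_realpow[symmetric] mult_ac)
      have \<rho>d: "\<Lambda> * \<rho> k ^ d = 2 powr (d * k)" for k
      proof -
        have "\<rho> k ^ d = \<rho> k powr d" using \<rho>0 by (simp add: powr_realpow)
        also have "\<dots> = \<Lambda> powr (-1) * 2 powr (d * k)"
          unfolding \<rho>_def using \<Lambda> d by (simp add: powr_mult powr_powr powr_realpow[symmetric] mult_ac)
        finally show ?thesis using \<Lambda> by (simp add: powr_minus)
      qed
      have step: "\<rho> k powr (d * \<gamma>) * (\<Lambda> * \<rho> k ^ d) powr (- \<delta>) = \<Lambda> powr (- \<gamma>) * t ^ k" for k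
      proof -
        have "t ^ k = 2 powr (d * (\<gamma> - \<delta>) * k)" unfolding t_def by (simp add: powr_realpow[symmetric] powr_powr)
        also have "\<dots> = 2 powr (d * \<gamma> * k) * 2 powr (d * k * (- \<delta>))" unfolding powr_add[symmetric] by (simp add: algebra_simps)
        finally show ?thesis unfolding \<rho>\<gamma> \<rho>d powr_powr by simp
      qed
      have cubes: "norm (bil (cube lam (\<rho> k)) f g) \<le> \<Lambda> powr (- \<gamma>) * (C0 + A * (\<Sum>i=1..k. t ^ i)) * F" for k
      proof (induction k)
        case 0
        have v: "measure lborel (hbox (\<chi> c. - \<rho> 0) (2 * \<rho> 0) :: (real^'n) set) \<le> (2 * \<rho> 0) powr real CARD('n)"
            "measure lborel (hbox (\<chi> c. - \<rho> 0) (2 * \<rho> 0) :: (real^'m) set) \<le> (2 * \<rho> 0) powr real CARD('m)"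
          using hbox_measure[of "2 * \<rho> 0" "(\<chi> c. - \<rho> 0) :: real^'n"] hbox_measure[of "2 * \<rho> 0" "(\<chi> c. - \<rho> 0) :: real^'m"] \<rho>0[of 0]
          by (simp_all add: powr_realpow)
        have "norm (bil (cube lam (\<rho> 0)) f g) \<le> M * ((2 * \<rho> 0) powr real CARD('m)) powr (1 - 1/p) * ((2 * \<rho> 0) powr real CARD('n)) powr (1/p) * Lp_norm p f * Lp_norm q g"
          unfolding cube_def
          by (rule bil_Lp_trivial_bound[OF f g cut_supp hbox_sets hbox_bounded v(1) hbox_sets hbox_bounded v(2) cut_norm p pq])
        also have "\<dots> = M * (((2 * \<rho> 0) powr real CARD('m)) powr (1 - 1/p) * ((2 * \<rho> 0) powr real CARD('n)) powr (1/p)) * F"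
          unfolding F_def by (simp only: mult.assoc)
        also have "((2 * \<rho> 0) powr real CARD('m)) powr (1 - 1/p) * ((2 * \<rho> 0) powr real CARD('n)) powr (1/p) = (2 * \<rho> 0) powr (d * \<gamma>)"
          unfolding powr_powr powr_add[symmetric] d\<gamma>[symmetric] by (simp add: add.commute)
        also have "(2 * \<rho> 0) powr (d * \<gamma>) = 2 powr (d * \<gamma>) * \<Lambda> powr (- \<gamma>)"
          using \<rho>0[of 0] \<rho>\<gamma>[of 0] by (simp add: powr_mult)
        finally show ?case unfolding C0_def by (simp add: mult_ac)
      next
        case (Suc k)
        have "\<rho> (Suc k) / 2 = \<rho> k" unfolding \<rho>_def by simp
        then have "norm (bil (cube lam (\<rho> (Suc k))) f g) \<le> norm (bil (cube lam (\<rho> k)) f g) + A * (\<Lambda> powr (- \<gamma>) * t ^ Suc k) * F"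
          using A(2)[OF lam \<rho>0[of "Suc k"] f g, folded \<Lambda>_def, unfolded step] unfolding F_def by (simp add: mult_ac)
        also have "\<dots> \<le> \<Lambda> powr (- \<gamma>) * (C0 + A * (\<Sum>i=1..k. t ^ i)) * F + A * (\<Lambda> powr (- \<gamma>) * t ^ Suc k) * F"
          using Suc by simp
        also have "\<dots> = \<Lambda> powr (- \<gamma>) * (C0 + A * (\<Sum>i=1..Suc k. t ^ i)) * F"
          by (simp add: algebra_simps)
        finally show ?case .
      qed
      \<comment> \<open>The number of annuli depends on \<open>lam\<close> and on the radius
        \<open>R\<close> of the support; the bound on their sum does not.\<close>
      obtain k :: nat where k: "R / \<Lambda> powr (- (1 / d)) < 2 ^ k" using real_arch_pow[of 2 "R / \<Lambda> powr (- (1 / d))"] by auto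
      have \<rho>R: "R < \<rho> k" using k \<Lambda> unfolding \<rho>_def by (simp add: pos_divide_less_eq mult.commute)
      have "cube lam (\<rho> k) = ker lam"
      proof (intro ext)
        fix x y
        show "cube lam (\<rho> k) x y = ker lam x y"
        proof (cases "\<phi> x y = 0")
          case False
          then have "norm x \<le> R" "norm y \<le> R" using \<phi>_supp[of x y] norm_fst_le[of x y] norm_snd_le[of y x] by auto
          then have "\<bar>x $ c\<bar> < \<rho> k" "\<bar>y $ c'\<bar> < \<rho> k" for c c'
            using component_le_norm_cart[of x c] component_le_norm_cart[of y c'] \<rho>R by linarith+
          then have "x \<in> hbox (\<chi> c. - \<rho> k) (2 * \<rho> k)" "y \<in> hbox (\<chi> c. - \<rho> k) (2 * \<rho> k)"
            unfolding hbox_def by (auto simp: abs_less_iff less_imp_le; smt (verit))+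
          then show ?thesis unfolding cube_def cut_def by simp
        qed (simp add: cube_def cut_def ker_def)
      qed
      then have "norm (bil (ker lam) f g) \<le> \<Lambda> powr (- \<gamma>) * (C0 + A * (\<Sum>i=1..k. t ^ i)) * F" using cubes[of k] by simp
      also have "\<dots> \<le> \<Lambda> powr (- \<gamma>) * (C0 + A * (1 / (1 - t))) * F"
      proof (intro mult_right_mono mult_left_mono add_left_mono)
        have "(\<Sum>i=1..k. t ^ i) \<le> (\<Sum>i<Suc k. t ^ i)" using t by (intro sum_mono2) auto
        also have "\<dots> \<le> (\<Sum>i. t ^ i)" using t by (intro sum_le_suminf summable_geometric) auto
        also have "\<dots> = 1 / (1 - t)" using t by (intro suminf_geometric) auto
        finally show "(\<Sum>i=1..k. t ^ i) \<le> 1 / (1 - t)" .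
      qed (use A F0 in auto)
      finally show "norm (bil (ker lam) f g) \<le> (C0 + A * (1 / (1 - t))) * \<bar>lam\<bar> powr (- \<gamma>) * Lp_norm p f * Lp_norm q g"
        unfolding F_def \<Lambda>_def by (simp add: mult_ac)
    qed
  qed
qed

end

section \<open>From bilinear forms to operators\<close>

lemma kernel_slice_integrable:
  fixes K :: "'a::euclidean_space \<Rightarrow> 'b::euclidean_space \<Rightarrow> complex"
  assumes K: "bcs (\<lambda>z. K (fst z) (snd z))" and p: "p > 1" and pq: "1/p + 1/q = 1" and f: "memLp p f"
  shows "integrable lborel (\<lambda>y. K x y * f y)"
proof -
  have "q > 0" using conjugate_exponent(2)[OF p pq] by simp
  then have "memLp q (\<lambda>y. K x y)" using bcs_memLp[OF bcs_slice1[OF K, of x]] by simp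
  from Lp_Holder(1)[OF f this p pq] show ?thesis by (simp add: mult.commute)
qed

text \<open>Duality with the explicit extremal g = cnj h |h|^(p-2): the integral of
  \<open>h * g\<close> is \<open>H\<close>, the integral of |h|^p, and \<open>g\<close> has norm
  \<open>H powr (1/q)\<close>. Since the kernel is bounded with bounded support, \<open>h\<close>
  and \<open>g\<close> lie in \<open>bcs\<close> although \<open>f\<close> need not;
  \<open>f\<close> is reached by truncation.\<close>

lemma kernel_operator_Lp_bound:
  fixes K :: "'a::euclidean_space \<Rightarrow> 'b::euclidean_space \<Rightarrow> complex"
  assumes K: "bcs (\<lambda>z. K (fst z) (snd z))" and p: "p > 1" and pq: "1/p + 1/q = 1" and N: "N \<ge> 0"
    and bil: "\<And>f g. bcs f \<Longrightarrow> bcs g \<Longrightarrow> norm (bil K f g) \<le> N * Lp_norm p f * Lp_norm q g"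
    and f: "memLp p f"
  defines "h \<equiv> \<lambda>x. \<integral>y. K x y * f y \<partial>lborel"
  shows "memLp p h \<and> Lp_norm p h \<le> N * Lp_norm p f"
proof -
  note q1 = conjugate_exponent(1)[OF p pq] and q = conjugate_exponent(2)[OF p pq]
  have qp: "(p - 1) * q = p"
  proof -
    have "p - 1 = p * (1/q)" unfolding q1 using p by (simp add: field_simps)
    then show ?thesis using q by simp
  qed
  have [measurable]: "f \<in> borel_measurable borel" using f by (simp add: memLp_def)
  have ip: "integrable lborel (\<lambda>x. norm (f x) powr p)" using f by (simp add: memLp_def)
  obtain M where M: "M > 0" "\<And>z. norm (K (fst z) (snd z)) \<le> M" using bcs_bound[OF K] by metis
  have M': "norm (K x y) \<le> M" for x y using M(2)[of "(x,y)"] by simp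
  obtain Z where Z: "bounded Z" "Z \<in> sets borel" "\<And>z. z \<notin> Z \<Longrightarrow> K (fst z) (snd z) = 0" using bcs_supp[OF K] by metis
  obtain R where R: "\<And>z. z \<in> Z \<Longrightarrow> norm z \<le> R" using Z(1) unfolding bounded_iff by metis
  have KR: "norm x \<le> R \<and> norm y \<le> R" if "K x y \<noteq> 0" for x y
  proof -
    have "norm (x, y) \<le> R" by (rule R) (use Z(3)[of "(x,y)"] that in auto)
    then show ?thesis using norm_fst_le[of x y] norm_snd_le[of y x] by simp
  qed
  define Y where "Y = cball (0::'b) R"
  \<comment> \<open>The kernel sees only \<open>Y\<close>, and there \<open>f\<close> is integrable
    by Hoelder. So the approximation can take place in L^1, against a bounded kernel.\<close>
  define f0 where "f0 y = f y * indicator Y y" for y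
  have Y: "Y \<in> sets borel" "bounded Y" unfolding Y_def by auto
  have [measurable]: "f0 \<in> borel_measurable borel" unfolding f0_def using Y by measurable
  have if0: "integrable lborel f0"
    unfolding f0_def
  proof (rule Lp_Holder(1)[OF f _ p pq])
    show "memLp q (indicator Y :: 'b \<Rightarrow> complex)"
      using bcs_memLp[OF bcs_of_real_indicator[OF Y(2,1)], of q] q by simp
  qed
  have Kf: "K x y * f y = K x y * f0 y" for x y using KR[of x y] unfolding f0_def Y_def by (cases "K x y = 0") auto
  have iK: "integrable lborel (\<lambda>y. K x y * w y)" if "integrable lborel w" for x w
  proof (rule Bochner_Integration.integrable_bound)
    show "integrable lborel (\<lambda>y. M * norm (w y))" using that by simp
    have "(\<lambda>y. K x y) \<in> borel_measurable borel" using bcs_measurable[OF bcs_slice1[OF K, of x]] by simp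
    then show "(\<lambda>y. K x y * w y) \<in> borel_measurable lborel" using that by simp
    show "AE y in lborel. norm (K x y * w y) \<le> norm (M * norm (w y))"
      using M' M(1) by (intro AE_I2) (simp add: norm_mult mult_right_mono)
  qed
  have Kw: "norm (\<integral>y. K x y * w y \<partial>lborel) \<le> M * (\<integral>y. norm (w y) \<partial>lborel)" if "integrable lborel w" for x w
  proof -
    have "norm (\<integral>y. K x y * w y \<partial>lborel) \<le> (\<integral>y. M * norm (w y) \<partial>lborel)"
      by (rule norm_integral_le) (use M' that in \<open>auto simp: norm_mult mult_right_mono\<close>)
    then show ?thesis by simp
  qed
  have h0: "h x = (\<integral>y. K x y * f0 y \<partial>lborel)" for x unfolding h_def Kf ..
  have bh: "bcs h"
  proof (rule bcsI[where M="M * (\<integral>y. norm (f0 y) \<partial>lborel)" and X="cball 0 R"])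
    have "(\<lambda>z. K (fst z) (snd z)) \<in> borel_measurable (borel \<Otimes>\<^sub>M borel)" using bcs_measurable[OF K] by (simp only: borel_prod)
    then have "(\<lambda>z. K (fst z) (snd z) * f0 (snd z)) \<in> borel_measurable (borel \<Otimes>\<^sub>M borel)" by measurable
    then have "(\<lambda>(x, y). K x y * f0 y) \<in> borel_measurable (borel \<Otimes>\<^sub>M lborel)"
      by (subst measurable_cong_sets[OF sets_pair_measure_cong[OF refl sets_lborel] refl]) (simp add: case_prod_beta')
    then show "h \<in> borel_measurable borel"
      unfolding h0[abs_def] using lborel.borel_measurable_lebesgue_integral[of "\<lambda>x y. K x y * f0 y" borel] by simp
    show "norm (h x) \<le> M * (\<integral>y. norm (f0 y) \<partial>lborel)" for x unfolding h0 by (rule Kw[OF if0])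
    show "x \<in> cball 0 R" if "h x \<noteq> 0" for x
    proof (rule ccontr)
      assume "x \<notin> cball 0 R"
      then have "K x y = 0" for y using KR[of x y] by auto
      then show False using that unfolding h0 by simp
    qed
  qed simp
  have [measurable]: "h \<in> borel_measurable borel" by (rule bcs_measurable[OF bh])
  \<comment> \<open>At a zero of \<open>h\<close> also \<open>g\<close> is 0, and
    \<open>0 powr a = 0\<close> even for negative \<open>a\<close>; so p < 2 is no
    exception.\<close>
  define g where "g x = cnj (h x) * complex_of_real (norm (h x) powr (p - 2))" for x
  have ng: "norm (g x) = norm (h x) powr (p - 1)" for x
  proof (cases "h x = 0")
    case False
    then have "norm (g x) = norm (h x) powr 1 * norm (h x) powr (p - 2)" by (simp add: g_def norm_mult)
    then show ?thesis unfolding powr_add[symmetric] by simp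
  qed (simp add: g_def)
  have hg: "h x * g x = complex_of_real (norm (h x) powr p)" for x
  proof (cases "h x = 0")
    case False
    have "h x * g x = complex_of_real ((norm (h x))\<^sup>2) * complex_of_real (norm (h x) powr (p - 2))"
      unfolding g_def complex_norm_square by (simp only: mult.assoc)
    also have "\<dots> = complex_of_real (norm (h x) powr 2 * norm (h x) powr (p - 2))" using False by (simp add: powr_numeral)
    finally show ?thesis unfolding powr_add[symmetric] by simp
  qed simp
  have bg: "bcs g"
  proof -
    obtain H where H: "H > 0" "\<And>x. norm (h x) \<le> H" using bcs_bound[OF bh] by metis
    have [measurable]: "cnj \<in> borel_measurable borel" by (intro borel_measurable_continuous_onI continuous_intros)
    have "g \<in> borel_measurable borel" unfolding g_def[abs_def] by measurable
    moreover have "norm (g x) \<le> H powr (p - 1)" for x unfolding ng using H p by (intro powr_mono2) auto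
    moreover have "bounded {x. h x \<noteq> 0}" using bh by (simp add: bcs_def)
    moreover have "x \<in> {x. h x \<noteq> 0}" if "g x \<noteq> 0" for x using that unfolding g_def by auto
    ultimately show ?thesis using bcsI by metis
  qed
  define F where "F = Lp_norm p f"
  have F0: "F \<ge> 0" unfolding F_def by (rule Lp_norm_nonneg)
  define H where "H = (\<integral>x. norm (h x) powr p \<partial>lborel)"
  have H0: "H \<ge> 0" unfolding H_def by (simp add: integral_nonneg_AE)
  have "norm (\<integral>x. h x * g x \<partial>lborel) = H" unfolding hg integral_complex_of_real H_def[symmetric] using H0 by simp
  have gq: "Lp_norm q g = H powr (1/q)" unfolding Lp_norm_def ng powr_powr qp H_def ..
  \<comment> \<open>Truncation lowers the modulus, so the L^p norms stay below \<open>F\<close>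
    while the L^1 error \<open>e n\<close> tends to 0.\<close>
  define fn where "fn n y = f0 y * indicator {y. norm (f0 y) \<le> real n} y" for n :: nat and y
  have bfn: "bcs (fn n)" for n
  proof (rule bcsI[where M="real n" and X=Y])
    show "fn n \<in> borel_measurable borel" unfolding fn_def[abs_def] by measurable
    show "norm (fn n y) \<le> real n" for y unfolding fn_def by (auto simp: indicator_def)
    show "y \<in> Y" if "fn n y \<noteq> 0" for y using that unfolding fn_def f0_def by (auto simp: indicator_def split: if_splits)
  qed (rule Y(2))
  have Lfn: "Lp_norm p (fn n) \<le> F" for n
    unfolding F_def Lp_norm_def
  proof (rule powr_mono2)
    show "(\<integral>x. norm (fn n x) powr p \<partial>lborel) \<le> (\<integral>x. norm (f x) powr p \<partial>lborel)"
      using p by (intro integral_mono bcs_powr_integrable[OF bfn] ip powr_mono2) (auto simp: fn_def f0_def indicator_def)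
  qed (use p in \<open>auto intro: integral_nonneg_AE\<close>)
  define e where "e n = (\<integral>y. norm (f0 y - fn n y) \<partial>lborel)" for n
  have e0: "e \<longlonglongrightarrow> 0"
  proof -
    have "(\<lambda>n. \<integral>y. norm (f0 y - fn n y) \<partial>lborel) \<longlonglongrightarrow> (\<integral>y. norm (0::complex) \<partial>(lborel :: 'b measure))"
    proof (rule integral_dominated_convergence[where w="\<lambda>y. norm (f0 y)"])
      show "integrable lborel (\<lambda>y. norm (f0 y))" using if0 by simp
      show "(\<lambda>y. norm (f0 y - fn n y)) \<in> borel_measurable lborel" for n using bcs_measurable[OF bfn[of n]] by simp
      show "AE y in lborel. (\<lambda>n. norm (f0 y - fn n y)) \<longlonglongrightarrow> norm (0::complex)"
      proof (rule AE_I2)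
        fix y
        obtain n0 :: nat where n0: "norm (f0 y) \<le> real n0" using real_arch_simple by blast
        have "eventually (\<lambda>n. norm (f0 y - fn n y) = norm (0::complex)) sequentially"
          using eventually_ge_at_top[of n0] by eventually_elim (use n0 in \<open>auto simp: fn_def indicator_def\<close>)
        then show "(\<lambda>n. norm (f0 y - fn n y)) \<longlonglongrightarrow> norm (0::complex)" by (rule tendsto_eventually)
      qed
      show "AE y in lborel. norm (norm (f0 y - fn n y)) \<le> norm (f0 y)" for n
        by (intro AE_I2) (auto simp: fn_def indicator_def)
    qed simp
    then show ?thesis unfolding e_def by simp
  qed
  define Gi where "Gi = (\<integral>x. norm (g x) \<partial>lborel)"
  have key: "H \<le> N * F * Lp_norm q g + M * e n * Gi" for n
  proof -
    define hn where "hn x = (\<integral>y. K x y * fn n y \<partial>lborel)" for x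
    have hn: "h x - hn x = (\<integral>y. K x y * (f0 y - fn n y) \<partial>lborel)" for x
      unfolding h0 hn_def using iK[OF if0, of x] iK[OF bcs_integrable[OF bfn], of x n] by (simp add: algebra_simps)
    have iw: "integrable lborel (\<lambda>y. f0 y - fn n y)" using if0 bcs_integrable[OF bfn] by simp
    have bhn: "bcs hn"
    proof -
      obtain Mf where Mf: "Mf > 0" "\<And>x. norm (fn n x) \<le> Mf" using bcs_bound[OF bfn[of n]] by metis
      have [measurable]: "fn n \<in> borel_measurable borel" by (rule bcs_measurable[OF bfn])
      have m1: "(\<lambda>z :: 'a \<times> 'b. fn n (snd z)) \<in> borel_measurable (borel \<Otimes>\<^sub>M borel)" by measurable
      have "bcs (\<lambda>z. K (fst z) (snd z) * fn n (snd z))"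
        by (rule bcs_mult[OF K m1[unfolded borel_prod], of Mf]) (use Mf in auto)
      from bcs_partial_integral[OF this] show ?thesis unfolding hn_def[abs_def] by simp
    qed
    have "bil K (fn n) g = (\<integral>x. hn x * g x \<partial>lborel)"
      unfolding bil_def hn_def using iK[OF bcs_integrable[OF bfn]] by simp
    then have "(\<integral>x. h x * g x \<partial>lborel) = bil K (fn n) g + (\<integral>x. (h x - hn x) * g x \<partial>lborel)"
      using bcs_integrable[OF bcs_bcs_mult[OF bh bg]] bcs_integrable[OF bcs_bcs_mult[OF bhn bg]] by (simp add: left_diff_distrib)
    then have "H \<le> norm (bil K (fn n) g) + norm (\<integral>x. (h x - hn x) * g x \<partial>lborel)"
      using \<open>norm (\<integral>x. h x * g x \<partial>lborel) = H\<close> norm_triangle_ineq by metis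
    also have "norm (bil K (fn n) g) \<le> N * Lp_norm p (fn n) * Lp_norm q g" by (rule bil[OF bfn bg])
    also have "\<dots> \<le> N * F * Lp_norm q g"
      using Lfn N by (intro mult_right_mono mult_left_mono Lp_norm_nonneg) auto
    also have "norm (\<integral>x. (h x - hn x) * g x \<partial>lborel) \<le> (\<integral>x. (M * e n) * norm (g x) \<partial>lborel)"
    proof (rule norm_integral_le)
      show "integrable lborel (\<lambda>x. M * e n * norm (g x))" using bcs_integrable[OF bg] by simp
      show "norm ((h x - hn x) * g x) \<le> M * e n * norm (g x)" for x
        unfolding norm_mult hn e_def by (rule mult_right_mono[OF Kw[OF iw]]) simp
    qed
    finally show ?thesis unfolding Gi_def by simp
  qed
  have "(\<lambda>n. N * F * Lp_norm q g + M * e n * Gi) \<longlonglongrightarrow> N * F * Lp_norm q g + M * 0 * Gi"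
    by (intro tendsto_intros e0)
  then have "H \<le> N * F * Lp_norm q g + M * 0 * Gi"
    by (rule LIMSEQ_le_const) (use key in auto)
  then have HF: "H \<le> N * F * H powr (1/q)" unfolding gq by simp
  \<comment> \<open>\<open>H\<close> is the integral of an integrable function because
    \<open>h\<close> is in \<open>bcs\<close>; if it is positive, the factor
    \<open>H powr (1/q)\<close> can be cancelled.\<close>
  have "H powr (1/p) \<le> N * F"
  proof (cases "H = 0")
    case False
    then have Hp: "H > 0" using H0 by simp
    have "H powr (1/p) * H powr (1/q) = H" unfolding powr_add[symmetric] pq using Hp by simp
    then have "H powr (1/p) * H powr (1/q) \<le> N * F * H powr (1/q)" using HF by simp
    then show ?thesis using Hp by simp
  qed (use N F0 in simp)
  then have "Lp_norm p h \<le> N * F" unfolding Lp_norm_def H_def .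
  moreover have "memLp p h" by (rule bcs_memLp[OF bh]) (use p in simp)
  ultimately show ?thesis unfolding F_def by blast
qed

section \<open>Sharpness\<close>

lemma measure_cball_pos:
  assumes "r > 0" shows "measure lborel (cball (0::real^'n) r) = unit_ball_vol (real CARD('n)) * r powr real CARD('n)"
  using content_cball[of r "0::real^'n"] assms by (simp add: powr_realpow)

lemma Lp_norm_lower_bound:
  fixes h :: "'a::euclidean_space \<Rightarrow> complex"
  assumes h: "memLp p h" and p: "p > 0" and X: "X \<in> sets borel" "bounded X" and \<beta>: "\<beta> \<ge> 0" "\<And>x. x \<in> X \<Longrightarrow> \<beta> \<le> norm (h x)"
  shows "\<beta> * measure lborel X powr (1/p) \<le> Lp_norm p h"
proof -
  have "\<beta> powr p * measure lborel X = (\<integral>x. \<beta> powr p * indicator X x \<partial>lborel)" by simp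
  also have "\<dots> \<le> (\<integral>x. norm (h x) powr p \<partial>lborel)"
  proof (rule integral_mono)
    show "integrable lborel (\<lambda>x. \<beta> powr p * indicator X x)"
      using X bounded_finite_measure[OF X(2)] by (intro integrable_mult_right integrable_real_indicator) auto
    show "integrable lborel (\<lambda>x. norm (h x) powr p)" using h by (simp add: memLp_def)
    show "\<beta> powr p * indicator X x \<le> norm (h x) powr p" for x
      using \<beta> p by (auto simp: indicator_def intro: powr_mono2)
  qed
  finally have "(\<beta> powr p * measure lborel X) powr (1/p) \<le> Lp_norm p h"
    unfolding Lp_norm_def using p by (intro powr_mono2) auto
  then show ?thesis using \<beta> p by (simp add: powr_mult powr_powr)
qed

text \<open>On a ball of radius comparable to \<open>|lam| powr (-1/d)\<close> the phase is at most 1 in modulus, so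
  there is no cancellation.\<close>

lemma osc_op_lower_bound:
  fixes S \<phi> :: "real^'n \<Rightarrow> real^'m \<Rightarrow> real"
  assumes S_cont: "continuous_on UNIV (\<lambda>z. S (fst z) (snd z))" and S_hom: "\<And>x y r. S (r *\<^sub>R x) (r *\<^sub>R y) = r ^ d * S x y"
    and d: "d > 0" and \<phi>_cont: "continuous_on UNIV (\<lambda>z. \<phi> (fst z) (snd z))" and \<phi>0: "\<phi> 0 0 \<noteq> 0"
    and p: "p > 1" and \<gamma>: "\<gamma> = real CARD('n) / real d * (1/p) + real CARD('m) / real d * (1 - 1/p)"
    and ker_int: "\<And>lam f x. memLp p f \<Longrightarrow> integrable lborel (\<lambda>y. exp (\<i> * complex_of_real (lam * S x y)) * complex_of_real (\<phi> x y) * f y)"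
    and mem: "\<And>lam f. lam \<noteq> 0 \<Longrightarrow> memLp p f \<Longrightarrow> memLp p (osc_op S \<phi> lam f)"
  obtains c \<Lambda> where "c > 0" "\<Lambda> > 0"
    "\<And>lam. \<bar>lam\<bar> \<ge> \<Lambda> \<Longrightarrow> \<exists>f. memLp p f \<and> Lp_norm p f \<le> 1 \<and> c * \<bar>lam\<bar> powr (- \<gamma>) \<le> Lp_norm p (osc_op S \<phi> lam f)"
proof -
  define c0 where "c0 = \<bar>\<phi> 0 0\<bar> / 2"
  have c0: "c0 > 0" unfolding c0_def using \<phi>0 by simp
  \<comment> \<open>Multiplying by the sign makes the amplitude positive near the origin, at least
    half its modulus there.\<close>
  define \<sigma> where "\<sigma> = sgn (\<phi> 0 0)"
  obtain r0 where r0: "r0 > 0" "\<And>x y. norm (x, y) < r0 \<Longrightarrow> c0 \<le> \<sigma> * \<phi> x y"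
  proof -
    have "isCont (\<lambda>z. \<phi> (fst z) (snd z)) 0" using \<phi>_cont unfolding continuous_on_eq_continuous_at[OF open_UNIV] by blast
    then obtain r0 where r0: "r0 > 0" "\<And>z. dist z 0 < r0 \<Longrightarrow> dist (\<phi> (fst z) (snd z)) (\<phi> 0 0) < c0"
      using c0 unfolding continuous_at_eps_delta by (metis fst_zero snd_zero)
    show thesis
    proof (rule that[OF r0(1)])
      fix x :: "real^'n" and y :: "real^'m" assume "norm (x, y) < r0"
      then have "\<bar>\<phi> x y - \<phi> 0 0\<bar> < c0" using r0(2)[of "(x, y)"] by (simp add: dist_norm)
      then show "c0 \<le> \<sigma> * \<phi> x y" unfolding \<sigma>_def c0_def by (auto simp: sgn_if abs_if split: if_splits)
    qed
  qed
  \<comment> \<open>A family with one member, in the form that \<open>homogeneous_bound\<close>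
    expects.\<close>
  define T where "T = (\<lambda>(k::unit) z. S (fst z) (snd z))"
  obtain Cs where Cs: "Cs \<ge> 0" "\<And>\<rho> z k. \<rho> > 0 \<Longrightarrow> norm z \<le> 1 * \<rho> \<Longrightarrow> \<rho> ^ 0 * \<bar>T k z\<bar> \<le> Cs * \<rho> ^ d"
  proof (rule homogeneous_bound[where T=T and e=0 and d=d and R=1])
    show "continuous_on UNIV (T k)" for k unfolding T_def by (rule S_cont)
    show "r ^ 0 * T k (r *\<^sub>R z) = r ^ d * T k z" for k r z unfolding T_def using S_hom by simp
    fix C :: real
    assume "0 \<le> C" "\<And>\<rho> z k. \<rho> > 0 \<Longrightarrow> norm z \<le> 1 * \<rho> \<Longrightarrow> \<rho> ^ 0 * \<bar>T k z\<bar> \<le> C * \<rho> ^ d"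
    then show thesis by (rule that)
  qed
  have Sb: "\<bar>S x y\<bar> \<le> Cs * \<rho> ^ d" if "\<rho> > 0" "norm (x, y) \<le> \<rho>" for x y \<rho>
    using Cs(2)[of \<rho> "(x, y)"] that unfolding T_def by simp
  \<comment> \<open>Since \<eta> \<le> 1 and d \<ge> 1, Cs \<eta>^d \<le> Cs \<eta> \<le> 1: within
    radius \<eta> |lam|^(-1/d) the phase stays in [-1, 1].\<close>
  define \<eta> where "\<eta> = 1 / (Cs + 1)"
  have \<eta>: "0 < \<eta>" "\<eta> \<le> 1" unfolding \<eta>_def using Cs by auto
  have C\<eta>: "Cs * \<eta> ^ d \<le> 1"
  proof -
    have "\<eta> ^ d \<le> \<eta> ^ 1" using \<eta> d by (intro power_decreasing) auto
    then have "Cs * \<eta> ^ d \<le> Cs * \<eta>" using Cs by (simp add: mult_left_mono)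
    also have "\<dots> \<le> 1" unfolding \<eta>_def using Cs by simp
    finally show ?thesis .
  qed
  define V where "V = unit_ball_vol (real CARD('n))"
  define W where "W = unit_ball_vol (real CARD('m))"
  have VW: "V > 0" "W > 0" unfolding V_def W_def by simp_all
  have d\<gamma>: "real CARD('n) / p + real CARD('m) * (1 - 1/p) = d * \<gamma>" unfolding \<gamma> using d by (simp add: distrib_left)
  define c where "c = c0 / 2 * (W powr (1 - 1/p) * V powr (1/p)) * (\<eta> / 2) powr (d * \<gamma>)"
  \<comment> \<open>Large enough for the radius \<rho> below to stay under \<open>r0\<close>, where
    the amplitude is bounded below; the added 1 gives strict inequalities.\<close>
  define \<Lambda> where "\<Lambda> = (1 / r0) powr d + 1"
  show thesis
  proof (rule that[of c \<Lambda>])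
    show "c > 0" unfolding c_def using c0 VW \<eta> by simp
    show "\<Lambda> > 0" unfolding \<Lambda>_def by (simp add: add_nonneg_pos)
    fix lam :: real assume lam: "\<bar>lam\<bar> \<ge> \<Lambda>"
    define L where "L = \<bar>lam\<bar>"
    have L: "L > 0" "L > (1 / r0) powr d" using lam powr_ge_zero[of "1 / r0" "real d"] unfolding L_def \<Lambda>_def by linarith+
    have lam0: "lam \<noteq> 0" using L unfolding L_def by auto
    define \<rho> where "\<rho> = \<eta> * L powr (- (1/d))"
    have \<rho>: "\<rho> > 0" unfolding \<rho>_def using \<eta> L by simp
    have \<rho>r: "\<rho> < r0"
    proof -
      have "((1 / r0) powr d) powr (1/d) < L powr (1/d)" using L d by (intro powr_less_mono2) auto
      then have "1 / r0 < L powr (1/d)" using d r0 by (simp add: powr_powr)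
      then have "L powr (- (1/d)) < r0" using r0 L by (simp add: powr_minus field_simps)
      moreover have "\<rho> \<le> L powr (- (1/d))" unfolding \<rho>_def using mult_right_mono[OF \<eta>(2), of "L powr (- (1/d))"] by simp
      ultimately show ?thesis by simp
    qed
    have L\<rho>: "L * (Cs * \<rho> ^ d) \<le> 1"
    proof -
      have "\<rho> ^ d = \<eta> ^ d * (L powr (- (1/d))) ^ d" unfolding \<rho>_def by (simp add: power_mult_distrib)
      also have "(L powr (- (1/d))) ^ d = L powr (-1)" using L d by (simp add: powr_realpow[symmetric] powr_powr)
      finally have "L * (Cs * \<rho> ^ d) = Cs * \<eta> ^ d" using L by (simp add: powr_minus)
      with C\<eta> show ?thesis by (simp only:)
    qed
    \<comment> \<open>Half the radius for each variable, so that |(x, y)| \<le> |x| + |y| \<le>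
      \<rho>.\<close>
    define X where "X = cball (0::real^'n) (\<rho>/2)"
    define Y where "Y = cball (0::real^'m) (\<rho>/2)"
    define mY where "mY = measure lborel Y"
    have mX: "measure lborel X = V * (\<rho>/2) powr real CARD('n)" and mY: "mY = W * (\<rho>/2) powr real CARD('m)"
      unfolding X_def Y_def V_def W_def mY_def using measure_cball_pos[of "\<rho>/2"] \<rho> by auto
    have mYp: "mY > 0" unfolding mY using VW \<rho> by simp
    have Yb: "Y \<in> sets borel" "bounded Y" and Xb: "X \<in> sets borel" "bounded X" unfolding X_def Y_def by auto
    define \<alpha> where "\<alpha> = mY powr (- (1/p))"
    have \<alpha>: "\<alpha> > 0" unfolding \<alpha>_def using mYp by simp
    define f where "f y = complex_of_real \<alpha> * indicator Y y" for y
    have bf: "bcs f"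
      unfolding f_def by (subst mult.commute, rule bcs_mult[OF bcs_of_real_indicator[OF Yb(2,1)], where M="\<alpha>"]) (use \<alpha> in auto)
    have mf: "memLp p f" by (rule bcs_memLp[OF bf]) (use p in simp)
    have "Lp_norm p f = 1"
    proof -
      have "norm (f y) powr p = \<alpha> powr p * indicator Y y" for y
        unfolding f_def using \<alpha> p by (auto simp: indicator_def norm_mult)
      then have "Lp_norm p f = (\<alpha> powr p * mY) powr (1/p)" unfolding Lp_norm_def mY_def by simp
      also have "\<alpha> powr p = mY powr (-1)" unfolding \<alpha>_def powr_powr using p by simp
      also have "mY powr (-1) = 1 / mY" using mYp by (simp add: powr_minus_divide)
      finally show ?thesis using mYp by simp
    qed
    define k where "k x y = exp (\<i> * complex_of_real (lam * S x y)) * complex_of_real (\<phi> x y)" for x y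
    have low: "c0 / 2 * \<alpha> * mY \<le> norm (osc_op S \<phi> lam f x)" if x: "x \<in> X" for x
    proof -
      have pt: "c0 / 2 * \<alpha> * indicator Y y \<le> Re (complex_of_real \<sigma> * (k x y * f y))" for y
      proof (cases "y \<in> Y")
        case True
        have xy: "norm (x, y) \<le> \<rho>"
          using norm_Pair_le[of x y] x True unfolding X_def Y_def by simp
        have "\<bar>lam * S x y\<bar> \<le> L * (Cs * \<rho> ^ d)" unfolding abs_mult L_def by (rule mult_left_mono[OF Sb[OF \<rho> xy]]) simp
        then have "\<bar>lam * S x y\<bar> \<le> 1" using L\<rho> by simp
        \<comment> \<open>As 1 < pi/3, the cosine of a phase of modulus at most 1 is at least
          1/2.\<close>
        then have "cos 1 \<le> cos \<bar>lam * S x y\<bar>" using pi_gt3 by (subst cos_mono_le_eq) auto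
        moreover have "1/2 \<le> cos (1::real)"
        proof -
          have "cos (pi/3) \<le> cos (1::real)" using pi_gt3 by (subst cos_mono_le_eq) auto
          then show ?thesis by (simp add: cos_60)
        qed
        ultimately have cs: "1/2 \<le> cos (lam * S x y)" by simp
        have "c0 \<le> \<sigma> * \<phi> x y" using r0(2)[of x y] xy \<rho>r by simp
        then have "c0 * (1/2) \<le> (\<sigma> * \<phi> x y) * cos (lam * S x y)" using cs c0 by (intro mult_mono) auto
        then have "c0 * (1/2) * \<alpha> \<le> (\<sigma> * \<phi> x y) * cos (lam * S x y) * \<alpha>" using \<alpha> by (intro mult_right_mono) auto
        moreover have "Re (complex_of_real \<sigma> * (k x y * f y)) = (\<sigma> * \<phi> x y) * cos (lam * S x y) * \<alpha>"
          using True unfolding k_def f_def by (simp add: Re_exp Im_exp)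
        moreover have "c0 / 2 * \<alpha> * indicator Y y = c0 * (1/2) * \<alpha>" using True by simp
        ultimately show ?thesis by (simp only:)
      qed (simp add: f_def)
      have ik: "integrable lborel (\<lambda>y. k x y * f y)" unfolding k_def by (rule ker_int[OF mf])
      have "c0 / 2 * \<alpha> * mY = (\<integral>y. c0 / 2 * \<alpha> * indicator Y y \<partial>lborel)" unfolding mY_def by simp
      also have "\<dots> \<le> (\<integral>y. Re (complex_of_real \<sigma> * (k x y * f y)) \<partial>lborel)"
      proof (rule integral_mono[OF _ _ pt])
        show "integrable lborel (\<lambda>y. c0 / 2 * \<alpha> * indicator Y y)"
          using Yb bounded_finite_measure[OF Yb(2)] by (intro integrable_mult_right integrable_real_indicator) auto
        show "integrable lborel (\<lambda>y. Re (complex_of_real \<sigma> * (k x y * f y)))"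
          by (intro integrable_Re integrable_mult_right) (use ik in auto)
      qed
      also have "\<dots> = Re (complex_of_real \<sigma> * osc_op S \<phi> lam f x)"
      proof -
        have "(\<integral>y. Re (complex_of_real \<sigma> * (k x y * f y)) \<partial>lborel) = Re (\<integral>y. complex_of_real \<sigma> * (k x y * f y) \<partial>lborel)"
          by (rule integral_Re) (use ik in \<open>intro integrable_mult_right, auto\<close>)
        then show ?thesis unfolding osc_op_def k_def by simp
      qed
      also have "\<dots> \<le> norm (complex_of_real \<sigma> * osc_op S \<phi> lam f x)" by (rule complex_Re_le_cmod)
      also have "\<dots> = norm (osc_op S \<phi> lam f x)" unfolding norm_mult \<sigma>_def using \<phi>0 by (simp add: sgn_if)
      finally show ?thesis .
    qed
    have "c * L powr (- \<gamma>) = (c0 / 2 * \<alpha> * mY) * measure lborel X powr (1/p)"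
    proof -
      have "\<alpha> * mY = mY powr (1 - 1/p)"
        unfolding \<alpha>_def using mYp powr_add[of mY "- (1/p)" 1] by simp
      also have "\<dots> = W powr (1 - 1/p) * (\<rho>/2) powr (real CARD('m) * (1 - 1/p))"
        unfolding mY using VW \<rho> by (simp add: powr_mult powr_powr)
      finally have 1: "\<alpha> * mY = W powr (1 - 1/p) * (\<rho>/2) powr (real CARD('m) * (1 - 1/p))" .
      have 2: "measure lborel X powr (1/p) = V powr (1/p) * (\<rho>/2) powr (real CARD('n) / p)"
        unfolding mX using VW \<rho> by (simp add: powr_mult powr_powr)
      have "(\<rho>/2) powr (d * \<gamma>) = (\<eta>/2) powr (d * \<gamma>) * L powr (- \<gamma>)"
      proof -
        have "\<rho>/2 = (\<eta>/2) * L powr (- (1/d))" unfolding \<rho>_def by simp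
        then have "(\<rho>/2) powr (d * \<gamma>) = (\<eta>/2) powr (d * \<gamma>) * (L powr (- (1/d))) powr (d * \<gamma>)"
          using \<eta> by (simp only: powr_mult)
        also have "(L powr (- (1/d))) powr (d * \<gamma>) = L powr (- \<gamma>)" using d by (simp add: powr_powr)
        finally show ?thesis .
      qed
      moreover have "(c0 / 2 * \<alpha> * mY) * measure lborel X powr (1/p) = c0 / 2 * (W powr (1 - 1/p) * V powr (1/p)) * ((\<rho>/2) powr (real CARD('n) / p) * (\<rho>/2) powr (real CARD('m) * (1 - 1/p)))"
        using 1 2 by (simp add: mult_ac)
      ultimately have "(c0 / 2 * \<alpha> * mY) * measure lborel X powr (1/p) = c * L powr (- \<gamma>)"
        unfolding powr_add[symmetric] d\<gamma> c_def by (simp add: mult_ac)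
      then show ?thesis by (rule sym)
    qed
    also have "\<dots> \<le> Lp_norm p (osc_op S \<phi> lam f)"
      by (rule Lp_norm_lower_bound[OF mem[OF lam0 mf] _ Xb _ low]) (use p c0 \<alpha> mYp in auto)
    finally show "\<exists>f. memLp p f \<and> Lp_norm p f \<le> 1 \<and> c * \<bar>lam\<bar> powr (- \<gamma>) \<le> Lp_norm p (osc_op S \<phi> lam f)"
      using mf \<open>Lp_norm p f = 1\<close> unfolding L_def by auto
  qed
qed

section \<open>The oscillatory kernel and the final estimate\<close>

abbreviation osc_kernel :: "(real^'n \<Rightarrow> real^'m \<Rightarrow> real) \<Rightarrow> (real^'n \<Rightarrow> real^'m \<Rightarrow> real) \<Rightarrow> real \<Rightarrow> real^'n \<Rightarrow> real^'m \<Rightarrow> complex" where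
  "osc_kernel S \<phi> lam x y \<equiv> exp (\<i> * complex_of_real (lam * S x y)) * complex_of_real (\<phi> x y)"

text \<open>The locales take derivatives and constants as parameters. Here these are produced from
  the hypotheses and hidden again, leaving one constant independent of \<open>lam\<close>,
  \<open>f\<close> and \<open>g\<close>.\<close>

lemma osc_kernel_bilinear_bound:
  fixes S \<phi> :: "real^'n \<Rightarrow> real^'m \<Rightarrow> real"
  assumes hom: "homogeneous_poly d S" and d: "d > 0"
    and sm: "smooth (\<lambda>z :: (real^'n) \<times> (real^'m). \<phi> (fst z) (snd z))"
    and cpt: "compact (closure {z :: (real^'n) \<times> (real^'m). \<phi> (fst z) (snd z) \<noteq> 0})"
    and rank1: "rank_one_condition S"
    and p: "p > 1" and pq: "1/p + 1/q = 1"
    and \<gamma>: "\<gamma> = real CARD('n) / real d * (1/p) + real CARD('m) / real d * (1 - 1/p)" and \<gamma>_less: "\<gamma> * max p q < 1"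
  shows "(\<forall>lam. bcs (\<lambda>z. osc_kernel S \<phi> lam (fst z) (snd z))) \<and>
    (\<exists>C\<ge>0. \<forall>lam f g. lam \<noteq> 0 \<longrightarrow> bcs f \<longrightarrow> bcs g \<longrightarrow>
      norm (bil (osc_kernel S \<phi> lam) f g) \<le> C * \<bar>lam\<bar> powr (- \<gamma>) * Lp_norm p f * Lp_norm q g)"
proof (rule homogeneous_poly_phase[OF hom])
  fix S1 S2 S11 S21
  assume "homogeneous_phase S d S1 S2 S11 S21" and mixed: "\<And>i j x y. mixed_partial S i j x y = S11 i j x y"
  then interpret homogeneous_phase S d S1 S2 S11 S21 by blast
  define D where "D = real CARD('n) + real CARD('m)"
  \<comment> \<open>The pairs \<open>(i, j)\<close> form one finite index type; the rank one
    condition says that away from the origin some \<open>T k\<close> is nonzero.\<close>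
  define T where "T = (\<lambda>k z. S11 (fst k) (snd k) (fst z) (snd z))"
  define U where "U = (\<lambda>k z. S21 (fst k) (snd k) (fst z) (snd z))"
  have T_nz: "\<exists>k. T k z \<noteq> 0" if "z \<noteq> 0" for z
  proof -
    have "(fst z, snd z) \<noteq> (0, 0)" using that by (simp add: prod_eq_iff)
    then have "\<exists>i j. S11 i j (fst z) (snd z) \<noteq> 0" using rank1 unfolding rank_one_condition_def mixed by blast
    then show ?thesis unfolding T_def by force
  qed
  have T_cont: "continuous_on UNIV (T k)" and U_cont: "continuous_on UNIV (U k)" for k
    unfolding T_def U_def by (rule S11_cont S21_cont)+
  have T_hom: "r ^ 2 * T k (r *\<^sub>R z) = r ^ d * T k z" and U_hom: "r ^ 3 * U k (r *\<^sub>R z) = r ^ d * U k z" for k r z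
    unfolding T_def U_def fst_scaleR snd_scaleR by (rule S11_hom S21_hom)+
  show ?thesis
  proof (rule nondegenerate_on_annulus[OF T_cont T_hom T_nz, of D], assumption,
      rule homogeneous_bound[OF U_cont U_hom, of D], rule smooth_cutoff[OF sm cpt])
    fix \<kappa> \<eta> C2 :: real and \<phi>1 M M1 R
    assume \<kappa>: "\<kappa> > 0" and \<eta>: "\<eta> > 0" and C2: "C2 \<ge> 0"
      and nd: "\<And>\<rho> z0. \<rho> > 0 \<Longrightarrow> \<rho> / 2 \<le> norm z0 \<Longrightarrow> norm z0 \<le> D * \<rho> \<Longrightarrow>
        \<exists>k. \<forall>z. dist z0 z < \<eta> * \<rho> \<longrightarrow> \<kappa> * \<rho> ^ d \<le> \<rho> ^ 2 * \<bar>T k z\<bar>"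
      and bd: "\<And>\<rho> z k. \<rho> > 0 \<Longrightarrow> norm z \<le> D * \<rho> \<Longrightarrow> \<rho> ^ 3 * \<bar>U k z\<bar> \<le> C2 * \<rho> ^ d"
      and \<phi>: "cutoff \<phi> \<phi>1 M M1 R"
    interpret cutoff \<phi> \<phi>1 M M1 R by (rule \<phi>)
    have nd': "\<exists>i j. \<forall>x y. dist (x0, y0) (x, y) < \<eta> * \<rho> \<longrightarrow> \<kappa> * \<rho> ^ d \<le> \<rho> ^ 2 * \<bar>S11 i j x y\<bar>"
      if h: "\<rho> > 0" "\<rho> / 2 \<le> norm (x0, y0)" "norm (x0, y0) \<le> (real CARD('n) + real CARD('m)) * \<rho>" for \<rho> x0 y0
    proof -
      obtain k where "\<forall>z. dist (x0, y0) z < \<eta> * \<rho> \<longrightarrow> \<kappa> * \<rho> ^ d \<le> \<rho> ^ 2 * \<bar>T k z\<bar>"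
        using nd[OF h[folded D_def]] ..
      then show ?thesis unfolding T_def by (intro exI[of _ "fst k"] exI[of _ "snd k"]) simp
    qed
    have bd': "\<rho> ^ 3 * \<bar>S21 i j x y\<bar> \<le> C2 * \<rho> ^ d"
      if "\<rho> > 0" "norm (x, y) \<le> (real CARD('n) + real CARD('m)) * \<rho>" for \<rho> i j x y
      using bd[OF that[folded D_def], of "(i, j)"] unfolding U_def by simp
    interpret nondegenerate_data S \<phi> d S1 S2 S11 S21 \<phi>1 M M1 R \<kappa> \<eta> C2
      by unfold_locales (fact \<kappa> \<eta> C2 nd' bd')+
    have ker: "ker lam = osc_kernel S \<phi> lam" for lam by (intro ext) (rule ker_def)
    have "\<forall>lam. bcs (\<lambda>z. osc_kernel S \<phi> lam (fst z) (snd z))" using ker_bcs unfolding ker by blast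
    moreover have "\<exists>C\<ge>0. \<forall>lam f g. lam \<noteq> 0 \<longrightarrow> bcs f \<longrightarrow> bcs g \<longrightarrow>
      norm (bil (osc_kernel S \<phi> lam) f g) \<le> C * \<bar>lam\<bar> powr (- \<gamma>) * Lp_norm p f * Lp_norm q g"
      by (rule bil_ker_bound[OF p pq d \<gamma> \<gamma>_less]) (assumption | (unfold ker, blast))+
    ultimately show ?thesis ..
  qed
qed

theorem theorem3p1:
  fixes S :: "real^'n \<Rightarrow> real^'m \<Rightarrow> real"
    and \<phi> :: "real^'n \<Rightarrow> real^'m \<Rightarrow> real"
    and d :: nat and p :: real
  assumes hom: "homogeneous_poly d S"
    and deg: "d > CARD('n) + CARD('m)"
    and smooth_phi: "smooth (\<lambda>z :: (real^'n) \<times> (real^'m). \<phi> (fst z) (snd z))"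
    and supp_phi: "compact (closure {z :: (real^'n) \<times> (real^'m). \<phi> (fst z) (snd z) \<noteq> 0})"
    and rank1: "rank_one_condition S"
    and p_lo: "(real d - real CARD('m) + real CARD('n)) / (real d - real CARD('m)) < p"
    and p_hi: "p < (real d - real CARD('n) + real CARD('m)) / real CARD('m)"
  shows "(\<exists>C. \<forall>lam::real. lam \<noteq> 0 \<longrightarrow>
            (\<forall>f :: real^'m \<Rightarrow> complex. memLp p f \<longrightarrow>
               memLp p (osc_op S \<phi> lam f) \<and>
               Lp_norm p (osc_op S \<phi> lam f)
                 \<le> C * \<bar>lam\<bar> powr (- (real CARD('n) / real d * (1 / p)
                                     + real CARD('m) / real d * (1 - 1 / p)))
                     * Lp_norm p f))
       \<and> ((\<exists>\<epsilon>>0. \<forall>z \<in> ball (0 :: (real^'n) \<times> (real^'m)) \<epsilon>. \<phi> (fst z) (snd z) \<noteq> 0) \<longrightarrow>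
            (\<exists>c>0. \<exists>\<Lambda>. \<forall>lam::real. \<bar>lam\<bar> \<ge> \<Lambda> \<longrightarrow>
               c * \<bar>lam\<bar> powr (- (real CARD('n) / real d * (1 / p)
                                  + real CARD('m) / real d * (1 - 1 / p)))
                 \<le> Lp_opnorm p (osc_op S \<phi> lam)))"
proof -
  define n where "n = real CARD('n)"
  define m where "m = real CARD('m)"
  have nm: "n > 0" "m > 0" unfolding n_def m_def by simp_all
  have dnm: "real d > n + m" unfolding n_def m_def using deg by linarith
  have d0: "d > 0" using deg by simp
  define \<gamma> where "\<gamma> = real CARD('n) / real d * (1/p) + real CARD('m) / real d * (1 - 1/p)"
  have lo: "real d - m + n < p * (real d - m)"
    using p_lo dnm nm unfolding n_def[symmetric] m_def[symmetric] by (simp add: pos_divide_less_eq)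
  have hi: "p * m < real d - n + m"
    using p_hi nm unfolding n_def[symmetric] m_def[symmetric] by (simp add: pos_less_divide_eq)
  have p: "p > 1"
  proof -
    have "1 * (real d - m) < p * (real d - m)" by (rule less_trans[OF _ lo]) (use nm in simp)
    then show ?thesis using dnm nm by (simp add: mult_less_cancel_right)
  qed
  define q where "q = p / (p - 1)"
  have pq: "1/p + 1/q = 1" unfolding q_def using p by (simp add: field_simps)
  \<comment> \<open>The upper end of the range of \<open>p\<close> is the condition
    \<open>\<gamma> * p < 1\<close>, the lower end is \<open>\<gamma> * q < 1\<close>.\<close>
  have \<gamma>_less: "\<gamma> * max p q < 1"
  proof -
    have "\<gamma> * p = (n + m * (p - 1)) / d"
      unfolding \<gamma>_def n_def[symmetric] m_def[symmetric] using p d0 by (simp add: field_simps)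
    also have "\<dots> < 1" using hi d0 by (simp add: pos_divide_less_eq algebra_simps)
    finally have 1: "\<gamma> * p < 1" .
    have "\<gamma> * q = (n + m * (p - 1)) / (d * (p - 1))"
      unfolding \<gamma>_def n_def[symmetric] m_def[symmetric] q_def using p d0 by (simp add: field_simps)
    also have "\<dots> < 1" using lo d0 p by (simp add: pos_divide_less_eq algebra_simps)
    finally show ?thesis using 1 by (simp add: max_def)
  qed
  note ker = osc_kernel_bilinear_bound[OF hom d0 smooth_phi supp_phi rank1 p pq \<gamma>_def \<gamma>_less]
  then have kb: "bcs (\<lambda>z. osc_kernel S \<phi> lam (fst z) (snd z))" for lam by blast
  from ker[THEN conjunct2] obtain C where C0: "C \<ge> 0" and C1: "\<forall>lam f g. lam \<noteq> 0 \<longrightarrow> bcs f \<longrightarrow> bcs g \<longrightarrow>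
      norm (bil (osc_kernel S \<phi> lam) f g) \<le> C * \<bar>lam\<bar> powr (- \<gamma>) * Lp_norm p f * Lp_norm q g"
    by (elim exE conjE)
  note C = C0 C1[rule_format]
  have upper: "memLp p (osc_op S \<phi> lam f) \<and> Lp_norm p (osc_op S \<phi> lam f) \<le> C * \<bar>lam\<bar> powr (- \<gamma>) * Lp_norm p f"
    if "lam \<noteq> 0" "memLp p f" for lam f
  proof -
    have "C * \<bar>lam\<bar> powr (- \<gamma>) \<ge> 0" using C(1) by simp
    from kernel_operator_Lp_bound[OF kb p pq this C(2)[OF that(1)] that(2)]
    show ?thesis unfolding osc_op_def[abs_def] .
  qed
  have "\<exists>c>0. \<exists>\<Lambda>. \<forall>lam::real. \<bar>lam\<bar> \<ge> \<Lambda> \<longrightarrow> c * \<bar>lam\<bar> powr (- \<gamma>) \<le> Lp_opnorm p (osc_op S \<phi> lam)"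
    if nonvan: "\<exists>\<epsilon>>0. \<forall>z \<in> ball (0 :: (real^'n) \<times> (real^'m)) \<epsilon>. \<phi> (fst z) (snd z) \<noteq> 0"
  proof -
    have \<phi>0: "\<phi> 0 0 \<noteq> 0"
    proof -
      from nonvan obtain \<epsilon> where "\<epsilon> > 0" "\<forall>z \<in> ball (0 :: (real^'n) \<times> (real^'m)) \<epsilon>. \<phi> (fst z) (snd z) \<noteq> 0" by (elim exE conjE)
      then have "\<phi> (fst (0 :: (real^'n) \<times> (real^'m))) (snd (0 :: (real^'n) \<times> (real^'m))) \<noteq> 0" by (elim bspec) simp
      then show ?thesis by simp
    qed
    have "higher_diff 0 (\<lambda>z :: (real^'n) \<times> (real^'m). \<phi> (fst z) (snd z))" using smooth_phi unfolding smooth_def by blast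
    then have \<phi>_cont: "continuous_on UNIV (\<lambda>z :: (real^'n) \<times> (real^'m). \<phi> (fst z) (snd z))" by simp
    have ker_int: "integrable lborel (\<lambda>y. osc_kernel S \<phi> lam x y * f y)" if "memLp p f" for lam f x
      using kernel_slice_integrable[OF kb p pq that] .
    obtain S1 S2 S11 S21 where "homogeneous_phase S d S1 S2 S11 S21" by (rule homogeneous_poly_phase[OF hom])
    then interpret homogeneous_phase S d S1 S2 S11 S21 .
    have mem: "memLp p (osc_op S \<phi> lam f)" if "lam \<noteq> 0" "memLp p f" for lam f
      using upper[OF that] by blast
    show ?thesis
    proof (rule osc_op_lower_bound[OF S_cont S_hom d0 \<phi>_cont \<phi>0 p \<gamma>_def ker_int mem])
      fix c \<Lambda> :: real
      assume c: "c > 0" and \<Lambda>: "\<Lambda> > 0"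
        and low: "\<And>lam. \<bar>lam\<bar> \<ge> \<Lambda> \<Longrightarrow> \<exists>f. memLp p f \<and> Lp_norm p f \<le> 1 \<and> c * \<bar>lam\<bar> powr (- \<gamma>) \<le> Lp_norm p (osc_op S \<phi> lam f)"
      have "c * \<bar>lam\<bar> powr (- \<gamma>) \<le> Lp_opnorm p (osc_op S \<phi> lam)" if lam: "\<bar>lam\<bar> \<ge> \<Lambda>" for lam
      proof -
        have lam0: "lam \<noteq> 0" using lam \<Lambda> by auto
        obtain f where f: "memLp p f" "Lp_norm p f \<le> 1" "c * \<bar>lam\<bar> powr (- \<gamma>) \<le> Lp_norm p (osc_op S \<phi> lam f)"
          using low[OF lam] by blast
        \<comment> \<open>\<open>Sup\<close> of an unbounded set of reals carries no information, so
          even the lower bound on the operator norm rests on the upper estimate.\<close>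
        have "bdd_above {Lp_norm p (osc_op S \<phi> lam f) | f. memLp p f \<and> Lp_norm p f \<le> 1}"
        proof (rule bdd_aboveI[where M="C * \<bar>lam\<bar> powr (- \<gamma>)"])
          fix v assume "v \<in> {Lp_norm p (osc_op S \<phi> lam f) | f. memLp p f \<and> Lp_norm p f \<le> 1}"
          then obtain f where v: "v = Lp_norm p (osc_op S \<phi> lam f)" "memLp p f" "Lp_norm p f \<le> 1" by blast
          have "v \<le> C * \<bar>lam\<bar> powr (- \<gamma>) * Lp_norm p f" using upper[OF lam0 v(2)] v(1) by simp
          also have "\<dots> \<le> C * \<bar>lam\<bar> powr (- \<gamma>) * 1" using C(1) v(3) by (intro mult_left_mono) auto
          finally show "v \<le> C * \<bar>lam\<bar> powr (- \<gamma>)" by simp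
        qed
        then have "Lp_norm p (osc_op S \<phi> lam f) \<le> Lp_opnorm p (osc_op S \<phi> lam)"
          unfolding Lp_opnorm_def using f by (intro cSup_upper) blast+
        then show ?thesis using f(3) by linarith
      qed
      then show ?thesis using c by blast
    qed
  qed
  then show ?thesis using upper unfolding \<gamma>_def[symmetric] by blast
qed

end
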